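(* Let $p,q,r$ be real coefficients satisfying the standing hypotheses (a), (b), (c) listed in the context, and assume in addition that $1/p\in L^\infty(\mathbb R)$. Let $$\alpha=2\lVert q_-\rVert_{\mathrm u}+4\lVert 1/p\rVert_\infty\lVert q_-\rVert_{\mathrm u}^2\quad\text{and}\quad \beta=\left(4\lVert 1/p\rVert_\infty\,\alpha\right)^{1/2},$$ and let $g\in L^\infty(\mathbb R)$ be a nonnegative function such that $\mu(\Omega_g)\beta<1$, where $\Omega_g=\{x\in\mathbb R : r(x)g(x)<1\}$. Then $$\min\sigma(T)\geq\frac{-\alpha\lVert g\rVert_\infty}{1-\mu(\Omega_g)\beta}.$$ In the special case $1/r\in L^\infty(\mathbb R)$, the choice $g=1/r$ gives $\mu(\Omega_g)=0$ and $$\min\sigma(T)\geq-\bigl(2\lVert q_-\rVert_{\mathrm u}+4\lVert 1/p\rVert_\infty\lVert q_-\rVert_{\mathrm u}^2\bigr)\lVert 1/r\rVert_\infty.$$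
   Context: Let $p,q,r:\mathbb R\to\mathbb R$ be measurable with $r,1/p,q\in L^1_{\mathrm{loc}}(\mathbb R)$. Let $L^1_{\mathrm u}(\mathbb R)$ be the space of all $h\in L^1_{\mathrm{loc}}(\mathbb R)$ with $\lVert h\rVert_{\mathrm u}:=\sup_{n\in\mathbb Z}\int_n^{n+1}|h(t)|\,\mathrm dt<\infty$. Standing hypotheses: (a) $p(x)>0$ for a.a. $x\in\mathbb R$ and $1/p\in L^\eta(\mathbb R)$ for some $\eta\in[1,\infty]$; (b) $q\in L^1_{\mathrm u}(\mathbb R)$; (c) $r(x)>0$ for a.a. $x\in\mathbb R$ and there exist $a,b\in\mathbb R$ with $a<b$ such that $\operatorname{ess\,inf}_{t\in\mathbb R\setminus[a,b]}r(t)>0$. $L^2_r(\mathbb R)=L^2(\mathbb R;r\,\mathrm dx)$ is the weighted $L^2$-space (complex-valued functions). The operator $T$ in $L^2_r(\mathbb R)$ is the maximal operator $$Tf=\tau f=\frac1r\left(-(pf')'+qf\right),\quad D(T)=\bigl\{f\in L^2_r(\mathbb R) : f,\,pf'\in AC_{\mathrm{loc}}(\mathbb R),\ \tau f\in L^2_r(\mathbb R)\bigr\},$$ where $AC_{\mathrm{loc}}(\mathbb R)$ denotes the locally absolutely continuous functions. It is known that under the standing hypotheses $T$ is self-adjoint and semibounded from below; $\sigma(T)$ is its spectrum. The negative part of $q$ is $q_-=(|q|-q)/2$. $\mu$ is Lebesgue measure on $\mathbb R$, and $\lVert\cdot\rVert_\infty$ is the (unweighted) norm of $L^\infty(\mathbb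 R)$. *)

theory Defs
  imports "HOL-Analysis.Analysis" "HOL-Probability.Essential_Supremum"
begin

definition L1_loc :: "(real \<Rightarrow> real) set" where
  "L1_loc = {h. \<forall>a b. set_integrable lebesgue {a..b} h}"

definition unif_norm :: "(real \<Rightarrow> real) \<Rightarrow> ennreal" where
  "unif_norm h =
     (SUP n::int. \<integral>\<^sup>+ t \<in> {real_of_int n..real_of_int n + 1}. ennreal \<bar>h t\<bar> \<partial>lebesgue)"

definition L1_u :: "(real \<Rightarrow> real) set" where
  "L1_u = {h \<in> L1_loc. unif_norm h < \<infinity>}"

definition Linf_norm :: "(real \<Rightarrow> real) \<Rightarrow> ennreal" where
  "Linf_norm h = esssup lebesgue (\<lambda>x. ennreal \<bar>h x\<bar>)"

definition Lp :: "ennreal \<Rightarrow> (real \<Rightarrow> real) set" where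
  "Lp \<eta> = {h \<in> borel_measurable lebesgue.
     if \<eta> = \<infinity> then Linf_norm h < \<infinity>
     else integrable lebesgue (\<lambda>x. \<bar>h x\<bar> powr enn2real \<eta>)}"

definition essinf :: "'a measure \<Rightarrow> ('a \<Rightarrow> ereal) \<Rightarrow> ereal" where
  "essinf M f = Sup {z. AE x in M. z \<le> f x}"

definition neg_part :: "(real \<Rightarrow> real) \<Rightarrow> real \<Rightarrow> real" where
  "neg_part q x = (\<bar>q x\<bar> - q x) / 2"

definition abs_cont_on :: "real \<Rightarrow> real \<Rightarrow> (real \<Rightarrow> complex) \<Rightarrow> bool" where
  "abs_cont_on a b f \<longleftrightarrow>
     (\<forall>\<epsilon>>0. \<exists>\<delta>>0. \<forall>(n::nat) s t.
        (\<forall>k<n. a \<le> s k \<and> s k \<le> t k \<and> t k \<le> b) \<longrightarrow>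
        disjoint_family_on (\<lambda>k. {s k<..<t k}) {..<n} \<longrightarrow>
        (\<Sum>k<n. t k - s k) < \<delta> \<longrightarrow>
        (\<Sum>k<n. cmod (f (t k) - f (s k))) < \<epsilon>)"

definition AC_loc :: "(real \<Rightarrow> complex) set" where
  "AC_loc = {f. \<forall>a b. abs_cont_on a b f}"

text \<open>
  Elements of an \<open>L\<^sup>2\<close> space are represented by functions, and equality in the space is equality
  almost everywhere.
\<close>

definition L2 :: "'a measure \<Rightarrow> ('a \<Rightarrow> complex) set" where
  "L2 M = {f \<in> borel_measurable M. integrable M (\<lambda>x. (cmod (f x))\<^sup>2)}"

definition L2_norm :: "'a measure \<Rightarrow> ('a \<Rightarrow> complex) \<Rightarrow> real" where
  "L2_norm M f = sqrt (\<integral>x. (cmod (f x))\<^sup>2 \<partial>M)"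

text \<open>
  The resolvent set and spectrum of the operator \<open>A\<close> in \<open>L2 M\<close> with domain \<open>D \<subseteq> L2 M\<close>:
  \<open>z\<close> is in the resolvent set if \<open>A - z\<close> maps \<open>D\<close> bijectively (modulo null sets) onto \<open>L2 M\<close>
  and its inverse is bounded.
\<close>

definition resolvent_set ::
  "'a measure \<Rightarrow> ('a \<Rightarrow> complex) set \<Rightarrow> (('a \<Rightarrow> complex) \<Rightarrow> ('a \<Rightarrow> complex)) \<Rightarrow> complex set" where
  "resolvent_set M D A = {z.
     (\<forall>f\<in>D. \<forall>g\<in>D. (AE x in M. A f x - z * f x = A g x - z * g x) \<longrightarrow> (AE x in M. f x = g x)) \<and>
     (\<forall>h\<in>L2 M. \<exists>f\<in>D. AE x in M. A f x - z * f x = h x) \<and>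
     (\<exists>C. \<forall>f\<in>D. L2_norm M f \<le> C * L2_norm M (\<lambda>x. A f x - z * f x))}"

definition spectrum ::
  "'a measure \<Rightarrow> ('a \<Rightarrow> complex) set \<Rightarrow> (('a \<Rightarrow> complex) \<Rightarrow> ('a \<Rightarrow> complex)) \<Rightarrow> complex set" where
  "spectrum M D A = - resolvent_set M D A"

definition is_min_of :: "real \<Rightarrow> complex set \<Rightarrow> bool" where
  "is_min_of m S \<longleftrightarrow> complex_of_real m \<in> S \<and> (\<forall>z\<in>S. z \<in> \<real> \<and> m \<le> Re z)"

definition weighted :: "(real \<Rightarrow> real) \<Rightarrow> real measure" where
  "weighted r = density lebesgue (\<lambda>x. ennreal (r x))"

text \<open>
  For absolutely continuous \<open>f\<close> the derivative \<open>f'\<close> exists only almost everywhere, so that \<open>p f'\<close>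
  is a class of functions; that \<open>p f'\<close> is locally absolutely continuous means that it has a
  locally absolutely continuous representative. This representative is continuous, hence unique.
  The value of \<open>vector_derivative\<close> at the exceptional points is irrelevant.
\<close>

definition is_quasi_deriv ::
  "(real \<Rightarrow> real) \<Rightarrow> (real \<Rightarrow> complex) \<Rightarrow> (real \<Rightarrow> complex) \<Rightarrow> bool" where
  "is_quasi_deriv p f u \<longleftrightarrow>
     u \<in> AC_loc \<and> (AE x in lebesgue. u x = p x *\<^sub>R vector_derivative f (at x))"

definition quasi_deriv :: "(real \<Rightarrow> real) \<Rightarrow> (real \<Rightarrow> complex) \<Rightarrow> real \<Rightarrow> complex" where
  "quasi_deriv p f = (THE u. is_quasi_deriv p f u)"

definition SL_op ::
  "(real \<Rightarrow> real) \<Rightarrow> (real \<Rightarrow> real) \<Rightarrow> (real \<Rightarrow> real) \<Rightarrow> (real \<Rightarrow> complex) \<Rightarrow> real \<Rightarrow> complex" where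
  "SL_op p q r f x =
     (1 / r x) *\<^sub>R (- vector_derivative (quasi_deriv p f) (at x) + q x *\<^sub>R f x)"

text \<open>
  Each class in the domain is represented by its unique continuous member.
\<close>

definition SL_dom ::
  "(real \<Rightarrow> real) \<Rightarrow> (real \<Rightarrow> real) \<Rightarrow> (real \<Rightarrow> real) \<Rightarrow> (real \<Rightarrow> complex) set" where
  "SL_dom p q r = {f \<in> L2 (weighted r).
     f \<in> AC_loc \<and> (\<exists>u. is_quasi_deriv p f u) \<and> SL_op p q r f \<in> L2 (weighted r)}"

definition SL_spectrum ::
  "(real \<Rightarrow> real) \<Rightarrow> (real \<Rightarrow> real) \<Rightarrow> (real \<Rightarrow> real) \<Rightarrow> complex set" where
  "SL_spectrum p q r = spectrum (weighted r) (SL_dom p q r) (SL_op p q r)"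

definition Omega :: "(real \<Rightarrow> real) \<Rightarrow> (real \<Rightarrow> real) \<Rightarrow> real set" where
  "Omega r g = {x. r x * g x < 1}"

end

theory Submission
  imports Defs
begin

text \<open>
  The spectrum is read off the quadratic form \<open>S[f] = \<integral> p |f'|\<^sup>2 + q |f|\<^sup>2\<close> on the functions \<open>f\<close>
  for which \<open>\<integral> p |f'|\<^sup>2\<close> and \<open>\<integral> r |f|\<^sup>2\<close> are finite. In the proof, \<open>s\<close> stands for \<open>1/p\<close>, \<open>P\<close> for
  its essential bound, \<open>N\<close> for the uniform norm of the negative part of \<open>q\<close>, and \<open>w\<close> for \<open>f'\<close>,
  so that \<open>p |f'|\<^sup>2\<close> is \<open>|w|\<^sup>2 / s\<close>.

  \<^bold>\<open>The form is bounded below\<close> (\<open>form_lower_bound\<close>). On an interval of length one, the value of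
  \<open>|f|\<^sup>2\<close> at any point is at most its mean plus \<open>\<integral> 2 |f| |f'|\<close>. Integrating this against the
  negative part of \<open>q\<close>, whose integral over the interval is at most \<open>N\<close>, and splitting
  \<open>2 |f| |f'|\<close> by Young's inequality gives \<open>S[f] \<ge> E/2 - (\<alpha>/2) F\<close> with \<open>E = \<integral> p |f'|\<^sup>2\<close> and
  \<open>F = \<integral> |f|\<^sup>2\<close>. If \<open>S[f] < 0\<close>, then \<open>E \<le> \<alpha> F\<close>, and the same device on a half-line gives
  \<open>|f(x)|\<^sup>2 \<le> \<beta> F\<close> for every \<open>x\<close>: a function of negative form cannot be concentrated on a small
  set. Splitting \<open>F\<close> over \<open>\<Omega>\<close> and its complement, where \<open>1 \<le> r g\<close>, gives
  \<open>F \<le> \<mu>(\<Omega>) \<beta> F + \<parallel>g\<parallel> \<integral> r |f|\<^sup>2\<close>. This bounds \<open>F\<close>, hence \<open>S[f]\<close>, by the weighted norm.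

  \<^bold>\<open>The operator belongs to the form\<close> (\<open>in_dom_in_form\<close>, \<open>green\<close>). A function of the maximal
  domain has finite energy: otherwise \<open>Re (p f' cnj f)\<close> would tend to infinity in modulus at an
  end of the line, so that \<open>|f|\<^sup>2\<close> would be monotone there and not integrable. Along suitable
  sequences the boundary terms \<open>p f' cnj g\<close> vanish at infinity, and therefore \<open>\<langle>T f, f\<rangle> = S[f]\<close>.

  \<^bold>\<open>The minimum of the spectrum is the bottom of the form\<close> (\<open>bottom_is_min\<close>). Let \<open>m\<close> be the
  infimum of \<open>S[f] / \<integral> r |f|\<^sup>2\<close>. For \<open>z\<close> outside the half-line \<open>[m, \<infinity>)\<close> the identity
  \<open>\<langle>T f, f\<rangle> = S[f]\<close> bounds \<open>f\<close> by \<open>(T - z) f\<close> (\<open>coercive\<close>), and \<open>T - z\<close> is onto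
  (\<open>resolvent_onto\<close>): the Dirichlet problems on growing intervals are solvable with a uniform
  bound, and a compactness argument on the two-dimensional affine space of solutions, in the
  manner of Weyl's nested discs, produces a solution in \<open>L\<^sup>2\<close> of the whole line. Hence the
  spectrum lies in \<open>[m, \<infinity>)\<close>. Conversely a bounded inverse of \<open>T - m\<close> would improve the constant
  \<open>m\<close> in the inequality \<open>S[f] \<ge> m \<integral> r |f|\<^sup>2\<close> (\<open>bottom_not_regular\<close>), so \<open>m\<close> belongs to the
  spectrum.

  The domain is described by absolute continuity in the sense of \<open>\<epsilon>\<close> and \<open>\<delta>\<close>, whereas the
  arguments integrate derivatives. The bridge is the fundamental theorem of calculus: a function
  is locally absolutely continuous iff it is an indefinite Lebesgue integral. It is proved from
  the Vitali covering theorem (\<open>prim_has_vector_derivative\<close>) and from a growth estimate that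
  ignores null sets (\<open>growth_bound\<close>, \<open>ac_AC_deriv\<close>).
\<close>

section \<open>Indefinite integrals and their difference quotients\<close>

definition loc_int :: "(real \<Rightarrow> 'a::euclidean_space) \<Rightarrow> bool" where
  "loc_int w \<longleftrightarrow> (\<forall>a b. set_integrable lebesgue {a..b} w)"

definition prim :: "(real \<Rightarrow> 'a::euclidean_space) \<Rightarrow> real \<Rightarrow> 'a" where
  "prim w x = (if 0 \<le> x then (LINT t:{0..x}|lebesgue. w t) else - (LINT t:{x..0}|lebesgue. w t))"

lemma loc_intD: "loc_int w \<Longrightarrow> set_integrable lebesgue {a..b} w"
  by (simp add: loc_int_def)

lemma loc_int_iff: "loc_int w \<longleftrightarrow> (\<forall>n::nat. set_integrable lebesgue {-real n..real n} w)"
proof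
  assume *: "\<forall>n::nat. set_integrable lebesgue {-real n..real n} w"
  show "loc_int w"
    unfolding loc_int_def
  proof (intro allI)
    fix a b :: real
    obtain n :: nat where "max \<bar>a\<bar> \<bar>b\<bar> \<le> real n" using real_arch_simple by blast
    then have "{a..b} \<subseteq> {-real n..real n}" by auto
    then show "set_integrable lebesgue {a..b} w"
      using * set_integrable_subset[of lebesgue "{-real n..real n}" w "{a..b}"] by auto
  qed
qed (simp add: loc_int_def)

lemma lint_combine:
  fixes w :: "real \<Rightarrow> 'a::euclidean_space"
  assumes "set_integrable lebesgue {a..c} w" "a \<le> b" "b \<le> c"
  shows "(LINT t:{a..c}|lebesgue. w t) = (LINT t:{a..b}|lebesgue. w t) + (LINT t:{b..c}|lebesgue. w t)"
proof -
  have 1: "set_integrable lebesgue {a..b} w" "set_integrable lebesgue {b..c} w"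
    using assms by (auto intro: set_integrable_subset)
  have "{a..c} = {a..b} \<union> {b..c}" using assms by auto
  moreover have "AE x in lebesgue. \<not> (x \<in> {a..b} \<and> x \<in> {b..c})"
    using AE_lborel_singleton[of b] by (auto intro!: AE_completion elim: eventually_mono)
  ultimately show ?thesis
    using 1 by (simp add: set_integral_Un_AE)
qed

lemma prim_diff:
  assumes "loc_int w" "x \<le> y"
  shows "prim w y - prim w x = (LINT t:{x..y}|lebesgue. w t)"
  using lint_combine[of 0 y w x] lint_combine[of x y w 0] lint_combine[of x 0 w y] assms
  by (auto simp: prim_def loc_int_def)

lemma prim_0 [simp]: "prim w 0 = 0"
proof -
  have "AE x in lebesgue. x \<noteq> (0::real)"
    using AE_lborel_singleton[of 0] by (auto intro!: AE_completion elim: eventually_mono)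
  then have "(LINT t:{0}|lebesgue. w t) = 0"
    unfolding set_lebesgue_integral_def
    by (intro integral_eq_zero_AE) (auto elim!: eventually_mono)
  then show ?thesis by (simp add: prim_def)
qed

lemma set_integrable_norm:
  "set_integrable M A (f::_\<Rightarrow>'a::{banach, second_countable_topology}) \<Longrightarrow> set_integrable M A (\<lambda>x. norm (f x))"
  unfolding set_integrable_def
  by (drule integrable_norm) (simp add: abs_mult)

text \<open>
  Split \<open>|f|\<close> into its truncation at height \<open>n\<close> and the excess above \<open>n\<close>: the excess has small
  integral for large \<open>n\<close> by dominated convergence, and the truncation contributes at most \<open>n\<close>
  times the measure of the set.
\<close>
lemma integral_uniformly_small:
  fixes f :: "'a \<Rightarrow> real"
  assumes f: "integrable M f" and e: "e > 0"
  shows "\<exists>d>0. \<forall>A\<in>sets M. emeasure M A < ennreal d \<longrightarrow> (LINT x:A|M. \<bar>f x\<bar>) < e"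
proof -
  let ?g = "\<lambda>(n::nat) x. max 0 (\<bar>f x\<bar> - real n)"
  have m[measurable]: "f \<in> borel_measurable M" using f by auto
  have "(\<lambda>n. \<integral>x. ?g n x \<partial>M) \<longlonglongrightarrow> (\<integral>x. 0 \<partial>M)"
  proof (rule integral_dominated_convergence[where w="\<lambda>x. \<bar>f x\<bar>"])
    show "AE x in M. (\<lambda>n. ?g n x) \<longlonglongrightarrow> 0"
    proof (rule AE_I2)
      fix x
      have "\<forall>\<^sub>F n in sequentially. ?g n x = 0"
        using eventually_ge_at_top[of "nat \<lceil>\<bar>f x\<bar>\<rceil>"]
        by eventually_elim (auto simp: nat_ceiling_le_eq)
      then show "(\<lambda>n. ?g n x) \<longlonglongrightarrow> 0" by (rule tendsto_eventually)
    qed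
  qed (use f in auto)
  then have "\<forall>\<^sub>F n in sequentially. (\<integral>x. ?g n x \<partial>M) < e/2"
    using e by (intro order_tendstoD) auto
  then obtain n where n: "(\<integral>x. ?g n x \<partial>M) < e/2" "n > 0"
    by (metis (mono_tags, lifting) eventually_conj eventually_gt_at_top eventually_happens trivial_limit_sequentially)
  have gi: "integrable M (?g n)"
    by (rule Bochner_Integration.integrable_bound[where f=f]) (use f in auto)
  show ?thesis
  proof (intro exI[of _ "e / (2 * real n)"] conjI ballI impI)
    fix A assume A[measurable]: "A \<in> sets M" and mu: "emeasure M A < ennreal (e / (2 * real n))"
    then have fin: "emeasure M A < \<infinity>" by (simp add: order_less_trans)
    have "measure M A < e / (2 * real n)"
      using mu fin by (simp add: emeasure_eq_ennreal_measure less_top[symmetric] ennreal_less_iff)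
    then have mm: "real n * measure M A < e/2" using n by (simp add: field_simps)
    have "(LINT x:A|M. \<bar>f x\<bar>) \<le> (\<integral>x. real n * indicator A x + ?g n x \<partial>M)"
      unfolding set_lebesgue_integral_def
    proof (rule integral_mono)
      show "integrable M (\<lambda>x. indicat_real A x *\<^sub>R \<bar>f x\<bar>)"
        using f by (intro integrable_mult_indicator integrable_abs) auto
      show "integrable M (\<lambda>x. real n * indicator A x + ?g n x)"
        using gi fin by auto
    qed (auto simp: indicator_def)
    also have "\<dots> = real n * measure M A + (\<integral>x. ?g n x \<partial>M)"
      using gi fin by (subst Bochner_Integration.integral_add) auto
    finally show "(LINT x:A|M. \<bar>f x\<bar>) < e" using mm n by linarith
  qed (use e n in auto)
qed

lemma set_integral_uniformly_small:
  fixes f :: "'a \<Rightarrow> 'b::{banach, second_countable_topology}"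
  assumes f: "set_integrable M S f" and S: "S \<in> sets M" and e: "e > 0"
  shows "\<exists>d>0. \<forall>A\<in>sets M. A \<subseteq> S \<longrightarrow> emeasure M A < ennreal d \<longrightarrow> (LINT x:A|M. norm (f x)) < e"
proof -
  have "integrable M (\<lambda>x. indicator S x * norm (f x))"
    using set_integrable_norm[OF f] by (simp add: set_integrable_def)
  from integral_uniformly_small[OF this e] obtain d where d: "d > 0"
    "\<And>A. A \<in> sets M \<Longrightarrow> emeasure M A < ennreal d \<Longrightarrow> (LINT x:A|M. \<bar>indicator S x * norm (f x)\<bar>) < e" by blast
  have "(LINT x:A|M. \<bar>indicator S x * norm (f x)\<bar>) = (LINT x:A|M. norm (f x))" if "A \<in> sets M" "A \<subseteq> S" for A
    using that by (intro set_lebesgue_integral_cong) (auto simp: indicator_def)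
  with d show ?thesis by (metis (lifting))
qed

lemma set_integrable_const:
  "set_integrable lebesgue {a..b::real} (\<lambda>x. c::'a::euclidean_space)"
  using absolutely_integrable_on_const[of "{a..b}" c] by simp

lemma prim_affine_shift:
  fixes w :: "real \<Rightarrow> real"
  assumes "loc_int w"
  shows "loc_int (\<lambda>x. w x - c)" "prim (\<lambda>x. w x - c) y = prim w y - c * y"
proof -
  have c: "set_integrable lebesgue {a..b} (\<lambda>x. c)" for a b :: real
 by (rule set_integrable_const)
  show "loc_int (\<lambda>x. w x - c)" using assms c by (auto simp: loc_int_def)
  have "(LINT t:{a..b}|lebesgue. c) = c * (b - a)" if "a \<le> b" for a b :: real
    using that by (simp add: set_integral_const)
  then show "prim (\<lambda>x. w x - c) y = prim w y - c * y"
    using assms c by (auto simp: prim_def loc_int_def)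
qed

text \<open>
  The difference quotients of the indefinite integral can exceed \<open>t\<close> only near intervals on
  which the mean of \<open>w\<close> exceeds \<open>t\<close>. Choose an open \<open>U\<close> around \<open>B = {w \<le> 0}\<close> that is so close to
  \<open>B\<close> in measure that \<open>w\<close> has small integral over every part of \<open>U - B\<close>. By Vitali's theorem,
  disjoint such intervals inside \<open>U\<close> cover almost all exceptional points. Their union \<open>V\<close>
  satisfies \<open>t |V| \<le> \<integral>\<^sub>V w\<close>, and the part of \<open>V\<close> inside \<open>B\<close> contributes nothing positive, so
  \<open>|V|\<close> is arbitrarily small.
\<close>
lemma upper_derivate_negligible:
  fixes w :: "real \<Rightarrow> real" and k t :: real
  assumes w: "loc_int w" and t: "t > 0"
  shows "negligible {x \<in> {-k<..<k}. w x \<le> 0 \<and>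
    (\<forall>d>0. \<exists>y. y \<noteq> x \<and> \<bar>y - x\<bar> < d \<and> (prim w y - prim w x) / (y - x) > t)}" (is "negligible ?S")
proof (subst negligible_outer_le, intro allI impI)
  fix e :: real assume e: "e > 0"
  define B where "B = {x \<in> {-k<..<k}. w x \<le> 0}"
  have wk: "set_integrable lebesgue {-k<..<k} w"
    using w by (rule set_integrable_subset[OF loc_intD[of _ "-k" k]]) auto
  have B[measurable]: "B \<in> sets lebesgue"
  proof -
    have "(\<lambda>x. indicator {-k<..<k} x * w x) \<in> borel_measurable lebesgue" (is "?f \<in> _")
      using wk by (auto simp: set_integrable_def)
    then have "{x \<in> space lebesgue. ?f x \<le> 0} \<in> sets lebesgue" by measurable
    moreover have "B = {x \<in> space lebesgue. ?f x \<le> 0} \<inter> {-k<..<k}"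
      by (auto simp: B_def)
    ultimately show ?thesis by auto
  qed
  from set_integral_uniformly_small[OF wk, of "e*t"] e t
  obtain d where d: "d > 0"
    "\<And>A. A \<in> sets lebesgue \<Longrightarrow> A \<subseteq> {-k<..<k} \<Longrightarrow> emeasure lebesgue A < ennreal d \<Longrightarrow> (LINT x:A|lebesgue. norm (w x)) < e*t"
    by auto
  obtain U0 where U0: "open U0" "B \<subseteq> U0" "(U0 - B) \<in> lmeasurable" "emeasure lebesgue (U0 - B) < ennreal d"
    by (rule sets_lebesgue_outer_open[OF B d(1)]) (rule that)
  define U where "U = U0 \<inter> {-k<..<k}"
  have U: "open U" "B \<subseteq> U" "U \<subseteq> {-k<..<k}" using U0(1,2) by (auto simp: U_def B_def)
  have emUB: "emeasure lebesgue A < ennreal d" if "A \<subseteq> U - B" "A \<in> sets lebesgue" for A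
    using that U0(3) by (intro le_less_trans[OF emeasure_mono U0(4)]) (auto simp: U_def)
  (* The intervals of large mean form a Vitali cover of the exceptional set. *)
  define K where "K = {(a,b). a < b \<and> {a..b} \<subseteq> U \<and> prim w b - prim w a > t * (b - a)}"
  let ?c = "\<lambda>i. (fst i + snd i)/2::real" and ?r = "\<lambda>i. (snd i - fst i)/2::real"
  define I where "I i = {fst i..snd i}" for i :: "real \<times> real"
  have cb: "cball (?c i) (?r i) = I i" for i
    by (simp add: I_def cball_eq_atLeastAtMost field_simps)
  have Isets[measurable]: "I i \<in> sets lebesgue" for i by (simp add: I_def)
  have fine: "\<exists>i. i \<in> K \<and> x \<in> cball (?c i) (?r i) \<and> ?r i < \<delta>" if x: "x \<in> ?S" and \<delta>: "0 < \<delta>" for x \<delta>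
  proof -
    have "x \<in> U" using x U by (auto simp: B_def)
    then obtain \<epsilon> where \<epsilon>: "\<epsilon> > 0" "ball x \<epsilon> \<subseteq> U" using U(1) openE by blast
    obtain y where y: "y \<noteq> x" "\<bar>y - x\<bar> < min \<epsilon> \<delta>" "(prim w y - prim w x) / (y - x) > t"
      using x \<epsilon>(1) \<delta> by (auto dest!: spec[of _ "min \<epsilon> \<delta>"])
    have sub: "{min x y..max x y} \<subseteq> U"
      using y(2) \<epsilon>(2) by (auto simp: subset_eq dist_real_def)
    show ?thesis
    proof (cases "x < y")
      case True
      then have "(x,y) \<in> K" using y sub by (auto simp: K_def field_simps)
      then show ?thesis unfolding cb using True y by (intro exI[of _ "(x,y)"]) (auto simp: I_def)
    next
      case False
      then have "(y,x) \<in> K" using y sub by (auto simp: K_def field_simps)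
      then show ?thesis unfolding cb using False y by (intro exI[of _ "(y,x)"]) (auto simp: I_def)
    qed
  qed
  have r0: "0 < ?r i" if "i \<in> K" for i using that by (auto simp: K_def)
  obtain C where C: "countable C" "C \<subseteq> K"
     "pairwise (\<lambda>i j. disjnt (cball (?c i) (?r i)) (cball (?c j) (?r j))) C"
     "negligible (?S - (\<Union>i \<in> C. cball (?c i) (?r i)))"
    by (rule Vitali_covering_theorem_cballs[of K ?r ?S ?c, OF r0 fine]) (assumption | rule that; assumption)+
  define V where "V = (\<Union>i\<in>C. I i)"
  have V[measurable]: "V \<in> sets lebesgue" using C(1) by (auto simp: V_def)
  have VU: "V \<subseteq> U"
  proof
    fix x assume "x \<in> V"
    then obtain i where i: "i \<in> C" "x \<in> I i" by (auto simp: V_def)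
    then have "i \<in> K" using C(2) by blast
    then show "x \<in> U" using i(2) by (cases i) (auto simp: K_def I_def subset_eq)
  qed
  have lk: "{-k<..<k} \<in> lmeasurable" by simp
  have Vl: "V \<in> lmeasurable" using VU U(3)
    by (intro fmeasurableI2[OF lk]) auto
  have nV: "negligible (?S - V)" using C(4) by (simp only: cb V_def)
  have wV: "set_integrable lebesgue V w" using VU U by (intro set_integrable_subset[OF wk]) auto
  have tV: "set_integrable lebesgue V (\<lambda>x. t)" by (rule absolutely_integrable_on_const[OF Vl])
  (* Countable additivity: the inequality holds on each interval of the disjoint family. *)
  have "0 \<le> (LINT x:V|lebesgue. w x - t)"
  proof (cases "C = {}")
    case False
    define A where "A n = (\<Union>i\<in>from_nat_into C ` {..n}. I i)" for n :: nat
    have subC: "from_nat_into C ` {..n} \<subseteq> C" for n using False by (auto intro: from_nat_into)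
    have AV: "\<Union>(range A) = V"
    proof (intro equalityI subsetI)
      fix x assume "x \<in> \<Union>(range A)"
      then obtain n i where "i \<in> from_nat_into C ` {..n}" "x \<in> I i" unfolding A_def by blast
      then show "x \<in> V" using subC unfolding V_def by blast
    next
      fix x assume "x \<in> V"
      then obtain i where i: "i \<in> C" "x \<in> I i" by (auto simp: V_def)
      then obtain n where "i = from_nat_into C n" using range_from_nat_into[OF False C(1)] by (metis imageE)
      then have "x \<in> A n" using i(2) unfolding A_def by (intro UN_I[of i]) auto
      then show "x \<in> \<Union>(range A)" by blast
    qed
    have "(\<lambda>n. LINT x:A n|lebesgue. w x - t) \<longlonglongrightarrow> (LINT x:\<Union>(range A)|lebesgue. w x - t)"
    proof (rule set_integral_cont_up)
      show "A n \<in> sets lebesgue" for n by (auto simp: A_def)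
      show "incseq A" by (rule monoI) (force simp: A_def)
      show "set_integrable lebesgue (\<Union>(range A)) (\<lambda>x. w x - t)" using wV tV by (simp add: AV)
    qed
    moreover have "0 \<le> (LINT x:A n|lebesgue. w x - t)" for n
    proof -
      have "(LINT x:A n|lebesgue. w x - t) = (\<Sum>i\<in>from_nat_into C ` {..n}. LINT x:I i|lebesgue. w x - t)"
        unfolding A_def
      proof (rule set_integral_finite_Union)
        show "disjoint_family_on I (from_nat_into C ` {..n})"
          using C(3) subC[of n] unfolding disjoint_family_on_def pairwise_def disjnt_def cb by blast
      qed (use prim_affine_shift(1)[OF w] in \<open>auto simp: loc_int_def I_def\<close>)
      also have "\<dots> \<ge> 0"
      proof (rule sum_nonneg)
        fix i assume "i \<in> from_nat_into C ` {..n}"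
        then have "i \<in> K" using subC C(2) by blast
        then obtain a b where i: "i = (a,b)" "a < b" "prim w b - prim w a > t * (b - a)" by (auto simp: K_def)
        have "(LINT x:I i|lebesgue. w x - t) = prim (\<lambda>x. w x - t) b - prim (\<lambda>x. w x - t) a"
          using i prim_diff[OF prim_affine_shift(1)[OF w], of a b t] by (simp add: I_def)
        also have "\<dots> \<ge> 0" using i by (simp add: prim_affine_shift[OF w] algebra_simps)
        finally show "0 \<le> (LINT x:I i|lebesgue. w x - t)" .
      qed
      finally show ?thesis .
    qed
    ultimately show ?thesis unfolding AV by (intro LIMSEQ_le_const) auto
  qed (simp add: V_def set_lebesgue_integral_def)
  moreover have "(LINT x:V|lebesgue. w x - t) = (LINT x:V|lebesgue. w x) - t * measure lebesgue V"
  proof -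
    have "(LINT x:V|lebesgue. t) = measure lebesgue V *\<^sub>R t"
      using Vl by (intro set_integral_const) (auto dest: fmeasurableD2)
    then show ?thesis using wV tV by (subst set_integral_diff) (simp_all add: mult.commute)
  qed
  moreover have "(LINT x:V|lebesgue. w x) \<le> e * t"
  proof -
    have "(LINT x:V|lebesgue. w x) \<le> (LINT x:V-B|lebesgue. norm (w x))"
      unfolding set_lebesgue_integral_def
    proof (rule integral_mono)
      show "integrable lebesgue (\<lambda>x. indicat_real V x *\<^sub>R w x)" using wV by (simp add: set_integrable_def)
      have "set_integrable lebesgue (V - B) w" using wV by (rule set_integrable_subset) auto
      from set_integrable_norm[OF this]
      show "integrable lebesgue (\<lambda>x. indicat_real (V - B) x *\<^sub>R norm (w x))" by (simp add: set_integrable_def)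
      fix x show "indicat_real V x *\<^sub>R w x \<le> indicat_real (V - B) x *\<^sub>R norm (w x)"
        using VU U(3) by (cases "x \<in> V"; cases "x \<in> B") (auto simp: B_def)
    qed
    also have "\<dots> < e * t"
    proof (rule d(2))
      show "emeasure lebesgue (V - B) < ennreal d" using VU by (intro emUB) auto
    qed (use VU U in auto)
    finally show ?thesis by simp
  qed
  ultimately have "t * measure lebesgue V \<le> e * t" by linarith
  then have mV: "measure lebesgue V \<le> e" using t by simp
  show "\<exists>T. ?S \<subseteq> T \<and> T \<in> lmeasurable \<and> measure lebesgue T \<le> e"
  proof (intro exI conjI)
    show "?S \<subseteq> V \<union> (?S - V)" by auto
    have nl: "(?S - V) \<in> null_sets lebesgue" using nV negligible_iff_null_sets by blast
    show "V \<union> (?S - V) \<in> lmeasurable"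
      by (rule fmeasurable.Un[OF Vl negligible_imp_measurable[OF nV]])
    show "measure lebesgue (V \<union> (?S - V)) \<le> e"
      using mV measure_Un_null_set[OF V nl] by (simp only:)
  qed
qed

lemma indicator_exhausts:
  fixes v :: "'a::real_normed_vector"
  shows "(\<lambda>n. indicator {-real n..real n} x *\<^sub>R v) \<longlonglongrightarrow> v"
proof (rule tendsto_eventually)
  show "\<forall>\<^sub>F n in sequentially. indicator {-real n..real n} x *\<^sub>R v = v"
    using eventually_ge_at_top[of "nat \<lceil>\<bar>x\<bar>\<rceil>"]
  proof eventually_elim
    case (elim n)
    then have "\<bar>x\<bar> \<le> real n" by (simp add: nat_ceiling_le_eq)
    then show ?case by (auto simp: indicator_def)
  qed
qed

lemma loc_int_measurable:
  fixes w :: "real \<Rightarrow> 'a::euclidean_space"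
  assumes "loc_int w" shows "w \<in> borel_measurable lebesgue"
proof (rule borel_measurable_LIMSEQ_metric[OF _ indicator_exhausts])
  show "(\<lambda>x. indicator {-real n..real n} x *\<^sub>R w x) \<in> borel_measurable lebesgue" for n :: nat
    by (rule borel_measurable_integrable) (use assms in \<open>simp add: loc_int_def set_integrable_def\<close>)
qed

section \<open>Absolutely continuous functions\<close>

definition nonoverlapping :: "real \<Rightarrow> real \<Rightarrow> nat \<Rightarrow> (nat \<Rightarrow> real) \<Rightarrow> (nat \<Rightarrow> real) \<Rightarrow> bool" where
  "nonoverlapping a b n s t \<longleftrightarrow> (\<forall>k<n. a \<le> s k \<and> s k \<le> t k \<and> t k \<le> b) \<and>
     disjoint_family_on (\<lambda>k. {s k<..<t k}) {..<n}"

text \<open>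
  The same notion as \<open>AC_loc\<close>, for functions into an arbitrary normed space: the fundamental
  theorem is proved for real functions and then applied to coordinates.
\<close>
definition ac :: "(real \<Rightarrow> 'a::real_normed_vector) \<Rightarrow> bool" where
  "ac f \<longleftrightarrow> (\<forall>a b. \<forall>e>0. \<exists>d>0. \<forall>n s t. nonoverlapping a b n s t \<longrightarrow>
        (\<Sum>k<n. t k - s k) < d \<longrightarrow> (\<Sum>k<n. norm (f (t k) - f (s k))) < e)"

lemma AC_loc_iff: "f \<in> AC_loc \<longleftrightarrow> ac f"
  unfolding AC_loc_def ac_def abs_cont_on_def nonoverlapping_def by (simp only: mem_Collect_eq imp_conjL)

lemma acE:
  assumes "ac f" "e > 0"
  obtains d where "d > 0" "\<And>n s t. nonoverlapping a b n s t \<Longrightarrow>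
        (\<Sum>k<n. t k - s k) < d \<Longrightarrow> (\<Sum>k<n. norm (f (t k) - f (s k))) < e"
proof -
  have "\<exists>d>0. \<forall>n s t. nonoverlapping a b n s t \<longrightarrow>
        (\<Sum>k<n. t k - s k) < d \<longrightarrow> (\<Sum>k<n. norm (f (t k) - f (s k))) < e"
    using assms unfolding ac_def by simp
  then show thesis using that by blast
qed

lemma ac_uniform:
  assumes "ac f" "e > 0"
  obtains d where "d > 0" "\<And>x y. a \<le> x \<Longrightarrow> x \<le> y \<Longrightarrow> y \<le> b \<Longrightarrow> y - x < d \<Longrightarrow> norm (f y - f x) < e"
proof -
  obtain d where d: "d > 0" "\<And>n s t. nonoverlapping a b n s t \<Longrightarrow>
        (\<Sum>k<n. t k - s k) < d \<Longrightarrow> (\<Sum>k<n. norm (f (t k) - f (s k))) < e"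
    by (rule acE[OF assms, of a b]) blast
  show thesis
  proof (rule that[OF d(1)])
    fix x y assume "a \<le> x" "x \<le> y" "y \<le> b" "y - x < d"
    then show "norm (f y - f x) < e"
      using d(2)[of 1 "\<lambda>_. x" "\<lambda>_. y"] by (auto simp: disjoint_family_on_def nonoverlapping_def)
  qed
qed

lemma ac_continuous:
  assumes "ac f" shows "continuous_on A f"
proof -
  have "isCont f x" for x
    unfolding continuous_at_eps_delta
  proof (intro allI impI)
    fix e :: real assume "e > 0"
    from ac_uniform[OF assms this, of "x-1" "x+1"] obtain d where d: "d > 0"
      "\<And>u y. x - 1 \<le> u \<Longrightarrow> u \<le> y \<Longrightarrow> y \<le> x + 1 \<Longrightarrow> y - u < d \<Longrightarrow> norm (f y - f u) < e" by blast
    have "dist (f y) (f x) < e" if "dist y x < min 1 d" for y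
      using d(2)[of x y] d(2)[of y x] that
      by (cases "x \<le> y") (auto simp: dist_norm abs_real_def norm_minus_commute split: if_splits)
    then show "\<exists>d>0. \<forall>y. dist y x < d \<longrightarrow> dist (f y) (f x) < e"
      using d(1) by (intro exI[of _ "min 1 d"]) auto
  qed
  then show ?thesis by (simp add: continuous_at_imp_continuous_on)
qed

text \<open>
  One closure property for all the algebra: sums, differences and products of \<open>f\<close> and \<open>g\<close> have
  increments that are locally dominated by those of \<open>f\<close> and \<open>g\<close>.
\<close>
lemma ac_local_bound:
  assumes "ac f" "ac g" and h: "\<And>a b. \<exists>A B. \<forall>x\<in>{a..b}. \<forall>y\<in>{a..b}.
     norm (h y - h x) \<le> A * norm (f y - f x) + B * norm (g y - g x)"
  shows "ac h"
  unfolding ac_def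
proof (intro allI impI)
  fix a b e :: real assume e: "e > 0"
  obtain A B where h: "\<And>x y. x \<in> {a..b} \<Longrightarrow> y \<in> {a..b} \<Longrightarrow>
     norm (h y - h x) \<le> A * norm (f y - f x) + B * norm (g y - g x)" using h[of a b] by blast
  define C where "C = \<bar>A\<bar> + \<bar>B\<bar> + 1"
  have C: "C > 0" "\<bar>A\<bar> \<le> C" "\<bar>B\<bar> \<le> C" by (auto simp: C_def)
  then have e2: "e / (2*C) > 0" using e by simp
  obtain d1 where d1: "d1 > 0" "\<And>n s t. nonoverlapping a b n s t \<Longrightarrow>
        (\<Sum>k<n. t k - s k) < d1 \<Longrightarrow> (\<Sum>k<n. norm (f (t k) - f (s k))) < e / (2*C)"
    by (rule acE[OF assms(1) e2, of a b]) blast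
  obtain d2 where d2: "d2 > 0" "\<And>n s t. nonoverlapping a b n s t \<Longrightarrow>
        (\<Sum>k<n. t k - s k) < d2 \<Longrightarrow> (\<Sum>k<n. norm (g (t k) - g (s k))) < e / (2*C)"
    by (rule acE[OF assms(2) e2, of a b]) blast
  show "\<exists>d>0. \<forall>n s t. nonoverlapping a b n s t \<longrightarrow>
        (\<Sum>k<n. t k - s k) < d \<longrightarrow> (\<Sum>k<n. norm (h (t k) - h (s k))) < e"
  proof (intro exI[of _ "min d1 d2"] conjI allI impI)
    fix n :: nat and s t
    assume 12: "nonoverlapping a b n s t" and 3: "(\<Sum>k<n. t k - s k) < min d1 d2"
    have "(\<Sum>k<n. norm (h (t k) - h (s k))) \<le> (\<Sum>k<n. C * norm (f (t k) - f (s k)) + C * norm (g (t k) - g (s k)))"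
    proof (rule sum_mono)
      fix k assume "k \<in> {..<n}"
      then have "s k \<in> {a..b}" "t k \<in> {a..b}" using 12 unfolding nonoverlapping_def by force+
      note h = h[OF this]
      have "A * norm (f (t k) - f (s k)) \<le> C * norm (f (t k) - f (s k))"
        using C by (intro mult_right_mono) auto
      moreover have "B * norm (g (t k) - g (s k)) \<le> C * norm (g (t k) - g (s k))"
        using C by (intro mult_right_mono) auto
      ultimately show "norm (h (t k) - h (s k)) \<le> C * norm (f (t k) - f (s k)) + C * norm (g (t k) - g (s k))"
        using h by linarith
    qed
    also have "\<dots> = C * (\<Sum>k<n. norm (f (t k) - f (s k))) + C * (\<Sum>k<n. norm (g (t k) - g (s k)))"
      by (simp add: sum.distrib sum_distrib_left)
    also have "\<dots> < C * (e / (2*C)) + C * (e / (2*C))"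
      using d1(2)[OF 12] d2(2)[OF 12] 3 C
      by (intro add_strict_mono mult_strict_left_mono) auto
    also have "\<dots> = e" using C by simp
    finally show "(\<Sum>k<n. norm (h (t k) - h (s k))) < e" .
  qed (use d1 d2 in auto)
qed

lemma ac_lincomb_bound:
  assumes "ac f" "ac g" and h: "\<And>x y. norm (h y - h x) \<le> A * norm (f y - f x) + B * norm (g y - g x)"
  shows "ac h"
  by (rule ac_local_bound[OF assms(1,2)]) (use h in blast)

lemma ac_diff: "ac f \<Longrightarrow> ac g \<Longrightarrow> ac (\<lambda>x. f x - g x)"
proof (rule ac_lincomb_bound[of f g _ 1 1])
  fix x y
  show "norm ((f y - g y) - (f x - g x)) \<le> 1 * norm (f y - f x) + 1 * norm (g y - g x)"
    using norm_triangle_ineq4[of "f y - f x" "g y - g x"] by (simp add: algebra_simps)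
qed auto

lemma ac_add: "ac f \<Longrightarrow> ac g \<Longrightarrow> ac (\<lambda>x. f x + g x)"
  by (rule ac_lincomb_bound[of f g _ 1 1]) (auto simp: norm_diff_triangle_ineq)

lemma ac_uminus: "ac f \<Longrightarrow> ac (\<lambda>x. - f x)"
  by (rule ac_lincomb_bound[of f f _ 1 0]) (auto simp: norm_minus_commute)

lemma ac_bounded_linear:
  assumes "bounded_linear L" "ac f" shows "ac (\<lambda>x. L (f x))"
proof -
  obtain K where "\<And>x. norm (L x) \<le> norm x * K" using bounded_linear.bounded[OF assms(1)] by blast
  then show ?thesis
    by (intro ac_lincomb_bound[OF assms(2,2), of _ K 0])
      (auto simp: linear_diff[OF bounded_linear.linear[OF assms(1)], symmetric] mult.commute)
qed

lemma disjoint_intervals_length: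
  fixes s t :: "nat \<Rightarrow> real"
  assumes "\<And>k. k < n \<Longrightarrow> s k \<le> t k" "disjoint_family_on (\<lambda>k. {s k<..<t k}) {..<n}"
  shows "emeasure lebesgue (\<Union>k<n. {s k<..<t k}) = ennreal (\<Sum>k<n. t k - s k)"
proof -
  have "emeasure lebesgue (\<Union>k<n. {s k<..<t k}) = (\<Sum>k<n. emeasure lebesgue {s k<..<t k})"
    using assms by (intro sum_emeasure[symmetric]) auto
  also have "\<dots> = (\<Sum>k<n. ennreal (t k - s k))"
    using assms by (intro sum.cong) auto
  also have "\<dots> = ennreal (\<Sum>k<n. t k - s k)"
    using assms by (subst sum_ennreal) auto
  finally show ?thesis .
qed

lemma norm_lint_le:
  fixes w :: "real \<Rightarrow> 'a::euclidean_space"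
  assumes "set_integrable lebesgue A w"
  shows "norm (LINT t:A|lebesgue. w t) \<le> (LINT t:A|lebesgue. norm (w t))"
  using assms integral_norm_bound[of lebesgue "\<lambda>x. indicator A x *\<^sub>R w x"]
  unfolding set_integrable_def set_lebesgue_integral_def by simp

lemma lint_open_closed:
  fixes w :: "real \<Rightarrow> 'a::euclidean_space"
  assumes w: "set_integrable lebesgue {a..b} w"
  shows "(LINT t:{a<..<b}|lebesgue. w t) = (LINT t:{a..b}|lebesgue. w t)"
proof -
  have w': "set_integrable lebesgue {a<..<b} w" using w by (rule set_integrable_subset) auto
  have *: "AE x in lebesgue. x \<noteq> a" "AE x in lebesgue. x \<noteq> b" for a b :: real
    using AE_lborel_singleton by (auto intro!: AE_completion elim: eventually_mono)
  have "AE x in lebesgue. indicator {a<..<b} x *\<^sub>R w x = indicator {a..b} x *\<^sub>R w x"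
    using *(1)[of a] *(2)[of b] by eventually_elim (auto simp: indicator_def)
  then show ?thesis unfolding set_lebesgue_integral_def
    using w w' by (intro integral_cong_AE) (auto simp: set_integrable_def)
qed

lemma ac_prim:
  fixes w :: "real \<Rightarrow> 'a::euclidean_space"
  assumes w: "loc_int w" shows "ac (prim w)"
  unfolding ac_def
proof (intro allI impI)
  fix a b e :: real assume e: "e > 0"
  from set_integral_uniformly_small[OF loc_intD[OF w, of a b] _ e] obtain d where d: "d > 0"
    "\<And>A. A \<in> sets lebesgue \<Longrightarrow> A \<subseteq> {a..b} \<Longrightarrow> emeasure lebesgue A < ennreal d \<Longrightarrow> (LINT x:A|lebesgue. norm (w x)) < e"
    by auto
  show "\<exists>d>0. \<forall>n s t. nonoverlapping a b n s t \<longrightarrow>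
        (\<Sum>k<n. t k - s k) < d \<longrightarrow> (\<Sum>k<n. norm (prim w (t k) - prim w (s k))) < e"
  proof (intro exI[of _ d] conjI allI impI)
    fix n :: nat and s t
    assume 12: "nonoverlapping a b n s t" and 3: "(\<Sum>k<n. t k - s k) < d"
    have 1: "\<forall>k<n. a \<le> s k \<and> s k \<le> t k \<and> t k \<le> b"
      and 2: "disjoint_family_on (\<lambda>k. {s k<..<t k}) {..<n}"
      using 12 by (auto simp: nonoverlapping_def)
    have si: "set_integrable lebesgue {x<..<y} w" for x y
      using w by (rule set_integrable_subset[OF loc_intD[of _ x y]]) auto
    have "(\<Sum>k<n. norm (prim w (t k) - prim w (s k))) \<le> (\<Sum>k<n. LINT x:{s k<..<t k}|lebesgue. norm (w x))"
    proof (rule sum_mono)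
      fix k assume "k \<in> {..<n}"
      then have "prim w (t k) - prim w (s k) = (LINT x:{s k<..<t k}|lebesgue. w x)"
        using 1 by (subst prim_diff[OF w]) (auto simp: lint_open_closed loc_intD[OF w])
      then show "norm (prim w (t k) - prim w (s k)) \<le> (LINT x:{s k<..<t k}|lebesgue. norm (w x))"
        using norm_lint_le[OF si] by simp
    qed
    also have "\<dots> = (LINT x:(\<Union>k<n. {s k<..<t k})|lebesgue. norm (w x))"
      using 2 set_integrable_norm[OF si] by (intro set_integral_finite_Union[symmetric]) auto
    also have "\<dots> < e"
    proof (rule d(2))
      show "(\<Union>k<n. {s k<..<t k}) \<subseteq> {a..b}" using 1 by force
      show "emeasure lebesgue (\<Union>k<n. {s k<..<t k}) < ennreal d"
        using 1 2 3 d by (subst disjoint_intervals_length) (auto intro!: ennreal_lessI)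
    qed auto
    finally show "(\<Sum>k<n. norm (prim w (t k) - prim w (s k))) < e" .
  qed (rule d)
qed

section \<open>Lebesgue's differentiation theorem\<close>

text \<open>
  If a difference quotient of \<open>prim w\<close> at \<open>x\<close> stays above \<open>w x + e\<close> along a sequence, there are
  rationals \<open>s < t\<close> between \<open>w x\<close> and \<open>w x + e\<close>, and \<open>x\<close> lies in the null set that belongs to
  \<open>w - s\<close> and \<open>t - s\<close>. There are countably many such pairs.
\<close>
lemma prim_quotient_upper:
  fixes w :: "real \<Rightarrow> real"
  assumes w: "loc_int w"
  shows "AE x in lebesgue. \<forall>e>0. \<exists>d>0. \<forall>y. y \<noteq> x \<longrightarrow> \<bar>y - x\<bar> < d \<longrightarrow>
     (prim w y - prim w x) / (y - x) \<le> w x + e"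
proof -
  let ?S = "\<lambda>k s t. {x \<in> {-k<..<k}. w x \<le> s \<and>
    (\<forall>d>0. \<exists>y. y \<noteq> x \<and> \<bar>y - x\<bar> < d \<and> (prim w y - prim w x) / (y - x) > t)}"
  have neg: "negligible (?S k s t)" if "s < t" for k s t
  proof -
    have "((prim w y - s * y) - (prim w x - s * x)) / (y - x) = (prim w y - prim w x) / (y - x) - s" if "y \<noteq> x" for x y
      using that by (simp add: field_simps)
    then have eq: "(y \<noteq> x \<and> \<bar>y - x\<bar> < d \<and> ((prim w y - s * y) - (prim w x - s * x)) / (y - x) > t - s)
      \<longleftrightarrow> (y \<noteq> x \<and> \<bar>y - x\<bar> < d \<and> (prim w y - prim w x) / (y - x) > t)" for x y d
      by auto
    show ?thesis
      using upper_derivate_negligible[OF prim_affine_shift(1)[OF w, of s], of "t-s" k] that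
      by (simp add: prim_affine_shift[OF w] eq)
  qed
  have "AE x in lebesgue. \<forall>k::nat. \<forall>s\<in>\<rat>. \<forall>t\<in>\<rat>. s < t \<longrightarrow> x \<notin> ?S (real k) s t"
  proof (intro AE_all_countable[THEN iffD2] allI AE_ball_countable[THEN iffD2, OF countable_rat] ballI)
    fix k :: nat and s t :: real
    show "AE x in lebesgue. s < t \<longrightarrow> x \<notin> ?S (real k) s t"
    proof (cases "s < t")
      case True
      then have "?S (real k) s t \<in> null_sets lebesgue" using neg negligible_iff_null_sets by blast
      from AE_not_in[OF this] show ?thesis by eventually_elim blast
    qed simp
  qed
  then show ?thesis
  proof eventually_elim
    case (elim x)
    show ?case
    proof (intro allI impI)
      fix e :: real assume "e > 0"
      then obtain s t where st: "s \<in> \<rat>" "t \<in> \<rat>" "w x < s" "s < t" "t < w x + e"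
        using Rats_dense_in_real[of "w x" "w x + e"] Rats_dense_in_real by (metis less_add_same_cancel1)
      obtain k :: nat where "\<bar>x\<bar> < real k" using reals_Archimedean2 by blast
      then have k: "x \<in> {-real k<..<real k}" by auto
      have "x \<notin> ?S (real k) s t" using elim st by blast
      then have "\<not> (\<forall>d>0. \<exists>y. y \<noteq> x \<and> \<bar>y - x\<bar> < d \<and> (prim w y - prim w x) / (y - x) > t)"
        using k st by auto
      then obtain d where "d > 0" "\<not> (\<exists>y. y \<noteq> x \<and> \<bar>y - x\<bar> < d \<and> (prim w y - prim w x) / (y - x) > t)"
        by blast
      then show "\<exists>d>0. \<forall>y. y \<noteq> x \<longrightarrow> \<bar>y - x\<bar> < d \<longrightarrow> (prim w y - prim w x) / (y - x) \<le> w x + e"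
        using st by (intro exI[of _ d]) force
    qed
  qed
qed

lemma prim_uminus: "loc_int w \<Longrightarrow> prim (\<lambda>x. - w x) y = - prim w y"
  by (simp add: prim_def set_integral_uminus loc_int_def)

lemma loc_int_uminus: "loc_int w \<Longrightarrow> loc_int (\<lambda>x. - w x)"
  unfolding loc_int_def set_integrable_def by simp

text \<open>
  The upper estimate applied to \<open>w\<close> and to \<open>- w\<close>.
\<close>
lemma prim_has_real_derivative:
  fixes w :: "real \<Rightarrow> real"
  assumes w: "loc_int w"
  shows "AE x in lebesgue. (prim w has_real_derivative w x) (at x)"
  using prim_quotient_upper[OF w] prim_quotient_upper[OF loc_int_uminus[OF w]]
proof eventually_elim
  case (elim x)
  show ?case
    unfolding has_field_derivative_iff
  proof (rule LIM_I)
    fix e :: real assume e: "e > 0"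
    obtain d1 where d1: "d1 > 0" "\<And>y. y \<noteq> x \<Longrightarrow> \<bar>y - x\<bar> < d1 \<Longrightarrow> (prim w y - prim w x) / (y - x) \<le> w x + e/2"
      using elim(1) e by (meson half_gt_zero)
    obtain d2 where d2: "d2 > 0" "\<And>y. y \<noteq> x \<Longrightarrow> \<bar>y - x\<bar> < d2 \<Longrightarrow>
      (prim (\<lambda>x. - w x) y - prim (\<lambda>x. - w x) x) / (y - x) \<le> - w x + e/2"
      using elim(2) e by (meson half_gt_zero)
    show "\<exists>s>0. \<forall>y. y \<noteq> x \<and> norm (y - x) < s \<longrightarrow> norm ((prim w y - prim w x) / (y - x) - w x) < e"
    proof (intro exI[of _ "min d1 d2"] conjI allI impI)
      fix y assume y: "y \<noteq> x \<and> norm (y - x) < min d1 d2"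
      have "(prim (\<lambda>x. - w x) y - prim (\<lambda>x. - w x) x) / (y - x) = - ((prim w y - prim w x) / (y - x))"
        by (simp add: prim_uminus[OF w] field_simps minus_divide_left)
      then show "norm ((prim w y - prim w x) / (y - x) - w x) < e"
        using d1(2)[of y] d2(2)[of y] y e by (auto simp: abs_less_iff)
    qed (use d1 d2 in auto)
  qed
qed

lemma loc_int_inner:
  fixes w :: "real \<Rightarrow> 'a::euclidean_space"
  assumes "loc_int w"
  shows "loc_int (\<lambda>x. w x \<bullet> i)" "prim (\<lambda>x. w x \<bullet> i) y = prim w y \<bullet> i"
proof -
  have *: "integrable lebesgue (\<lambda>x. indicator {a..b} x *\<^sub>R w x)" for a b
    using assms by (auto simp: loc_int_def set_integrable_def)
  show "loc_int (\<lambda>x. w x \<bullet> i)"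
    unfolding loc_int_def set_integrable_def
    using integrable_inner_left[OF *] by simp
  have "(LINT t:{a..b}|lebesgue. w t \<bullet> i) = (LINT t:{a..b}|lebesgue. w t) \<bullet> i" for a b
    unfolding set_lebesgue_integral_def using integral_inner_left[OF *] by simp
  then show "prim (\<lambda>x. w x \<bullet> i) y = prim w y \<bullet> i" by (simp add: prim_def)
qed

theorem prim_has_vector_derivative:
  fixes w :: "real \<Rightarrow> 'a::euclidean_space"
  assumes w: "loc_int w"
  shows "AE x in lebesgue. (prim w has_vector_derivative w x) (at x)"
proof -
  have eq: "prim (\<lambda>x. w x \<bullet> i) = (\<lambda>y. prim w y \<bullet> i)" for i
    by (rule ext) (rule loc_int_inner(2)[OF w])
  have "AE x in lebesgue. \<forall>i\<in>Basis. (prim (\<lambda>x. w x \<bullet> i) has_real_derivative w x \<bullet> i) (at x)"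
    by (rule AE_finite_allI) (auto intro!: prim_has_real_derivative loc_int_inner w)
  then show ?thesis
  proof eventually_elim
    case (elim x)
    show ?case
      unfolding has_vector_derivative_def
      by (subst has_derivative_componentwise_within)
        (use elim in \<open>auto simp: has_field_derivative_def eq mult_commute_abs\<close>)
  qed
qed

section \<open>Growth estimates that ignore null sets\<close>

lemma nonoverlapping_mono: "nonoverlapping a x n s t \<Longrightarrow> x \<le> y \<Longrightarrow> nonoverlapping a y n s t"
  unfolding nonoverlapping_def by (meson order_trans)

text \<open>
  Cover the null set by an open \<open>U\<close> of so small measure that the variation of \<open>f\<close> inside \<open>U\<close> is
  below \<open>\<eta>\<close>, and let \<open>W x\<close> be the variation of \<open>f\<close> inside \<open>U\<close> up to \<open>x\<close>. The inequality
  \<open>f x - f a \<le> e (x - a) + W x\<close> holds at \<open>a\<close>, is preserved under suprema by continuity, and can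
  be continued to the right of every point: by the growth hypothesis outside the null set, and
  by the definition of \<open>W\<close> inside \<open>U\<close>. So it reaches \<open>b\<close>.
\<close>
lemma growth_off_null_set:
  fixes f :: "real \<Rightarrow> real"
  assumes f: "ac f" and ab: "a \<le> b" and e: "e > 0" and N: "N \<in> null_sets lebesgue"
    and small: "\<And>x d. a \<le> x \<Longrightarrow> x < b \<Longrightarrow> x \<notin> N \<Longrightarrow> d > 0 \<Longrightarrow> \<exists>h. 0 < h \<and> h < d \<and> f (x + h) - f x \<le> e * h"
  shows "f b - f a \<le> e * (b - a)"
proof (rule field_le_epsilon)
  fix \<eta> :: real assume \<eta>: "\<eta> > 0"
  obtain d where d: "d > 0" "\<And>n s t. nonoverlapping a b n s t \<Longrightarrow>
        (\<Sum>k<n. t k - s k) < d \<Longrightarrow> (\<Sum>k<n. norm (f (t k) - f (s k))) < \<eta>"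
    by (rule acE[OF f \<eta>, of a b]) (rule that)
  obtain U where U: "open U" "N \<subseteq> U" "(U - N) \<in> lmeasurable" "emeasure lebesgue (U - N) < ennreal d"
    by (rule sets_lebesgue_outer_open[OF null_setsD2[OF N] d(1)]) (rule that)
  have "emeasure lebesgue ((U - N) \<union> N) = emeasure lebesgue (U - N)"
    using U N by (intro emeasure_Un_null_set) auto
  moreover have "(U - N) \<union> N = U" using U by blast
  ultimately have emU: "emeasure lebesgue U < ennreal d" using U(4) by (simp only:)
  define VS where "VS x = {\<Sum>k<n. \<bar>f (t k) - f (s k)\<bar> | n s t. nonoverlapping a x n s t \<and> (\<forall>k<n. {s k..t k} \<subseteq> U)}" for x
  define W where "W x = Sup (VS x)" for x
  have bound: "v < \<eta>" if v: "v \<in> VS x" and x: "x \<le> b" for v x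
  proof -
    obtain n s t where v: "v = (\<Sum>k<n. \<bar>f (t k) - f (s k)\<bar>)" "nonoverlapping a x n s t" "\<And>k. k < n \<Longrightarrow> {s k..t k} \<subseteq> U"
      using v unfolding VS_def by blast
    have no: "nonoverlapping a b n s t" using v(2) x by (rule nonoverlapping_mono)
    have "ennreal (\<Sum>k<n. t k - s k) = emeasure lebesgue (\<Union>k<n. {s k<..<t k})"
      using no by (intro disjoint_intervals_length[symmetric]) (auto simp: nonoverlapping_def)
    also have "\<dots> \<le> emeasure lebesgue U"
      using v(3) U(1) by (intro emeasure_mono) force+
    also have "\<dots> < ennreal d" by (rule emU)
    finally have "(\<Sum>k<n. t k - s k) < d"
      using no by (subst (asm) ennreal_less_iff) (auto simp: nonoverlapping_def intro!: sum_nonneg)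
    from d(2)[OF no this] show ?thesis using v(1) by simp
  qed
  have bdd: "bdd_above (VS x)" if "x \<le> b" for x
    using bound[OF _ that] by (intro bdd_aboveI[of _ \<eta>]) force
  have zero: "0 \<in> VS x" for x
    unfolding VS_def by (auto intro!: exI[of _ "0::nat"] simp: nonoverlapping_def disjoint_family_on_def)
  have VS_mono: "VS x \<subseteq> VS y" if "x \<le> y" for x y
    unfolding VS_def using nonoverlapping_mono[OF _ that] by blast
  have W_mono: "W x \<le> W y" if "x \<le> y" "y \<le> b" for x y
    unfolding W_def using that VS_mono bdd zero[of x] by (intro cSup_subset_mono) auto
  have W_bound: "W x \<le> \<eta>" if "x \<le> b" for x
    unfolding W_def using bound[OF _ that] zero by (intro cSup_least) force+
  have W_nonneg: "0 \<le> W x" if "x \<le> b" for x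
    unfolding W_def using bdd[OF that] zero by (intro cSup_upper)
  (* Appending the interval from \<open>x\<close> to \<open>y\<close> to a family that ends before \<open>x\<close>. *)
  have W_add: "W x + \<bar>f y - f x\<bar> \<le> W y" if xy: "a \<le> x" "x \<le> y" "y \<le> b" "{x..y} \<subseteq> U" for x y
  proof -
    have "v \<le> W y - \<bar>f y - f x\<bar>" if vx: "v \<in> VS x" for v
    proof -
      obtain n s t where v: "v = (\<Sum>k<n. \<bar>f (t k) - f (s k)\<bar>)" "nonoverlapping a x n s t" "\<And>k. k < n \<Longrightarrow> {s k..t k} \<subseteq> U"
        using vx unfolding VS_def by blast
      let ?s = "s(n := x)" and ?t = "t(n := y)"
      have tx: "t k \<le> x" if "k < n" for k using v(2) that by (auto simp: nonoverlapping_def)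
      have "nonoverlapping a y (Suc n) ?s ?t"
        unfolding nonoverlapping_def
      proof (intro conjI allI impI)
        show "disjoint_family_on (\<lambda>k. {?s k<..<?t k}) {..<Suc n}"
          unfolding disjoint_family_on_def
        proof (intro ballI impI)
          fix i j assume ij: "i \<in> {..<Suc n}" "j \<in> {..<Suc n}" "i \<noteq> j"
          then consider "i < n" "j < n" | "i = n" "j < n" | "i < n" "j = n" by force
          then show "{?s i<..<?t i} \<inter> {?s j<..<?t j} = {}"
          proof cases
            case 1
            then show ?thesis using v(2) ij by (auto simp: nonoverlapping_def disjoint_family_on_def)
          next
            case 2
            then show ?thesis using tx[of j] by auto
          next
            case 3
            then show ?thesis using tx[of i] by auto
          qed
        qed
      qed (use v(2) xy in \<open>auto simp: nonoverlapping_def less_Suc_eq dest: tx intro: order_trans\<close>)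
      moreover have "\<forall>k<Suc n. {?s k..?t k} \<subseteq> U" using v(3) xy by (auto simp: less_Suc_eq)
      ultimately have "(\<Sum>k<Suc n. \<bar>f (?t k) - f (?s k)\<bar>) \<in> VS y" unfolding VS_def by blast
      then have "(\<Sum>k<Suc n. \<bar>f (?t k) - f (?s k)\<bar>) \<le> W y"
        unfolding W_def using bdd[OF xy(3)] by (rule cSup_upper)
      moreover have "(\<Sum>k<Suc n. \<bar>f (?t k) - f (?s k)\<bar>) = v + \<bar>f y - f x\<bar>" using v(1) by simp
      ultimately show ?thesis by linarith
    qed
    then have "W x \<le> W y - \<bar>f y - f x\<bar>" unfolding W_def[of x] using zero by (intro cSup_least) blast+
    then show ?thesis by linarith
  qed
  define A where "A = {x \<in> {a..b}. f x - f a \<le> e * (x - a) + W x}"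
  define c where "c = Sup A"
  have aA: "a \<in> A" using ab W_nonneg by (auto simp: A_def)
  have bddA: "bdd_above A" by (auto simp: A_def intro!: bdd_aboveI[of _ b])
  have cab: "a \<le> c" "c \<le> b"
    unfolding c_def using aA bddA by (auto intro!: cSup_upper cSup_least) (auto simp: A_def)
  have cA: "c \<in> A"
  proof -
    have "f c - f a \<le> e * (c - a) + W c"
    proof (rule field_le_epsilon)
      fix \<delta> :: real assume "\<delta> > 0"
      obtain d' where d': "d' > 0" "\<And>x y. a \<le> x \<Longrightarrow> x \<le> y \<Longrightarrow> y \<le> b \<Longrightarrow> y - x < d' \<Longrightarrow> norm (f y - f x) < \<delta>"
        by (rule ac_uniform[OF f \<open>\<delta> > 0\<close>, of a b]) (rule that)
      have "c - d' < Sup A" using d' by (simp add: c_def)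
      then obtain x where x: "x \<in> A" "c - d' < x" using aA bddA less_cSup_iff[of A] by blast
      have xc: "x \<le> c" unfolding c_def using x bddA by (intro cSup_upper)
      have "norm (f c - f x) < \<delta>" using x xc cab by (intro d'(2)) (auto simp: A_def)
      moreover have "e * (x - a) \<le> e * (c - a)" using e xc by (intro mult_left_mono) auto
      moreover have "W x \<le> W c" using xc cab by (rule_tac W_mono)
      moreover have "f x - f a \<le> e * (x - a) + W x" using x by (simp add: A_def)
      ultimately show "f c - f a \<le> e * (c - a) + W c + \<delta>" by (simp add: abs_less_iff)
    qed
    then show ?thesis using cab by (simp add: A_def)
  qed
  (* At a point \<open>c < b\<close> the inequality could be continued, against the choice of \<open>c\<close>. *)
  have "c = b"
  proof (rule ccontr)
    assume "c \<noteq> b"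
    then have cb: "c < b" using cab by simp
    have "\<exists>y. c < y \<and> y \<le> b \<and> f y - f c \<le> e * (y - c) + (W y - W c)"
    proof (cases "c \<in> U")
      case True
      then obtain \<epsilon> where \<epsilon>: "\<epsilon> > 0" "ball c \<epsilon> \<subseteq> U" using U(1) openE by blast
      define y where "y = min b (c + \<epsilon>/2)"
      have y: "c < y" "y \<le> b" "{c..y} \<subseteq> U"
        using cb \<epsilon> by (auto simp: y_def subset_eq dist_real_def)
      have "0 \<le> e * (y - c)" using e y by simp
      then show ?thesis using W_add[of c y] y cab by (intro exI[of _ y]) (auto simp: abs_le_iff)
    next
      case False
      then have "c \<notin> N" using U by blast
      from small[OF cab(1) cb this, of "b - c"] cb obtain h where h: "0 < h" "h < b - c" "f (c + h) - f c \<le> e * h" by auto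
      then show ?thesis using W_mono[of c "c+h"] by (intro exI[of _ "c + h"]) auto
    qed
    then obtain y where y: "c < y" "y \<le> b" "f y - f c \<le> e * (y - c) + (W y - W c)" by blast
    have "y \<in> A" using cA y cab by (auto simp: A_def algebra_simps)
    then have "y \<le> c" unfolding c_def using bddA by (rule cSup_upper)
    then show False using y by simp
  qed
  then show "f b - f a \<le> e * (b - a) + \<eta>" using cA W_bound[of b] by (auto simp: A_def)
qed

text \<open>
  For almost every \<open>x\<close> the quotients of \<open>prim w\<close> at \<open>x\<close> tend to \<open>w x\<close>, so that \<open>f - prim w\<close>
  satisfies the hypothesis of the previous lemma with every \<open>e > 0\<close>. One small step to the right
  of each point is enough, so that the lemma applies with a lower derivative in the place of
  \<open>w\<close>.
\<close>
lemma growth_bound: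
  fixes f w :: "real \<Rightarrow> real"
  assumes f: "ac f" and w: "loc_int w" and ab: "a \<le> b"
    and small: "AE x in lebesgue. a < x \<longrightarrow> x < b \<longrightarrow>
      (\<forall>e>0. \<forall>d>0. \<exists>h. 0 < h \<and> h < d \<and> f (x + h) - f x \<le> (w x + e) * h)"
  shows "f b - f a \<le> prim w b - prim w a"
proof (cases "a = b")
  case False
  with ab have ab': "a < b" by simp
  let ?g = "\<lambda>x. f x - prim w x"
  have g: "ac ?g" by (intro ac_diff f ac_prim w)
  have "?g b - ?g a \<le> \<eta>" if \<eta>: "\<eta> > 0" for \<eta>
  proof -
    define e where "e = \<eta> / (b - a)"
    have e: "e > 0" using \<eta> ab' by (simp add: e_def)
    have "AE x in lebesgue. x \<noteq> a"
      using AE_lborel_singleton[of a] by (auto intro!: AE_completion elim: eventually_mono)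
    with small prim_has_real_derivative[OF w]
    have "AE x in lebesgue. a \<le> x \<longrightarrow> x < b \<longrightarrow> (\<forall>d>0. \<exists>h. 0 < h \<and> h < d \<and> ?g (x + h) - ?g x \<le> e * h)"
    proof eventually_elim
      case (elim x)
      show ?case
      proof (intro impI allI)
        fix d :: real assume x: "a \<le> x" "x < b" and d: "d > 0"
        have "((\<lambda>y. (prim w y - prim w x) / (y - x)) \<longlongrightarrow> w x) (at x)"
          using elim(2) by (simp add: has_field_derivative_iff)
        then have "\<forall>\<^sub>F y in at x. (prim w y - prim w x) / (y - x) > w x - e/2"
          using e by (intro order_tendstoD) auto
        then obtain d1 where d1: "d1 > 0" "\<And>y. y \<noteq> x \<Longrightarrow> dist y x < d1 \<Longrightarrow> (prim w y - prim w x) / (y - x) > w x - e/2"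
          unfolding eventually_at by auto
        have "a < x" using x elim by simp
        then obtain h where h: "0 < h" "h < min d d1" "f (x + h) - f x \<le> (w x + e/2) * h"
          using elim(1) x d d1(1) e by (metis half_gt_zero min_less_iff_conj)
        have "(prim w (x+h) - prim w x) / h > w x - e/2" using d1(2)[of "x+h"] h by (auto simp: dist_real_def)
        then have "prim w (x+h) - prim w x > (w x - e/2) * h" using h by (simp add: field_simps)
        moreover have "(w x + e/2) * h - (w x - e/2) * h = e * h" by (simp add: algebra_simps)
        ultimately show "\<exists>h. 0 < h \<and> h < d \<and> ?g (x + h) - ?g x \<le> e * h"
          using h by (intro exI[of _ h]) auto
      qed
    qed
    then obtain N where N: "N \<in> null_sets lebesgue"
      "\<And>x. x \<notin> N \<Longrightarrow> a \<le> x \<longrightarrow> x < b \<longrightarrow> (\<forall>d>0. \<exists>h. 0 < h \<and> h < d \<and> ?g (x + h) - ?g x \<le> e * h)"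
      by (auto elim!: AE_E3)
    have "?g b - ?g a \<le> e * (b - a)"
      by (rule growth_off_null_set[OF g ab e N(1)]) (use N(2) in blast)
    then show ?thesis using ab' by (simp add: e_def)
  qed
  then have "?g b - ?g a \<le> 0" by (rule_tac field_le_epsilon) auto
  then show ?thesis by simp
qed simp

lemma growth_bound_within:
  fixes f w :: "real \<Rightarrow> real"
  assumes f: "ac f" and w: "loc_int w" and xy: "a \<le> x" "x \<le> y" "y \<le> b"
    and small: "AE z in lebesgue. a < z \<longrightarrow> z < b \<longrightarrow>
      (\<forall>e>0. \<forall>d>0. \<exists>h. 0 < h \<and> h < d \<and> f (z + h) - f z \<le> (w z + e) * h)"
  shows "f y - f x \<le> prim w y - prim w x"
  by (rule growth_bound[OF f w xy(2)], rule eventually_mono[OF small]) (use xy in simp)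

section \<open>The fundamental theorem of calculus for absolutely continuous functions\<close>

text \<open>
  An integral over a long interval, read as an average over the starting points of equidistant
  grids.
\<close>
lemma integral_grid:
  fixes \<phi> :: "real \<Rightarrow> real"
  assumes cont: "continuous_on UNIV \<phi>" and h: "h \<ge> 0"
  shows "integral {c..c + real m * h} \<phi> = (\<Sum>i<m. integral {0..h} (\<lambda>y. \<phi> (c + real i * h + y)))"
proof (induction m)
  case (Suc m)
  let ?d = "c + real m * h"
  have int: "\<phi> integrable_on S" if "S = {u..v}" for S u v
    unfolding that by (rule integrable_continuous_real) (rule continuous_on_subset[OF cont], simp)
  have "integral {c..?d} \<phi> + integral {?d..h + ?d} \<phi> = integral {c..h + ?d} \<phi>"
    using h by (intro Henstock_Kurzweil_Integration.integral_combine int[OF refl]) auto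
  moreover have "integral {?d..h + ?d} \<phi> = integral {0..h} (\<lambda>y. \<phi> (?d + y))"
    using integral_shift_Icc_real[of 0 h \<phi> ?d] by (simp add: comp_def)
  moreover have eq: "c + real (Suc m) * h = h + ?d" by (simp add: algebra_simps)
  ultimately show ?case unfolding eq using Suc by simp
qed simp

lemma loc_int_of_integrable:
  fixes w :: "real \<Rightarrow> 'a::euclidean_space"
  shows "integrable lebesgue w \<Longrightarrow> loc_int w"
  unfolding loc_int_def set_integrable_def by (auto intro!: integrable_mult_indicator)

lemma loc_int_restrict:
  fixes w :: "real \<Rightarrow> 'a::euclidean_space"
  assumes "set_integrable lebesgue {a..b} w"
  shows "loc_int (\<lambda>x. indicator {a..b} x *\<^sub>R w x)"
  using assms by (intro loc_int_of_integrable) (simp add: set_integrable_def)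

text \<open>
  The dominating density is the lower limit of the absolute difference quotients with steps
  \<open>h j\<close>. It is integrable by Fatou's lemma, because the integrals of the quotients are bounded:
  averaged over the starting points of a grid of mesh \<open>h j\<close>, such an integral is a sum of the
  increments of \<open>f\<close> over consecutive grid intervals, and absolute continuity bounds these sums
  on short intervals. The increments of \<open>f\<close> are then dominated by \<open>growth_bound\<close>.
\<close>
lemma ac_dominated:
  fixes f :: "real \<Rightarrow> real"
  assumes f: "ac f" and ab: "a < b"
  shows "\<exists>w. loc_int w \<and> (\<forall>x y. a \<le> x \<longrightarrow> x \<le> y \<longrightarrow> y \<le> b \<longrightarrow> \<bar>f y - f x\<bar> \<le> prim w y - prim w x)"
proof -
  have cont: "continuous_on S f" for S by (rule ac_continuous[OF f])
  have conth: "continuous_on S (\<lambda>x. \<bar>f (x + h) - f x\<bar>)" for h S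
    by (intro continuous_on_rabs continuous_on_diff cont continuous_on_compose2[OF cont[of UNIV]] continuous_intros) auto
  (* The grids that start in \<open>[a, b]\<close> run past \<open>b\<close>; hence the larger interval. *)
  obtain d where d: "d > 0" "\<And>n s t. nonoverlapping a (b + 2*(b-a)) n s t \<Longrightarrow>
        (\<Sum>k<n. t k - s k) < d \<Longrightarrow> (\<Sum>k<n. norm (f (t k) - f (s k))) < 1"
    by (rule acE[OF f zero_less_one, of a "b + 2*(b-a)"]) (rule that)
  obtain n :: nat where n: "(b - a) / d < real n" using reals_Archimedean2 by blast
  have n0: "n > 0" using n d ab by (cases n) (auto simp: field_simps)
  define l where "l = (b - a) / real n"
  have "(b - a) / real n \<le> (b - a) / 1" using n0 ab by (intro divide_left_mono) auto
  then have l: "l > 0" "l < d" "l \<le> b - a"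
    using n n0 d(1) ab by (auto simp: l_def field_simps)
  (* The steps divide the block length \<open>l\<close>, so that a block is a union of whole grid intervals.
     *)
  define h where "h j = l / real (Suc j)" for j
  have h: "h j > 0" "h j \<le> l" "real (Suc j) * h j = l" for j
    using l by (auto simp: h_def field_simps)
  define g where "g j x = \<bar>f (x + h j) - f x\<bar> / h j" for j x
  have gcont: "continuous_on S (g j)" for S j
    unfolding g_def using h(1)[of j] by (intro continuous_on_divide conth continuous_on_const) auto
  have block: "integral {c..c+l} (g j) \<le> 1" if c: "a \<le> c" "c \<le> b" for c j
  proof -
    have sums: "(\<Sum>i<Suc j. \<bar>f (c + real i * h j + y + h j) - f (c + real i * h j + y)\<bar>) \<le> 1" if y: "0 \<le> y" "y \<le> h j" for y
    proof -
      let ?s = "\<lambda>i. c + real i * h j + y" and ?t = "\<lambda>i. c + real i * h j + y + h j"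
      have "nonoverlapping a (b + 2*(b-a)) (Suc j) ?s ?t"
        unfolding nonoverlapping_def
      proof (intro conjI allI impI)
        fix i assume i: "i < Suc j"
        show "a \<le> ?s i" using c y mult_nonneg_nonneg[of "real i" "h j"] h(1)[of j] by linarith
        show "?s i \<le> ?t i" using h(1)[of j] by simp
        have "real (Suc i) * h j \<le> real (Suc j) * h j" using i h(1)[of j] by (intro mult_right_mono) auto
        also have "\<dots> = l" by (rule h(3))
        finally have "real i * h j + h j \<le> l" by (simp add: algebra_simps)
        moreover have "y \<le> l" using y(2) h(2)[of j] by linarith
        ultimately have "c + (real i * h j + h j) + y \<le> b + (b - a) + (b - a)"
          using c(2) l(3) by (intro add_mono) auto
        then show "?t i \<le> b + 2*(b-a)" by (simp add: algebra_simps)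
      next
        have *: "?t i \<le> ?s k" if "i < k" for i k
        proof -
          have "real (Suc i) * h j \<le> real k * h j" using that h(1)[of j] by (intro mult_right_mono) auto
          then show ?thesis by (simp add: algebra_simps)
        qed
        show "disjoint_family_on (\<lambda>i. {?s i<..<?t i}) {..<Suc j}"
          unfolding disjoint_family_on_def
        proof (intro ballI impI)
          fix i k :: nat assume "i \<noteq> k"
          then consider "?t i \<le> ?s k" | "?t k \<le> ?s i" using *[of i k] *[of k i] by linarith
          then show "{?s i<..<?t i} \<inter> {?s k<..<?t k} = {}" by cases auto
        qed
      qed
      moreover have "(\<Sum>i<Suc j. ?t i - ?s i) = l" using h(3)[of j] by simp
      ultimately have "(\<Sum>i<Suc j. norm (f (?t i) - f (?s i))) < 1" using l by (intro d(2)) auto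
      then show ?thesis unfolding real_norm_def by (rule less_imp_le)
    qed
    let ?\<phi> = "\<lambda>x. \<bar>f (x + h j) - f x\<bar>"
    have int: "(\<lambda>y. ?\<phi> (c + real i * h j + y)) integrable_on {0..h j}" for i
      by (intro integrable_continuous_real continuous_on_compose2[OF conth[of UNIV]] continuous_intros) auto
    have "integral {c..c+l} ?\<phi> = (\<Sum>i<Suc j. integral {0..h j} (\<lambda>y. ?\<phi> (c + real i * h j + y)))"
      using integral_grid[OF conth[of UNIV "h j"] less_imp_le[OF h(1)[of j]], where c=c and m="Suc j"] unfolding h(3)[of j] .
    also have "\<dots> = integral {0..h j} (\<lambda>y. \<Sum>i<Suc j. ?\<phi> (c + real i * h j + y))"
      by (rule Henstock_Kurzweil_Integration.integral_sum[symmetric]) (use int in auto)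
    also have "\<dots> \<le> integral {0..h j} (\<lambda>y. 1)"
    proof (rule integral_le)
      show "(\<lambda>y. \<Sum>i<Suc j. ?\<phi> (c + real i * h j + y)) integrable_on {0..h j}"
        by (rule integrable_sum) (use int in auto)
    qed (use sums in \<open>auto simp del: sum.lessThan_Suc\<close>)
    also have "\<dots> = h j" using h(1)[of j] by simp
    finally have "integral {c..c+l} ?\<phi> \<le> h j" .
    moreover have "integral {c..c+l} (g j) = integral {c..c+l} ?\<phi> / h j"
      unfolding g_def by (rule Henstock_Kurzweil_Integration.integral_divide)
    ultimately show ?thesis using h(1)[of j] by simp
  qed
  have gmeas[measurable]: "g j \<in> borel_measurable borel" for j
    using gcont by (rule borel_measurable_continuous_onI)
  define v where "v x = liminf (\<lambda>j. ennreal (g j x))" for x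
  have vmeas[measurable]: "v \<in> borel_measurable borel" unfolding v_def by measurable
  have g0: "0 \<le> g j x" for j x using h(1)[of j] by (simp add: g_def)
  have nnblock: "(\<integral>\<^sup>+x. v x * indicator {c..c+l} x \<partial>lebesgue) \<le> 1" if c: "a \<le> c" "c \<le> b" for c
  proof -
    have "(\<integral>\<^sup>+x. v x * indicator {c..c+l} x \<partial>lebesgue) = (\<integral>\<^sup>+x. v x * indicator {c..c+l} x \<partial>lborel)"
      by (rule nn_integral_completion)
    also have "\<dots> = (\<integral>\<^sup>+x. liminf (\<lambda>j. ennreal (g j x) * indicator {c..c+l} x) \<partial>lborel)"
      by (intro nn_integral_cong) (auto simp: v_def indicator_def Liminf_const)
    also have "\<dots> \<le> liminf (\<lambda>j. \<integral>\<^sup>+x. ennreal (g j x) * indicator {c..c+l} x \<partial>lborel)"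
      by (rule nn_integral_liminf) measurable
    also have "\<dots> \<le> liminf (\<lambda>j. 1)"
    proof (rule Liminf_mono, rule always_eventually, rule allI)
      fix j
      have "(\<integral>\<^sup>+x. ennreal (g j x) * indicator {c..c+l} x \<partial>lborel) = ennreal (integral {c..c+l} (g j))"
        by (rule nn_integral_has_integral_lebesgue'[OF g0])
          (intro integrable_integral integrable_continuous_real gcont)
      also have "\<dots> \<le> ennreal 1" by (intro ennreal_leI block c)
      finally show "(\<integral>\<^sup>+x. ennreal (g j x) * indicator {c..c+l} x \<partial>lborel) \<le> 1" by simp
    qed
    finally show ?thesis by (simp add: Liminf_const)
  qed
  define w0 where "w0 x = enn2real (v x)" for x
  have w0meas: "w0 \<in> borel_measurable lebesgue" unfolding w0_def by (rule measurable_completion) measurable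
  have bint: "set_integrable lebesgue {c..c+l} w0" if c: "a \<le> c" "c \<le> b" for c
    unfolding set_integrable_def
  proof (rule integrableI_bounded)
    show "(\<lambda>x. indicat_real {c..c + l} x *\<^sub>R w0 x) \<in> borel_measurable lebesgue"
      using w0meas by (intro borel_measurable_scaleR borel_measurable_indicator) auto
    have "(\<integral>\<^sup>+x. ennreal (norm (indicat_real {c..c + l} x *\<^sub>R w0 x)) \<partial>lebesgue)
      \<le> (\<integral>\<^sup>+x. v x * indicator {c..c+l} x \<partial>lebesgue)"
      by (intro nn_integral_mono) (auto simp: w0_def indicator_def ennreal_enn2real_if)
    also have "\<dots> \<le> 1" by (rule nnblock[OF c])
    also have "\<dots> < \<infinity>" by simp
    finally show "(\<integral>\<^sup>+x. ennreal (norm (indicat_real {c..c + l} x *\<^sub>R w0 x)) \<partial>lebesgue) < \<infinity>" .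
  qed
  have bfin: "AE x in lebesgue. x \<in> {c..c+l} \<longrightarrow> v x \<noteq> \<infinity>" if c: "a \<le> c" "c \<le> b" for c
  proof -
    have "AE x in lebesgue. v x * indicator {c..c+l} x \<noteq> \<infinity>"
    proof (rule nn_integral_PInf_AE)
      show "(\<lambda>x. v x * indicator {c..c+l} x) \<in> borel_measurable lebesgue" by (rule measurable_completion) measurable
      show "(\<integral>\<^sup>+x. v x * indicator {c..c+l} x \<partial>lebesgue) \<noteq> \<infinity>" using nnblock[OF c] by (auto simp: top_unique)
    qed
    then show ?thesis by eventually_elim (auto simp: indicator_def)
  qed
  have "set_integrable lebesgue {a..a + real k * l} w0 \<and> (AE x in lebesgue. x \<in> {a..a + real k * l} \<longrightarrow> v x \<noteq> \<infinity>)" if "k \<le> n" for k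
    using that
  proof (induction k)
    case 0
    have "AE x in lebesgue. x \<in> {a..a + l} \<longrightarrow> v x \<noteq> \<infinity>" using ab by (intro bfin) auto
    then have "AE x in lebesgue. x \<in> {a..a + real 0 * l} \<longrightarrow> v x \<noteq> \<infinity>"
      by eventually_elim (use l in auto)
    moreover have "set_integrable lebesgue {a..a + real 0 * l} w0"
      by (rule set_integrable_subset[OF bint[of a]]) (use ab l in auto)
    ultimately show ?case by blast
  next
    case (Suc k)
    let ?c = "a + real k * l"
    have "real k * l \<le> real n * l" using Suc l by (intro mult_right_mono) auto
    also have "\<dots> = b - a" using n0 by (simp add: l_def)
    finally have c: "a \<le> ?c" "?c \<le> b" using l by auto
    have eq: "{a..a + real (Suc k) * l} = {a..?c} \<union> {?c..?c+l}"
    proof -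
      have "a + real (Suc k) * l = ?c + l" by (simp add: algebra_simps)
      then show ?thesis using ivl_disj_un_two_touch(4)[OF c(1), of "?c + l"] l by simp
    qed
    have "AE x in lebesgue. x \<in> {a..a + real (Suc k) * l} \<longrightarrow> v x \<noteq> \<infinity>"
      using Suc bfin[OF c] unfolding eq by (auto elim: eventually_elim2)
    moreover have "set_integrable lebesgue {a..a + real (Suc k) * l} w0"
      unfolding eq using Suc bint[OF c] by (intro set_integrable_Un) auto
    ultimately show ?case by blast
  qed
  from this[of n] have w0int: "set_integrable lebesgue {a..b} w0" and vfin: "AE x in lebesgue. x \<in> {a..b} \<longrightarrow> v x \<noteq> \<infinity>"
    using n0 by (auto simp: l_def)
  define w where "w x = indicator {a..b} x *\<^sub>R w0 x" for x
  have w: "loc_int w" unfolding w_def by (rule loc_int_restrict[OF w0int])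
  have small: "\<exists>j. h j < \<delta> \<and> \<bar>f (x + h j) - f x\<bar> \<le> (w x + e) * h j"
    if x: "x \<in> {a..b}" "v x \<noteq> \<infinity>" and e: "e > 0" and \<delta>: "\<delta> > 0" for x e \<delta>
  proof (rule ccontr)
    assume no: "\<not> ?thesis"
    have wx: "ennreal (w x) = v x" "w x \<ge> 0" using x by (auto simp: w_def w0_def less_top)
    have "(\<lambda>j. l * inverse (real (Suc j))) \<longlonglongrightarrow> 0"
      using tendsto_mult_right_zero[OF LIMSEQ_inverse_real_of_nat] .
    then have "h \<longlonglongrightarrow> 0" unfolding h_def by (simp add: divide_inverse)
    then have "\<forall>\<^sub>F j in sequentially. h j < \<delta>" using \<delta> by (rule order_tendstoD)
    then have "\<forall>\<^sub>F j in sequentially. ennreal (w x + e) \<le> ennreal (g j x)"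
    proof eventually_elim
      case (elim j)
      then have "\<bar>f (x + h j) - f x\<bar> > (w x + e) * h j" using no by auto
      then have "g j x > w x + e" using h(1)[of j] by (simp add: g_def field_simps)
      then show ?case by (intro ennreal_leI) auto
    qed
    then have "ennreal (w x + e) \<le> v x" unfolding v_def by (rule Liminf_bounded)
    then have "ennreal (w x + e) \<le> ennreal (w x)" unfolding wx(1) .
    then have "w x + e \<le> w x" by (simp only: ennreal_le_iff[OF wx(2)])
    then show False using e by simp
  qed
  have small': "AE z in lebesgue. a < z \<longrightarrow> z < b \<longrightarrow>
      (\<forall>e>0. \<forall>d>0. \<exists>h. 0 < h \<and> h < d \<and> \<bar>f (z + h) - f z\<bar> \<le> (w z + e) * h)"
    using vfin
  proof eventually_elim
    case (elim z)
    show ?case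
    proof (intro impI allI)
      fix e d :: real assume *: "a < z" "z < b" "e > 0" "d > 0"
      then have z: "z \<in> {a..b}" "v z \<noteq> \<infinity>" using elim by auto
      from small[OF z *(3,4)] show "\<exists>h. 0 < h \<and> h < d \<and> \<bar>f (z + h) - f z\<bar> \<le> (w z + e) * h"
        using h(1) by blast
    qed
  qed
  have "\<bar>f y - f x\<bar> \<le> prim w y - prim w x" if xy: "a \<le> x" "x \<le> y" "y \<le> b" for x y
  proof -
    have "f y - f x \<le> prim w y - prim w x"
    proof (rule growth_bound_within[OF f w xy], rule eventually_mono[OF small'])
      fix z assume "a < z \<longrightarrow> z < b \<longrightarrow> (\<forall>e>0. \<forall>d>0. \<exists>h. 0 < h \<and> h < d \<and> \<bar>f (z + h) - f z\<bar> \<le> (w z + e) * h)"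
      then show "a < z \<longrightarrow> z < b \<longrightarrow> (\<forall>e>0. \<forall>d>0. \<exists>h. 0 < h \<and> h < d \<and> f (z + h) - f z \<le> (w z + e) * h)"
        by (meson abs_le_D1)
    qed
    moreover have "- f y - (- f x) \<le> prim w y - prim w x"
    proof (rule growth_bound_within[OF ac_uminus[OF f] w xy], rule eventually_mono[OF small'])
      fix z assume *: "a < z \<longrightarrow> z < b \<longrightarrow> (\<forall>e>0. \<forall>d>0. \<exists>h. 0 < h \<and> h < d \<and> \<bar>f (z + h) - f z\<bar> \<le> (w z + e) * h)"
      have "- f (z + h) - (- f z) = - (f (z + h) - f z)" for h by simp
      with * show "a < z \<longrightarrow> z < b \<longrightarrow> (\<forall>e>0. \<forall>d>0. \<exists>h. 0 < h \<and> h < d \<and> - f (z + h) - (- f z) \<le> (w z + e) * h)"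
        by (metis abs_le_D2)
    qed
    ultimately show ?thesis by linarith
  qed
  with w show ?thesis by blast
qed

text \<open>
  The integrable dominating function makes the lower limit of the signed quotients finite almost
  everywhere and integrable. By its definition, every point allows small steps with growth at
  most this lower limit plus \<open>e\<close>, as \<open>growth_bound\<close> requires.
\<close>
lemma ac_lower_derivative:
  fixes f :: "real \<Rightarrow> real"
  assumes f: "ac f" and ab: "a < b"
    and h: "\<And>j. h j > 0" and hlim: "h \<longlonglongrightarrow> 0"
  shows "\<exists>lo. loc_int lo \<and> (\<forall>x. \<not> (a < x \<and> x < b) \<longrightarrow> lo x = 0) \<and>
    (AE x in lebesgue. a < x \<longrightarrow> x < b \<longrightarrow> liminf (\<lambda>j. ereal ((f (x + h j) - f x) / h j)) = ereal (lo x)) \<and>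
    (\<forall>x y. a \<le> x \<longrightarrow> x \<le> y \<longrightarrow> y \<le> b \<longrightarrow> f y - f x \<le> prim lo y - prim lo x)"
proof -
  obtain W where W: "loc_int W" and dom: "\<And>x y. a \<le> x \<Longrightarrow> x \<le> y \<Longrightarrow> y \<le> b \<Longrightarrow> \<bar>f y - f x\<bar> \<le> prim W y - prim W x"
    using ac_dominated[OF f ab] by metis
  have cont: "continuous_on S f" for S by (rule ac_continuous[OF f])
  have hev: "\<forall>\<^sub>F j in sequentially. h j < d" if "d > 0" for d using hlim that by (rule order_tendstoD)
  define q where "q j x = (f (x + h j) - f x) / h j" for j x
  have qmeas[measurable]: "q j \<in> borel_measurable borel" for j
    unfolding q_def using h[of j]
    by (intro borel_measurable_continuous_onI continuous_on_divide continuous_on_diff cont continuous_on_const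
      continuous_on_compose2[OF cont[of UNIV]] continuous_intros) auto
  define L where "L x = liminf (\<lambda>j. ereal (q j x))" for x
  have [measurable]: "L \<in> borel_measurable borel"
    unfolding L_def by measurable
  have bnd: "AE x in lebesgue. a < x \<longrightarrow> x < b \<longrightarrow> - ereal (W x) \<le> L x \<and> L x \<le> ereal (W x)"
    using prim_has_real_derivative[OF W]
  proof eventually_elim
    case (elim x)
    show ?case
    proof (intro impI)
      assume x: "a < x" "x < b"
      have "((\<lambda>y. (prim W y - prim W x) / (y - x)) \<longlongrightarrow> W x) (at x)"
        using elim by (simp add: has_field_derivative_iff)
      moreover have "filterlim (\<lambda>j. x + h j) (at x) sequentially"
        unfolding filterlim_at using h tendsto_add[OF tendsto_const[of x] hlim] by (auto simp: less_imp_neq[OF h, symmetric])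
      ultimately have "(\<lambda>j. (prim W (x + h j) - prim W x) / ((x + h j) - x)) \<longlonglongrightarrow> W x"
        by (rule filterlim_compose)
      then have lim: "(\<lambda>j. ereal ((prim W (x + h j) - prim W x) / h j)) \<longlonglongrightarrow> ereal (W x)" (is "?G \<longlonglongrightarrow> _") by simp
      have ev: "\<forall>\<^sub>F j in sequentially. \<bar>q j x\<bar> \<le> (prim W (x + h j) - prim W x) / h j"
      proof -
        have "\<forall>\<^sub>F j in sequentially. h j < b - x" using x by (intro hev) simp
        then show ?thesis
        proof eventually_elim
          case (elim j)
          have "\<bar>f (x + h j) - f x\<bar> \<le> prim W (x + h j) - prim W x"
            using elim x h[of j] by (intro dom) auto
          then show ?case using h[of j] by (simp add: q_def divide_right_mono)
        qed
      qed
      have "(\<lambda>j. - ?G j) \<longlonglongrightarrow> - ereal (W x)" using lim by (rule tendsto_uminus_ereal)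
      then have "- ereal (W x) = liminf (\<lambda>j. - ?G j)" by (intro lim_imp_Liminf[symmetric]) auto
      also have "\<dots> \<le> L x" unfolding L_def using ev by (intro Liminf_mono) (auto elim!: eventually_mono)
      finally have 1: "- ereal (W x) \<le> L x" .
      have "L x \<le> liminf ?G" unfolding L_def using ev by (intro Liminf_mono) (auto elim!: eventually_mono)
      also have "\<dots> = ereal (W x)" using lim by (intro lim_imp_Liminf) auto
      finally show "- ereal (W x) \<le> L x \<and> L x \<le> ereal (W x)" using 1 by simp
    qed
  qed
  define lo where "lo x = indicator {a<..<b} x * real_of_ereal (L x)" for x
  have [measurable]: "lo \<in> borel_measurable lebesgue"
    unfolding lo_def by (rule measurable_completion, measurable)
  have fin: "AE x in lebesgue. a < x \<longrightarrow> x < b \<longrightarrow> L x = ereal (lo x) \<and> \<bar>lo x\<bar> \<le> W x"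
    using bnd
  proof eventually_elim
    case (elim x)
    show ?case
    proof (intro impI)
      assume x: "a < x" "x < b"
      with elim have "- ereal (W x) \<le> L x" "L x \<le> ereal (W x)" by auto
      then show "L x = ereal (lo x) \<and> \<bar>lo x\<bar> \<le> W x"
        using x by (cases "L x") (auto simp: lo_def)
    qed
  qed
  have Wi: "integrable lebesgue (\<lambda>x. indicator {a..b} x *\<^sub>R W x)"
    using loc_intD[OF W, of a b] by (simp add: set_integrable_def)
  have out: "lo x = 0" if "\<not> (a < x \<and> x < b)" for x using that by (auto simp: lo_def)
  have "AE x in lebesgue. norm (lo x) \<le> norm (indicator {a..b} x *\<^sub>R W x)"
    using fin
  proof eventually_elim
    case (elim x)
    then show ?case using out[of x] by (cases "a < x \<and> x < b") auto
  qed
  then have lo: "loc_int lo"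
    by (intro loc_int_of_integrable Bochner_Integration.integrable_bound[OF Wi]) auto
  have "f y - f x \<le> prim lo y - prim lo x" if xy: "a \<le> x" "x \<le> y" "y \<le> b" for x y
  proof (rule growth_bound_within[OF f lo xy])
    show "AE z in lebesgue. a < z \<longrightarrow> z < b \<longrightarrow> (\<forall>e>0. \<forall>d>0. \<exists>h. 0 < h \<and> h < d \<and> f (z + h) - f z \<le> (lo z + e) * h)"
      using fin
    proof eventually_elim
      case (elim z)
      show ?case
      proof (intro impI allI)
        fix e d :: real assume *: "a < z" "z < b" "e > 0" "d > 0"
        then have L: "L z = ereal (lo z)" using elim by auto
        have "\<exists>j. h j < d \<and> q j z < lo z + e"
        proof (rule ccontr)
          assume "\<not> ?thesis"
          then have all: "lo z + e \<le> q j z" if "h j < d" for j using that by (meson not_less)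
          have "\<forall>\<^sub>F j in sequentially. ereal (lo z + e) \<le> ereal (q j z)"
            using hev[OF *(4)] by eventually_elim (simp add: all)
          then have "ereal (lo z + e) \<le> L z" unfolding L_def by (rule Liminf_bounded)
          then show False using L * by simp
        qed
        then obtain j where "h j < d" "q j z < lo z + e" by blast
        then show "\<exists>h. 0 < h \<and> h < d \<and> f (z + h) - f z \<le> (lo z + e) * h"
          using h[of j] by (intro exI[of _ "h j"]) (auto simp: q_def field_simps)
      qed
    qed
  qed
  moreover have "AE x in lebesgue. a < x \<longrightarrow> x < b \<longrightarrow> liminf (\<lambda>j. ereal ((f (x + h j) - f x) / h j)) = ereal (lo x)"
    using fin unfolding L_def q_def by eventually_elim blast
  ultimately show ?thesis using lo out by blast
qed

text \<open>
  Apply the lower-derivative bound to \<open>f\<close> and to \<open>- f\<close>, with the same steps. As the lower limit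
  does not exceed the upper limit, the two one-sided bounds meet, and \<open>f\<close> is the integral of its
  lower derivative.
\<close>
lemma ac_FTC_real_interval:
  fixes f :: "real \<Rightarrow> real"
  assumes f: "ac f" and ab: "a < b"
  shows "\<exists>w. loc_int w \<and> (\<forall>x y. a \<le> x \<longrightarrow> x \<le> y \<longrightarrow> y \<le> b \<longrightarrow> f y - f x = prim w y - prim w x)"
proof -
  define h :: "nat \<Rightarrow> real" where "h j = 1 / real (Suc j)" for j
  have h: "h j > 0" for j by (simp add: h_def)
  have hlim: "h \<longlonglongrightarrow> 0" unfolding h_def using LIMSEQ_inverse_real_of_nat by (simp add: divide_inverse)
  obtain lo where lo: "loc_int lo" "\<forall>x. \<not> (a < x \<and> x < b) \<longrightarrow> lo x = 0"
      "AE x in lebesgue. a < x \<longrightarrow> x < b \<longrightarrow> liminf (\<lambda>j. ereal ((f (x + h j) - f x) / h j)) = ereal (lo x)"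
      "\<forall>x y. a \<le> x \<longrightarrow> x \<le> y \<longrightarrow> y \<le> b \<longrightarrow> f y - f x \<le> prim lo y - prim lo x"
    using ac_lower_derivative[OF f ab h hlim] by blast
  obtain hi where hi: "loc_int hi" "\<forall>x. \<not> (a < x \<and> x < b) \<longrightarrow> hi x = 0"
      "AE x in lebesgue. a < x \<longrightarrow> x < b \<longrightarrow> liminf (\<lambda>j. ereal ((- f (x + h j) - (- f x)) / h j)) = ereal (hi x)"
      "\<forall>x y. a \<le> x \<longrightarrow> x \<le> y \<longrightarrow> y \<le> b \<longrightarrow> - f y - (- f x) \<le> prim hi y - prim hi x"
    using ac_lower_derivative[OF ac_uminus[OF f] ab h hlim] by blast
  have le: "AE x in lebesgue. hi x \<le> - lo x"
    using lo(3) hi(3)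
  proof eventually_elim
    case (elim x)
    show ?case
    proof (cases "a < x \<and> x < b")
      case True
      let ?q = "\<lambda>j. ereal ((f (x + h j) - f x) / h j)"
      have "(\<lambda>j. ereal ((- f (x + h j) - (- f x)) / h j)) = (\<lambda>j. - ?q j)"
        by (simp add: fun_eq_iff minus_divide_left)
      then have "ereal (hi x) = liminf (\<lambda>j. - ?q j)" using elim(2) True by simp
      also have "\<dots> = - limsup ?q" by (rule ereal_Liminf_uminus)
      also have "\<dots> \<le> - liminf ?q" using Liminf_le_Limsup[of sequentially ?q] by simp
      also have "liminf ?q = ereal (lo x)" using elim(1) True by simp
      finally show ?thesis by simp
    qed (use lo(2) hi(2) in simp)
  qed
  have "f y - f x = prim lo y - prim lo x" if xy: "a \<le> x" "x \<le> y" "y \<le> b" for x y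
  proof -
    have "prim hi y - prim hi x \<le> prim (\<lambda>x. - lo x) y - prim (\<lambda>x. - lo x) x"
      unfolding prim_diff[OF hi(1) xy(2)] prim_diff[OF loc_int_uminus[OF lo(1)] xy(2)]
      using le by (intro set_integral_mono_AE loc_intD loc_int_uminus hi lo) auto
    then show ?thesis using lo(4)[rule_format, OF xy] hi(4)[rule_format, OF xy] by (simp add: prim_uminus[OF lo(1)])
  qed
  with lo(1) show ?thesis by blast
qed

section \<open>Absolutely continuous functions with a given derivative\<close>

lemma loc_int_cong_AE:
  fixes v w :: "real \<Rightarrow> 'a::euclidean_space"
  assumes "loc_int v" "AE x in lebesgue. v x = w x"
  shows "loc_int w" "prim w y = prim v y"
proof -
  have *: "integrable lebesgue (\<lambda>x. indicator {a..b} x *\<^sub>R v x)" for a b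
    using assms(1) by (simp add: loc_int_def set_integrable_def)
  have ae: "AE x in lebesgue. indicator {a..b} x *\<^sub>R v x = indicator {a..b} x *\<^sub>R w x" for a b
    using assms(2) by eventually_elim simp
  have m: "(\<lambda>x. indicator {a..b} x *\<^sub>R w x) \<in> borel_measurable lebesgue" for a b
    by (rule borel_measurable_AE[OF borel_measurable_integrable[OF *] ae])
  have "integrable lebesgue (\<lambda>x. indicator {a..b} x *\<^sub>R w x)" for a b
    using integrable_cong_AE[OF borel_measurable_integrable[OF *] m ae] * by blast
  then show "loc_int w" by (simp add: loc_int_def set_integrable_def)
  have "(LINT t:{a..b}|lebesgue. v t) = (LINT t:{a..b}|lebesgue. w t)" for a b
    unfolding set_lebesgue_integral_def by (rule integral_cong_AE[OF borel_measurable_integrable[OF *] m ae])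
  then show "prim w y = prim v y" by (simp add: prim_def)
qed

text \<open>
  The derivative \<open>w\<close> is carried along explicitly, as a representative of its class. This is the
  notion in which the differential equation is written.
\<close>
definition AC_deriv :: "(real \<Rightarrow> 'a::euclidean_space) \<Rightarrow> (real \<Rightarrow> 'a) \<Rightarrow> bool" where
  "AC_deriv f w \<longleftrightarrow> loc_int w \<and> (\<forall>x. f x = f 0 + prim w x)"

lemma ac_const: "ac (\<lambda>x. c)"
  unfolding ac_def
proof (intro allI impI)
  fix a b e :: real assume "e > 0"
  then show "\<exists>d>0. \<forall>n s t. nonoverlapping a b n s t \<longrightarrow> (\<Sum>k<n. t k - s k) < d \<longrightarrow> (\<Sum>k<n. norm (c - c)) < e"
    by (intro exI[of _ 1]) simp
qed

lemma AC_deriv_eq: "AC_deriv f w \<Longrightarrow> f = (\<lambda>x. f 0 + prim w x)"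
  unfolding AC_deriv_def by (rule ext) blast

lemma AC_deriv_loc_int: "AC_deriv f w \<Longrightarrow> loc_int w" by (simp add: AC_deriv_def)

lemma AC_deriv_prim: "loc_int w \<Longrightarrow> AC_deriv (\<lambda>x. c + prim w x) w"
  by (simp add: AC_deriv_def)

lemma AC_deriv_ac: assumes "AC_deriv f w" shows "ac f"
  by (subst AC_deriv_eq[OF assms], rule ac_add[OF ac_const ac_prim[OF AC_deriv_loc_int[OF assms]]])

lemma AC_deriv_diff_eq: "AC_deriv f w \<Longrightarrow> x \<le> y \<Longrightarrow> f y - f x = (LINT t:{x..y}|lebesgue. w t)"
  using prim_diff[of w x y] unfolding AC_deriv_def by (metis add_diff_cancel_left)

lemma AC_deriv_has_derivative:
  assumes "AC_deriv f w" shows "AE x in lebesgue. (f has_vector_derivative w x) (at x)"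
  using prim_has_vector_derivative[OF AC_deriv_loc_int[OF assms]]
proof eventually_elim
  case (elim x)
  show ?case
    by (subst AC_deriv_eq[OF assms]) (use has_vector_derivative_add[OF has_vector_derivative_const elim] in simp)
qed

lemma ac_FTC_interval:
  fixes f :: "real \<Rightarrow> 'a::euclidean_space"
  assumes f: "ac f" and ab: "a < b"
  shows "\<exists>w. loc_int w \<and> (\<forall>x y. a \<le> x \<longrightarrow> x \<le> y \<longrightarrow> y \<le> b \<longrightarrow> f y - f x = prim w y - prim w x)"
proof -
  have "\<forall>i. \<exists>w. loc_int w \<and> (\<forall>x y. a \<le> x \<longrightarrow> x \<le> y \<longrightarrow> y \<le> b \<longrightarrow> f y \<bullet> i - f x \<bullet> i = prim w y - prim w x)"
    by (intro allI ac_FTC_real_interval[OF ac_bounded_linear[OF bounded_linear_inner_left f] ab])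
  then obtain w where w: "\<And>i. loc_int (w i)"
    and eq: "\<And>i x y. a \<le> x \<Longrightarrow> x \<le> y \<Longrightarrow> y \<le> b \<Longrightarrow> f y \<bullet> i - f x \<bullet> i = prim (w i) y - prim (w i) x"
    by metis
  define W where "W x = (\<Sum>i\<in>Basis. w i x *\<^sub>R i)" for x
  have comp: "(\<lambda>x. W x \<bullet> i) = w i" if "i \<in> Basis" for i
    using that by (auto simp: W_def)
  have W: "loc_int W"
    unfolding loc_int_def set_integrable_def W_def scaleR_sum_right
  proof (intro allI Bochner_Integration.integrable_sum)
    fix a b :: real and i :: 'a
    have "integrable lebesgue (\<lambda>x. (indicator {a..b} x *\<^sub>R w i x) *\<^sub>R i)"
      by (rule integrable_scaleR_left) (use w[of i] in \<open>simp add: loc_int_def set_integrable_def\<close>)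
    then show "integrable lebesgue (\<lambda>x. indicat_real {a..b} x *\<^sub>R w i x *\<^sub>R i)" by simp
  qed
  have "f y - f x = prim W y - prim W x" if "a \<le> x" "x \<le> y" "y \<le> b" for x y
  proof (rule euclidean_eqI)
    fix i :: 'a assume i: "i \<in> Basis"
    show "(f y - f x) \<bullet> i = (prim W y - prim W x) \<bullet> i"
      using eq[OF that, of i] by (simp add: inner_diff_left loc_int_inner(2)[OF W, symmetric] comp[OF i])
  qed
  with W show ?thesis by blast
qed

text \<open>
  On each interval \<open>f\<close> is an indefinite integral, and Lebesgue's theorem identifies the density
  there with the pointwise derivative. As the latter does not depend on the interval, the local
  densities fit together.
\<close>
theorem ac_AC_deriv:
  fixes f :: "real \<Rightarrow> 'a::euclidean_space"
  assumes f: "ac f"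
  shows "AC_deriv f (\<lambda>x. vector_derivative f (at x))"
proof -
  have "\<forall>n. \<exists>w. loc_int w \<and> (\<forall>x y. - real (Suc n) \<le> x \<longrightarrow> x \<le> y \<longrightarrow> y \<le> real (Suc n) \<longrightarrow> f y - f x = prim w y - prim w x)"
    by (intro allI ac_FTC_interval f) simp
  then obtain W where W: "\<And>n. loc_int (W n)"
    and eq: "\<And>n x y. - real (Suc n) \<le> x \<Longrightarrow> x \<le> y \<Longrightarrow> y \<le> real (Suc n) \<Longrightarrow> f y - f x = prim (W n) y - prim (W n) x"
    by metis
  let ?d = "\<lambda>x. vector_derivative f (at x)"
  have ae: "AE x in lebesgue. x \<in> {- real n..real n} \<longrightarrow> ?d x = W n x" for n
    using prim_has_vector_derivative[OF W[of n]]
  proof eventually_elim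
    case (elim x)
    show ?case
    proof
      assume x: "x \<in> {- real n..real n}"
      let ?c = "- real (Suc n)"
      have "((\<lambda>y. (f ?c - prim (W n) ?c) + prim (W n) y) has_vector_derivative W n x) (at x)"
        using has_vector_derivative_add[OF has_vector_derivative_const elim] by simp
      then have "(f has_vector_derivative W n x) (at x)"
      proof (rule has_vector_derivative_transform_within_open)
        show "open {?c<..<real (Suc n)}" by simp
        fix y assume "y \<in> {?c<..<real (Suc n)}"
        then show "(f ?c - prim (W n) ?c) + prim (W n) y = f y"
          using eq[of n ?c y] by (simp add: algebra_simps)
      qed (use x in auto)
      then show "?d x = W n x" by (rule vector_derivative_at)
    qed
  qed
  have m: "integrable lebesgue (\<lambda>x. indicator {- real n..real n} x *\<^sub>R ?d x)" for n
  proof -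
    have ae': "AE x in lebesgue. indicator {- real n..real n} x *\<^sub>R W n x = indicator {- real n..real n} x *\<^sub>R ?d x"
      using ae[of n] by eventually_elim (auto simp: indicator_def)
    have i: "integrable lebesgue (\<lambda>x. indicator {- real n..real n} x *\<^sub>R W n x)"
      using W[of n] by (simp add: loc_int_def set_integrable_def)
    have mm: "(\<lambda>x. indicator {- real n..real n} x *\<^sub>R ?d x) \<in> borel_measurable lebesgue"
      by (rule borel_measurable_AE[OF borel_measurable_integrable[OF i] ae'])
    show ?thesis
      using integrable_cong_AE[OF borel_measurable_integrable[OF i] mm ae'] i by blast
  qed
  have d: "loc_int ?d"
    unfolding loc_int_iff set_integrable_def using m by blast
  have "f x = f 0 + prim ?d x" for x
  proof -
    have lint: "f y - f x = (LINT t:{x..y}|lebesgue. ?d t)" if "x \<le> y" for x y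
    proof -
      obtain n :: nat where n: "max \<bar>x\<bar> \<bar>y\<bar> \<le> real n" using real_arch_simple by blast
      have si: "set_integrable lebesgue {x..y} (W n)" "set_integrable lebesgue {x..y} ?d"
        using W d by (auto simp: loc_int_def)
      have "f y - f x = (LINT t:{x..y}|lebesgue. W n t)"
        using eq[of n x y] n that prim_diff[OF W[of n], of x y] by auto
      also have "\<dots> = (LINT t:{x..y}|lebesgue. ?d t)"
        unfolding set_lebesgue_integral_def
      proof (rule integral_cong_AE)
        show "AE t in lebesgue. indicator {x..y} t *\<^sub>R W n t = indicator {x..y} t *\<^sub>R ?d t"
          using ae[of n] by eventually_elim (use n in \<open>auto simp: indicator_def\<close>)
      qed (use si in \<open>auto simp: set_integrable_def\<close>)
      finally show ?thesis .
    qed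
    have e: "f y - f x = prim ?d y - prim ?d x" if "x \<le> y" for x y
      using lint[OF that] prim_diff[OF d that] by simp
    show ?thesis
      using e[of 0 x] e[of x 0] by (cases "0 \<le> x") (simp_all add: algebra_simps)
  qed
  then show ?thesis unfolding AC_deriv_def using d by blast
qed

lemma AC_deriv_cong_AE:
  assumes "AC_deriv f w" "AE x in lebesgue. w x = w' x"
  shows "AC_deriv f w'"
proof -
  have "f x = f 0 + prim w' x" for x
    unfolding loc_int_cong_AE(2)[OF AC_deriv_loc_int[OF assms(1)] assms(2)]
    using assms(1) unfolding AC_deriv_def by blast
  then show ?thesis
    unfolding AC_deriv_def using loc_int_cong_AE(1)[OF AC_deriv_loc_int[OF assms(1)] assms(2)] by blast
qed

text \<open>
  Product and chain rules for \<open>AC_deriv\<close> reduce by this lemma to those for pointwise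
  derivatives.
\<close>
lemma ac_AC_derivI:
  fixes f :: "real \<Rightarrow> 'a::euclidean_space"
  assumes "ac f" "AE x in lebesgue. (f has_vector_derivative w x) (at x)"
  shows "AC_deriv f w"
  by (rule AC_deriv_cong_AE[OF ac_AC_deriv[OF assms(1)] eventually_mono[OF assms(2)]]) (rule vector_derivative_at)

lemma AC_deriv_add:
  assumes "AC_deriv f v" "AC_deriv g w" shows "AC_deriv (\<lambda>x. f x + g x) (\<lambda>x. v x + w x)"
  by (rule ac_AC_derivI[OF ac_add[OF AC_deriv_ac[OF assms(1)] AC_deriv_ac[OF assms(2)]]])
    (rule eventually_elim2[OF AC_deriv_has_derivative[OF assms(1)] AC_deriv_has_derivative[OF assms(2)] has_vector_derivative_add])

lemma AC_deriv_diff: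
  assumes "AC_deriv f v" "AC_deriv g w" shows "AC_deriv (\<lambda>x. f x - g x) (\<lambda>x. v x - w x)"
  by (rule ac_AC_derivI[OF ac_diff[OF AC_deriv_ac[OF assms(1)] AC_deriv_ac[OF assms(2)]]])
    (rule eventually_elim2[OF AC_deriv_has_derivative[OF assms(1)] AC_deriv_has_derivative[OF assms(2)] has_vector_derivative_diff])

lemma AC_deriv_bounded_linear:
  assumes "bounded_linear L" "AC_deriv f v" shows "AC_deriv (\<lambda>x. L (f x)) (\<lambda>x. L (v x))"
  by (rule ac_AC_derivI[OF ac_bounded_linear[OF assms(1) AC_deriv_ac[OF assms(2)]]])
    (rule eventually_mono[OF AC_deriv_has_derivative[OF assms(2)] bounded_linear.has_vector_derivative[OF assms(1)]])

lemma ac_mult: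
  fixes f g :: "real \<Rightarrow> 'a::real_normed_algebra"
  assumes "ac f" "ac g" shows "ac (\<lambda>x. f x * g x)"
proof (rule ac_local_bound[OF assms(2,1)])
  fix a b :: real
  have "bounded (f ` {a..b})" "bounded (g ` {a..b})"
    using assms by (auto intro!: compact_imp_bounded compact_continuous_image ac_continuous)
  then obtain A B where AB: "\<And>x. x \<in> {a..b} \<Longrightarrow> norm (f x) \<le> A" "\<And>x. x \<in> {a..b} \<Longrightarrow> norm (g x) \<le> B"
    unfolding bounded_iff by blast
  have "norm (f y * g y - f x * g x) \<le> A * norm (g y - g x) + B * norm (f y - f x)" if "x \<in> {a..b}" "y \<in> {a..b}" for x y
  proof -
    have "f y * g y - f x * g x = f y * (g y - g x) + (f y - f x) * g x" by (simp add: algebra_simps)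
    also have "norm \<dots> \<le> norm (f y) * norm (g y - g x) + norm (f y - f x) * norm (g x)"
      by (intro norm_triangle_le add_mono norm_mult_ineq)
    also have "\<dots> \<le> A * norm (g y - g x) + norm (f y - f x) * B"
      using AB that by (intro add_mono mult_mono) (auto intro: order_trans[OF norm_ge_zero])
    finally show ?thesis by (simp add: mult.commute)
  qed
  then show "\<exists>A B. \<forall>x\<in>{a..b}. \<forall>y\<in>{a..b}. norm (f y * g y - f x * g x) \<le> A * norm (g y - g x) + B * norm (f y - f x)"
    by blast
qed

lemma AC_deriv_mult:
  fixes f g :: "real \<Rightarrow> 'a::{real_normed_algebra, euclidean_space}"
  assumes "AC_deriv f v" "AC_deriv g w" shows "AC_deriv (\<lambda>x. f x * g x) (\<lambda>x. f x * w x + v x * g x)"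
  by (rule ac_AC_derivI[OF ac_mult[OF AC_deriv_ac[OF assms(1)] AC_deriv_ac[OF assms(2)]]])
    (rule eventually_elim2[OF AC_deriv_has_derivative[OF assms(1)] AC_deriv_has_derivative[OF assms(2)] has_vector_derivative_mult])

lemma AC_deriv_power:
  fixes G :: "real \<Rightarrow> real"
  assumes "AC_deriv G w" shows "AC_deriv (\<lambda>x. G x ^ Suc n) (\<lambda>x. real (Suc n) * G x ^ n * w x)"
proof (induction n)
  case (Suc n)
  have "AC_deriv (\<lambda>x. G x * G x ^ Suc n) (\<lambda>x. G x * (real (Suc n) * G x ^ n * w x) + w x * G x ^ Suc n)"
    by (rule AC_deriv_mult[OF assms Suc])
  then show ?case by (simp add: algebra_simps)
qed (use assms in simp)

lemma AC_deriv_continuous: "AC_deriv f w \<Longrightarrow> continuous_on S f"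
  by (rule ac_continuous[OF AC_deriv_ac])

section \<open>Linear systems with locally integrable coefficients\<close>

lemma loc_int_mult_continuous:
  fixes A g :: "real \<Rightarrow> 'a::{real_normed_algebra, euclidean_space}"
  assumes A: "loc_int A" and g: "continuous_on UNIV g"
  shows "loc_int (\<lambda>x. A x * g x)"
  unfolding loc_int_def
proof (intro allI)
  fix a b :: real
  have "bounded (g ` {a..b})"
    by (intro compact_imp_bounded compact_continuous_image continuous_on_subset[OF g]) auto
  then obtain C where C: "\<And>x. x \<in> {a..b} \<Longrightarrow> norm (g x) \<le> C" unfolding bounded_iff by blast
  have iA: "integrable lebesgue (\<lambda>x. indicator {a..b} x *\<^sub>R A x)"
    using loc_intD[OF A] by (simp add: set_integrable_def)
  have gm: "g \<in> borel_measurable lebesgue"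
    using borel_measurable_continuous_onI[OF g] by (rule measurable_completion[of g lborel borel, simplified])
  have "integrable lebesgue (\<lambda>x. (indicator {a..b} x *\<^sub>R A x) * g x)"
  proof (rule Bochner_Integration.integrable_bound)
    show "integrable lebesgue (\<lambda>x. C *\<^sub>R (indicator {a..b} x *\<^sub>R A x))"
      using iA by (rule integrable_scaleR_right)
    show "(\<lambda>x. (indicator {a..b} x *\<^sub>R A x) * g x) \<in> borel_measurable lebesgue"
      by (intro borel_measurable_times borel_measurable_integrable[OF iA] gm)
    show "AE x in lebesgue. norm ((indicator {a..b} x *\<^sub>R A x) * g x) \<le> norm (C *\<^sub>R (indicator {a..b} x *\<^sub>R A x))"
    proof (rule AE_I2)
      fix x
      show "norm ((indicator {a..b} x *\<^sub>R A x) * g x) \<le> norm (C *\<^sub>R (indicator {a..b} x *\<^sub>R A x))"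
      proof (cases "x \<in> {a..b}")
        case True
        have "norm (A x * g x) \<le> norm (A x) * norm (g x)" by (rule norm_mult_ineq)
        also have "\<dots> \<le> norm (A x) * \<bar>C\<bar>" using C[OF True] by (intro mult_left_mono) auto
        finally show ?thesis using True by (simp add: mult.commute)
      qed simp
    qed
  qed
  then show "set_integrable lebesgue {a..b} (\<lambda>x. A x * g x)" by (simp add: set_integrable_def)
qed

lemma prim_dominated_convergence:
  fixes g :: "nat \<Rightarrow> real \<Rightarrow> 'a::euclidean_space"
  assumes g: "\<And>n. loc_int (g n)" and lim: "\<And>x. (\<lambda>n. g n x) \<longlonglongrightarrow> G x"
    and h: "loc_int h" and bound: "\<And>R. \<exists>C. \<forall>n. \<forall>x\<in>{-R..R}. norm (g n x) \<le> C * h x"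
  shows "loc_int G" "(\<lambda>n. prim (g n) x) \<longlonglongrightarrow> prim G x"
proof -
  have *: "set_integrable lebesgue {a..b} G \<and> (\<lambda>n. LINT t:{a..b}|lebesgue. g n t) \<longlonglongrightarrow> (LINT t:{a..b}|lebesgue. G t)" for a b
  proof -
    obtain C where C: "\<And>n x. x \<in> {- max \<bar>a\<bar> \<bar>b\<bar>..max \<bar>a\<bar> \<bar>b\<bar>} \<Longrightarrow> norm (g n x) \<le> C * h x"
      using bound[of "max \<bar>a\<bar> \<bar>b\<bar>"] by blast
    have gi: "integrable lebesgue (\<lambda>x. indicator {a..b} x *\<^sub>R g n x)" for n
      using g[of n] by (simp add: loc_int_def set_integrable_def)
    have hi: "integrable lebesgue (\<lambda>x. C * (indicator {a..b} x *\<^sub>R h x))"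
      by (rule integrable_mult_right) (use h in \<open>simp add: loc_int_def set_integrable_def\<close>)
    have l: "AE x in lebesgue. (\<lambda>n. indicator {a..b} x *\<^sub>R g n x) \<longlonglongrightarrow> indicator {a..b} x *\<^sub>R G x"
      by (intro AE_I2 tendsto_scaleR tendsto_const lim)
    have b: "AE x in lebesgue. norm (indicator {a..b} x *\<^sub>R g n x) \<le> C * (indicator {a..b} x *\<^sub>R h x)" for n
    proof (rule AE_I2)
      fix x show "norm (indicator {a..b} x *\<^sub>R g n x) \<le> C * (indicator {a..b} x *\<^sub>R h x)"
      proof (cases "x \<in> {a..b}")
        case True
        then have "x \<in> {- max \<bar>a\<bar> \<bar>b\<bar>..max \<bar>a\<bar> \<bar>b\<bar>}" by auto
        from C[OF this, of n] True show ?thesis by simp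
      qed simp
    qed
    have m: "(\<lambda>x. indicator {a..b} x *\<^sub>R G x) \<in> borel_measurable lebesgue"
      by (rule borel_measurable_LIMSEQ_metric[where f="\<lambda>n x. indicator {a..b} x *\<^sub>R g n x"])
        (intro borel_measurable_integrable[OF gi] tendsto_scaleR tendsto_const lim)+
    show ?thesis
      unfolding set_integrable_def set_lebesgue_integral_def
      using integrable_dominated_convergence[OF m borel_measurable_integrable[OF gi] hi l b]
        integral_dominated_convergence[OF m borel_measurable_integrable[OF gi] hi l b] by blast
  qed
  show "loc_int G" using * by (simp add: loc_int_def)
  show "(\<lambda>n. prim (g n) x) \<longlonglongrightarrow> prim G x"
    unfolding prim_def using * by (auto intro: tendsto_minus)
qed

lemma norm_prim_le:
  assumes "loc_int w" "loc_int v" "\<And>t. t \<in> {min 0 x..max 0 x} \<Longrightarrow> norm (w t) \<le> v t"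
  shows "norm (prim w x) \<le> \<bar>prim v x\<bar>"
proof -
  have "norm (LINT t:{a..b}|lebesgue. w t) \<le> (LINT t:{a..b}|lebesgue. v t)" if "{a..b} \<subseteq> {min 0 x..max 0 x}" for a b
  proof -
    have "norm (LINT t:{a..b}|lebesgue. w t) \<le> (LINT t:{a..b}|lebesgue. norm (w t))"
      by (rule norm_lint_le[OF loc_intD[OF assms(1)]])
    also have "\<dots> \<le> (LINT t:{a..b}|lebesgue. v t)"
      using assms(3) that by (intro set_integral_mono set_integrable_norm loc_intD assms) blast
    finally show ?thesis .
  qed
  from this[of 0 x] this[of x 0] show ?thesis by (auto simp: prim_def)
qed

text \<open>
  The identity \<open>(G\<^sup>n\<^sup>+\<^sup>1)' = (n + 1) G\<^sup>n w\<close> for \<open>G = prim w\<close>. The absolute values make it hold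
  on both sides of the origin; it produces the factorials in the Picard iteration.
\<close>
lemma prim_weighted_power:
  fixes w :: "real \<Rightarrow> real"
  assumes w: "loc_int w" "\<And>x. w x \<ge> 0"
  shows "loc_int (\<lambda>x. w x * \<bar>prim w x\<bar> ^ n)"
    "\<bar>prim (\<lambda>x. w x * \<bar>prim w x\<bar> ^ n) x\<bar> = \<bar>prim w x\<bar> ^ Suc n / real (Suc n)"
proof -
  let ?G = "prim w"
  have G: "AC_deriv ?G w" using AC_deriv_prim[OF w(1), of 0] by simp
  have cont: "continuous_on UNIV ?G" by (rule AC_deriv_continuous[OF G])
  have li: "loc_int (\<lambda>x. w x * ?G x ^ n)"
    by (rule loc_int_mult_continuous[OF w(1)]) (intro continuous_intros cont)
  show li': "loc_int (\<lambda>x. w x * \<bar>?G x\<bar> ^ n)"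
    by (rule loc_int_mult_continuous[OF w(1)]) (intro continuous_intros cont)
  have sgn: "(0 \<le> x \<longrightarrow> 0 \<le> ?G x) \<and> (x \<le> 0 \<longrightarrow> ?G x \<le> 0)" for x
  proof (cases "x = 0")
    case False
    then show ?thesis using w(2) by (auto simp: prim_def set_lebesgue_integral_def intro!: integral_nonneg_AE)
  qed simp
  have key: "(LINT t:{a..b}|lebesgue. w t * ?G t ^ n) = (?G b ^ Suc n - ?G a ^ Suc n) / real (Suc n)" if "a \<le> b" for a b
  proof -
    have "?G b ^ Suc n - ?G a ^ Suc n = (LINT t:{a..b}|lebesgue. real (Suc n) * ?G t ^ n * w t)"
      by (rule AC_deriv_diff_eq[OF AC_deriv_power[OF G] that])
    also have "\<dots> = (LINT t:{a..b}|lebesgue. real (Suc n) * (w t * ?G t ^ n))"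
      by (simp only: mult_ac)
    also have "\<dots> = real (Suc n) * (LINT t:{a..b}|lebesgue. w t * ?G t ^ n)"
      by (rule set_integral_mult_right)
    finally show ?thesis by simp
  qed
  show "\<bar>prim (\<lambda>x. w x * \<bar>?G x\<bar> ^ n) x\<bar> = \<bar>?G x\<bar> ^ Suc n / real (Suc n)"
  proof (cases "0 \<le> x")
    case True
    have "(LINT t:{0..x}|lebesgue. w t * \<bar>?G t\<bar> ^ n) = (LINT t:{0..x}|lebesgue. w t * ?G t ^ n)"
      using sgn by (intro set_lebesgue_integral_cong) auto
    then have "prim (\<lambda>x. w x * \<bar>?G x\<bar> ^ n) x = ?G x ^ Suc n / real (Suc n)"
      using True key[of 0 x] by (simp add: prim_def[of "\<lambda>x. w x * \<bar>?G x\<bar> ^ n"])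
    then show ?thesis by (simp add: abs_mult power_abs)
  next
    case False
    have "(LINT t:{x..0}|lebesgue. w t * \<bar>?G t\<bar> ^ n) = (LINT t:{x..0}|lebesgue. (-1)^n * (w t * ?G t ^ n))"
      using sgn by (intro set_lebesgue_integral_cong) (auto simp: power_minus[of "?G _"])
    also have "\<dots> = (-1)^n * (LINT t:{x..0}|lebesgue. w t * ?G t ^ n)"
      by (rule set_integral_mult_right)
    also have "\<dots> = (-1)^n * (- (?G x ^ Suc n) / real (Suc n))"
      using False key[of x 0] by simp
    finally have "\<bar>prim (\<lambda>x. w x * \<bar>?G x\<bar> ^ n) x\<bar> = \<bar>(-1)^n * (- (?G x ^ Suc n) / real (Suc n))\<bar>"
      using False by (simp add: prim_def[of "\<lambda>x. w x * \<bar>?G x\<bar> ^ n"])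
    then show ?thesis by (simp add: abs_mult power_abs)
  qed
qed

lemma prim_mult_left:
  fixes w :: "real \<Rightarrow> real"
  shows "prim (\<lambda>x. c * w x) x = c * prim w x"
  by (simp add: prim_def)

lemma prim_sum:
  fixes g :: "nat \<Rightarrow> real \<Rightarrow> 'a::euclidean_space"
  assumes "\<And>i. loc_int (g i)"
  shows "loc_int (\<lambda>x. \<Sum>i<n. g i x)" "prim (\<lambda>x. \<Sum>i<n. g i x) x = (\<Sum>i<n. prim (g i) x)"
proof -
  have *: "integrable lebesgue (\<lambda>x. indicator {a..b} x *\<^sub>R g i x)" for a b i
    using assms[of i] by (simp add: loc_int_def set_integrable_def)
  show "loc_int (\<lambda>x. \<Sum>i<n. g i x)"
    unfolding loc_int_def set_integrable_def scaleR_sum_right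
    by (intro allI Bochner_Integration.integrable_sum *)
  have "(LINT t:{a..b}|lebesgue. (\<Sum>i<n. g i t)) = (\<Sum>i<n. LINT t:{a..b}|lebesgue. g i t)" for a b
    unfolding set_lebesgue_integral_def scaleR_sum_right
    by (intro Bochner_Integration.integral_sum *)
  then show "prim (\<lambda>x. \<Sum>i<n. g i x) x = (\<Sum>i<n. prim (g i) x)"
    by (simp add: prim_def sum_negf)
qed

text \<open>
  The terms, not the partial sums, of the Picard series for \<open>f' = A u\<close>, \<open>u' = B f\<close>.
\<close>
primrec picard_term :: "(real \<Rightarrow> complex) \<Rightarrow> (real \<Rightarrow> complex) \<Rightarrow> (real \<Rightarrow> complex) \<Rightarrow> (real \<Rightarrow> complex) \<Rightarrow>
   nat \<Rightarrow> (real \<Rightarrow> complex) \<times> (real \<Rightarrow> complex)" where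
  "picard_term A B f0 u0 0 = (f0, u0)"
| "picard_term A B f0 u0 (Suc n) = (prim (\<lambda>x. A x * snd (picard_term A B f0 u0 n) x), prim (\<lambda>x. B x * fst (picard_term A B f0 u0 n) x))"

text \<open>
  Picard's series converges locally uniformly although the coefficients are unbounded: with
  \<open>G = |prim (|A| + |B|)|\<close>, its \<open>k\<close>-th term is at most \<open>M G\<^sup>k / k!\<close> on a bounded interval.
  Dominated convergence permits passing to the limit in the integral equation. Arbitrary
  continuous inhomogeneities \<open>f0\<close> and \<open>u0\<close> cover initial values and source terms at once.
\<close>
theorem linear_system_solvable:
  fixes A B f0 u0 :: "real \<Rightarrow> complex"
  assumes A: "loc_int A" and B: "loc_int B" and f0: "continuous_on UNIV f0" and u0: "continuous_on UNIV u0"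
  shows "\<exists>f u. loc_int (\<lambda>x. A x * u x) \<and> loc_int (\<lambda>x. B x * f x) \<and>
    (\<forall>x. f x = f0 x + prim (\<lambda>x. A x * u x) x) \<and> (\<forall>x. u x = u0 x + prim (\<lambda>x. B x * f x) x)"
proof -
  define f where "f k = fst (picard_term A B f0 u0 k)" for k
  define u where "u k = snd (picard_term A B f0 u0 k)" for k
  have f_Suc: "f (Suc k) = prim (\<lambda>x. A x * u k x)" and u_Suc: "u (Suc k) = prim (\<lambda>x. B x * f k x)"
    and f_0: "f 0 = f0" and u_0: "u 0 = u0" for k
    by (simp_all add: f_def u_def)
  have cont: "continuous_on UNIV (f k) \<and> continuous_on UNIV (u k)" for k
  proof (induction k)
    case (Suc k)
    then have "loc_int (\<lambda>x. A x * u k x)" "loc_int (\<lambda>x. B x * f k x)"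
      using A B by (auto intro: loc_int_mult_continuous)
    then show ?case unfolding f_Suc u_Suc by (auto intro: ac_continuous ac_prim)
  qed (use f0 u0 in \<open>simp add: f_0 u_0\<close>)
  have lA: "loc_int (\<lambda>x. A x * u k x)" and lB: "loc_int (\<lambda>x. B x * f k x)" for k
    using A B cont by (auto intro: loc_int_mult_continuous)
  define w where "w x = norm (A x) + norm (B x)" for x
  have w: "loc_int w"
    using A B unfolding w_def loc_int_def by (auto intro!: set_integral_add set_integrable_norm)
  have w0: "w x \<ge> 0" "norm (A x) \<le> w x" "norm (B x) \<le> w x" for x by (auto simp: w_def)
  define G where "G x = \<bar>prim w x\<bar>" for x
  have Gcont: "continuous_on S G" for S
    unfolding G_def by (intro continuous_intros ac_continuous ac_prim w)
  define M where "M R = (SOME M. \<forall>x\<in>{-R..R}. norm (f0 x) \<le> M \<and> norm (u0 x) \<le> M)" for R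
  have M: "norm (f0 x) \<le> M R \<and> norm (u0 x) \<le> M R" if "x \<in> {-R..R}" for x R
  proof -
    have "bounded (f0 ` {-R..R})" "bounded (u0 ` {-R..R})"
      using f0 u0 by (auto intro!: compact_imp_bounded compact_continuous_image intro: continuous_on_subset)
    then obtain M1 M2 where "\<And>x. x \<in> {-R..R} \<Longrightarrow> norm (f0 x) \<le> M1" "\<And>x. x \<in> {-R..R} \<Longrightarrow> norm (u0 x) \<le> M2"
      unfolding bounded_iff by blast
    then have "\<exists>M. \<forall>x\<in>{-R..R}. norm (f0 x) \<le> M \<and> norm (u0 x) \<le> M"
      by (intro exI[of _ "max M1 M2"]) (auto simp: le_max_iff_disj)
    from someI_ex[OF this] show ?thesis using that unfolding M_def by blast
  qed
  have bound: "norm (f k x) \<le> M R * (G x ^ k / fact k) \<and> norm (u k x) \<le> M R * (G x ^ k / fact k)" if "x \<in> {-R..R}" for k x R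
    using that
  proof (induction k arbitrary: x)
    case 0
    then show ?case using M by (simp add: f_0 u_0)
  next
    case (Suc k)
    let ?v = "\<lambda>t. (M R / fact k) * (w t * \<bar>prim w t\<bar> ^ k)"
    have "M R \<ge> 0" using M[OF Suc(2)] by (meson norm_ge_zero order_trans)
    have lv: "loc_int ?v" unfolding loc_int_def
      using prim_weighted_power(1)[OF w w0(1), of k] by (auto simp: loc_int_def)
    have dom: "norm (a * b) \<le> ?v t" if "norm a \<le> w t" "norm b \<le> M R * (G t ^ k / fact k)" for a b :: complex and t
    proof -
      have "norm (a * b) \<le> w t * (M R * (G t ^ k / fact k))"
        unfolding norm_mult using that w0(1) by (intro mult_mono) auto
      then show ?thesis by (simp add: G_def mult_ac)
    qed
    have sub: "t \<in> {-R..R}" if "t \<in> {min 0 x..max 0 x}" for t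
      using that Suc(2) by (auto simp: min_def max_def split: if_splits)
    have "\<bar>prim ?v x\<bar> = \<bar>M R / fact k\<bar> * (\<bar>prim w x\<bar> ^ Suc k / real (Suc k))"
      unfolding prim_mult_left abs_mult prim_weighted_power(2)[OF w w0(1)] ..
    also have "\<dots> = M R * (G x ^ Suc k / fact (Suc k))"
      using \<open>M R \<ge> 0\<close> by (simp add: G_def field_simps)
    finally have v: "\<bar>prim ?v x\<bar> = M R * (G x ^ Suc k / fact (Suc k))" .
    have "norm (f (Suc k) x) \<le> \<bar>prim ?v x\<bar>"
      unfolding f_Suc by (rule norm_prim_le[OF lA lv]) (use Suc.IH sub in \<open>blast intro: dom w0\<close>)
    moreover have "norm (u (Suc k) x) \<le> \<bar>prim ?v x\<bar>"
      unfolding u_Suc by (rule norm_prim_le[OF lB lv]) (use Suc.IH sub in \<open>blast intro: dom w0\<close>)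
    ultimately show ?case unfolding v by blast
  qed
  have sumG: "summable (\<lambda>k. c * (G x ^ k / fact k))" for c x
    using summable_exp[of "G x"] by (intro summable_mult) (simp add: divide_inverse mult.commute)
  have sums: "summable (\<lambda>k. f k x)" "summable (\<lambda>k. u k x)" for x
    by (rule summable_comparison_test'[OF sumG[of "M \<bar>x\<bar>" x], of 0]; use bound[of x "\<bar>x\<bar>"] in force)+
  define F where "F x = (\<Sum>k. f k x)" for x
  define U where "U x = (\<Sum>k. u k x)" for x
  have limF: "(\<lambda>n. \<Sum>k<n. f k x) \<longlonglongrightarrow> F x" and limU: "(\<lambda>n. \<Sum>k<n. u k x) \<longlonglongrightarrow> U x" for x
    unfolding F_def U_def by (intro summable_LIMSEQ sums)+
  have partial: "\<exists>C. \<forall>n. \<forall>x\<in>{-R..R}. norm (\<Sum>k<n. f k x) \<le> C \<and> norm (\<Sum>k<n. u k x) \<le> C" for R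
  proof -
    have "bounded (G ` {-R..R})" by (intro compact_imp_bounded compact_continuous_image Gcont) simp
    then obtain K where K: "\<And>x. x \<in> {-R..R} \<Longrightarrow> norm (G x) \<le> K" unfolding bounded_iff by blast
    have "(\<Sum>k<n. M R * (G x ^ k / fact k)) \<le> M R * exp K" if x: "x \<in> {-R..R}" for n x
    proof -
      have M0: "M R \<ge> 0" using M[OF x] by (meson norm_ge_zero order_trans)
      have "(\<Sum>k<n. M R * (G x ^ k / fact k)) \<le> (\<Sum>k. M R * (G x ^ k / fact k))"
        using M0 by (intro sum_le_suminf sumG) (auto simp: G_def)
      also have "\<dots> = M R * exp (G x)"
        using summable_exp[of "G x"] by (subst suminf_mult) (auto simp: exp_def divide_inverse mult.commute)
      also have "\<dots> \<le> M R * exp K" using M0 K[OF x] by (intro mult_left_mono) auto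
      finally show ?thesis .
    qed
    moreover have "norm (\<Sum>k<n. f k x) \<le> (\<Sum>k<n. M R * (G x ^ k / fact k))"
        "norm (\<Sum>k<n. u k x) \<le> (\<Sum>k<n. M R * (G x ^ k / fact k))" if "x \<in> {-R..R}" for n x
      using bound[OF that] by (auto intro!: sum_norm_le)
    ultimately show ?thesis by (meson order_trans)
  qed
  have bA: "\<exists>C. \<forall>n. \<forall>x\<in>{-R..R}. norm (\<Sum>k<n. A x * u k x) \<le> C * w x"
    and bB: "\<exists>C. \<forall>n. \<forall>x\<in>{-R..R}. norm (\<Sum>k<n. B x * f k x) \<le> C * w x" for R
  proof -
    obtain C where C: "\<forall>n. \<forall>x\<in>{-R..R}. norm (\<Sum>k<n. f k x) \<le> C \<and> norm (\<Sum>k<n. u k x) \<le> C" using partial by blast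
    have "norm (\<Sum>k<n. A x * u k x) \<le> C * w x \<and> norm (\<Sum>k<n. B x * f k x) \<le> C * w x" if "x \<in> {-R..R}" for n x
    proof -
      have "norm (A x) * norm (\<Sum>k<n. u k x) \<le> w x * C" "norm (B x) * norm (\<Sum>k<n. f k x) \<le> w x * C"
        using C that w0 by (auto intro!: mult_mono)
      then show ?thesis by (simp add: sum_distrib_left[symmetric] norm_mult mult.commute)
    qed
    then show "\<exists>C. \<forall>n. \<forall>x\<in>{-R..R}. norm (\<Sum>k<n. A x * u k x) \<le> C * w x"
     "\<exists>C. \<forall>n. \<forall>x\<in>{-R..R}. norm (\<Sum>k<n. B x * f k x) \<le> C * w x" by blast+
  qed
  have lAU: "(\<lambda>n. \<Sum>k<n. A x * u k x) \<longlonglongrightarrow> A x * U x" and lBF: "(\<lambda>n. \<Sum>k<n. B x * f k x) \<longlonglongrightarrow> B x * F x" for x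
    unfolding sum_distrib_left[symmetric] by (intro tendsto_mult_left limF limU)+
  note cA = prim_dominated_convergence[OF prim_sum(1)[OF lA] lAU w bA]
  note cB = prim_dominated_convergence[OF prim_sum(1)[OF lB] lBF w bB]
  have "F x = f0 x + prim (\<lambda>x. A x * U x) x" for x
  proof (rule LIMSEQ_unique)
    show "(\<lambda>n. \<Sum>k<Suc n. f k x) \<longlonglongrightarrow> F x" using LIMSEQ_Suc[OF limF] .
    have "(\<Sum>k<Suc n. f k x) = f0 x + prim (\<lambda>x. \<Sum>k<n. A x * u k x) x" for n
      unfolding sum.lessThan_Suc_shift prim_sum(2)[OF lA] by (simp add: f_0 f_Suc)
    then show "(\<lambda>n. \<Sum>k<Suc n. f k x) \<longlonglongrightarrow> f0 x + prim (\<lambda>x. A x * U x) x"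
      using tendsto_add[OF tendsto_const cA(2)] by (simp only:)
  qed
  moreover have "U x = u0 x + prim (\<lambda>x. B x * F x) x" for x
  proof (rule LIMSEQ_unique)
    show "(\<lambda>n. \<Sum>k<Suc n. u k x) \<longlonglongrightarrow> U x" using LIMSEQ_Suc[OF limU] .
    have "(\<Sum>k<Suc n. u k x) = u0 x + prim (\<lambda>x. \<Sum>k<n. B x * f k x) x" for n
      unfolding sum.lessThan_Suc_shift prim_sum(2)[OF lB] by (simp add: u_0 u_Suc)
    then show "(\<lambda>n. \<Sum>k<Suc n. u k x) \<longlonglongrightarrow> u0 x + prim (\<lambda>x. B x * F x) x"
      using tendsto_add[OF tendsto_const cB(2)] by (simp only:)
  qed
  ultimately show ?thesis using cA(1) cB(1) by blast
qed

section \<open>Estimates on unit intervals\<close>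

lemma AC_deriv_cnj: "AC_deriv f w \<Longrightarrow> AC_deriv (\<lambda>x. cnj (f x)) (\<lambda>x. cnj (w x))"
  by (rule AC_deriv_bounded_linear[OF bounded_linear_cnj])

lemma AC_deriv_norm_square:
  assumes "AC_deriv f w"
  shows "AC_deriv (\<lambda>x. (cmod (f x))\<^sup>2) (\<lambda>x. 2 * Re (w x * cnj (f x)))"
proof -
  have "AC_deriv (\<lambda>x. Re (f x * cnj (f x))) (\<lambda>x. Re (f x * cnj (w x) + w x * cnj (f x)))"
    by (rule AC_deriv_bounded_linear[OF bounded_linear_Re AC_deriv_mult[OF assms AC_deriv_cnj[OF assms]]])
  moreover have "Re (f x * cnj (f x)) = (cmod (f x))\<^sup>2" for x
    by (simp add: complex_mult_cnj cmod_power2)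
  moreover have "Re (f x * cnj (w x) + w x * cnj (f x)) = 2 * Re (w x * cnj (f x))" for x
    by simp
  ultimately show ?thesis by (simp only:)
qed

lemma loc_int_norm: "loc_int w \<Longrightarrow> loc_int (\<lambda>x. norm (w x))"
  by (simp add: loc_int_def set_integrable_norm)

lemma loc_int_add: "loc_int v \<Longrightarrow> loc_int w \<Longrightarrow> loc_int (\<lambda>x. v x + w x)"
  unfolding loc_int_def by (auto intro: set_integral_add)

lemma loc_int_cmult:
  fixes w :: "real \<Rightarrow> real"
  shows "loc_int w \<Longrightarrow> loc_int (\<lambda>x. c * w x)"
  unfolding loc_int_def by auto

lemma loc_int_continuous:
  fixes g :: "real \<Rightarrow> 'a::euclidean_space"
  shows "continuous_on UNIV g \<Longrightarrow> loc_int g"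
  unfolding loc_int_def by (auto intro!: absolutely_integrable_continuous_real intro: continuous_on_subset)

lemma lint_const:
  fixes c :: real
  shows "a \<le> b \<Longrightarrow> (LINT t:{a..b}|lebesgue. c) = (b - a) * c"
  by (simp add: set_integral_const)

lemma lint_nonneg:
  fixes g :: "real \<Rightarrow> real"
  assumes "\<And>x. x \<in> A \<Longrightarrow> 0 \<le> g x" shows "0 \<le> (LINT t:A|lebesgue. g t)"
  unfolding set_lebesgue_integral_def using assms by (intro integral_nonneg_AE AE_I2) (auto simp: indicator_def)

lemma lint_mono_interval:
  fixes g :: "real \<Rightarrow> real"
  assumes "loc_int g" "\<And>x. 0 \<le> g x" "{x..y} \<subseteq> {a..b}"
  shows "(LINT t:{x..y}|lebesgue. g t) \<le> (LINT t:{a..b}|lebesgue. g t)"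
  unfolding set_lebesgue_integral_def
  using assms loc_intD[OF assms(1)] unfolding set_integrable_def
  by (intro integral_mono) (auto simp: indicator_def)

lemma loc_int_norm_product:
  assumes f: "AC_deriv f w" shows "loc_int (\<lambda>t. 2 * (cmod (f t) * cmod (w t)))"
  using loc_int_mult_continuous[OF loc_int_norm[OF AC_deriv_loc_int[OF f]] continuous_on_norm[OF AC_deriv_continuous[OF f]]]
  by (intro loc_int_cmult) (simp add: mult.commute)

text \<open>
  The derivative of \<open>|f|\<^sup>2\<close> is \<open>2 Re (w cnj f)\<close>.
\<close>
lemma norm_square_oscillation:
  assumes f: "AC_deriv f w" and x: "x \<in> {a..b}" and y: "y \<in> {a..b}"
  shows "(cmod (f x))\<^sup>2 \<le> (cmod (f y))\<^sup>2 + (LINT t:{a..b}|lebesgue. 2 * (cmod (f t) * cmod (w t)))"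
proof -
  note li = loc_int_norm_product[OF f]
  have le: "\<bar>LINT t:{u..v}|lebesgue. 2 * Re (w t * cnj (f t))\<bar> \<le> (LINT t:{a..b}|lebesgue. 2 * (cmod (f t) * cmod (w t)))"
    if "{u..v} \<subseteq> {a..b}" for u v
  proof -
    have l2: "loc_int (\<lambda>t. 2 * Re (w t * cnj (f t)))" by (rule AC_deriv_loc_int[OF AC_deriv_norm_square[OF f]])
    have "norm (LINT t:{u..v}|lebesgue. 2 * Re (w t * cnj (f t))) \<le> (LINT t:{u..v}|lebesgue. norm (2 * Re (w t * cnj (f t))))"
      by (rule norm_lint_le[OF loc_intD[OF l2]])
    also have "\<dots> \<le> (LINT t:{u..v}|lebesgue. 2 * (cmod (f t) * cmod (w t)))"
    proof (rule set_integral_mono)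
      fix t
      have "\<bar>Re (w t * cnj (f t))\<bar> \<le> cmod (f t) * cmod (w t)"
        using abs_Re_le_cmod[of "w t * cnj (f t)"] by (simp add: norm_mult mult.commute)
      then show "norm (2 * Re (w t * cnj (f t))) \<le> 2 * (cmod (f t) * cmod (w t))" by (simp add: abs_mult)
    qed (intro loc_intD[OF li] loc_intD[OF loc_int_norm[OF l2]])+
    also have "\<dots> \<le> (LINT t:{a..b}|lebesgue. 2 * (cmod (f t) * cmod (w t)))"
      by (rule lint_mono_interval[OF li _ that]) simp
    finally show ?thesis by simp
  qed
  show ?thesis
  proof (cases "x \<le> y")
    case True
    then show ?thesis using AC_deriv_diff_eq[OF AC_deriv_norm_square[OF f] True] le[of x y] x y by (auto simp: abs_le_iff)
  next
    case False
    then have "y \<le> x" by simp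
    then show ?thesis using AC_deriv_diff_eq[OF AC_deriv_norm_square[OF f], of y x] le[of y x] x y by (auto simp: abs_le_iff)
  qed
qed

text \<open>
  Averaging \<open>norm_square_oscillation\<close> over \<open>y\<close> bounds \<open>|f|\<^sup>2\<close> on the interval by the integral on
  the right, which can be taken out of the integral on the left. As the interval has length one,
  mean and integral agree.
\<close>
lemma weighted_square_unit_interval:
  assumes f: "AC_deriv f w" and v: "loc_int v" "\<And>x. 0 \<le> v x" and N: "(LINT t:{a..a+1}|lebesgue. v t) \<le> N"
  shows "(LINT t:{a..a+1}|lebesgue. v t * (cmod (f t))\<^sup>2)
    \<le> N * (LINT t:{a..a+1}|lebesgue. (cmod (f t))\<^sup>2 + 2 * (cmod (f t) * cmod (w t)))"
proof -
  let ?S = "LINT t:{a..a+1}|lebesgue. (cmod (f t))\<^sup>2 + 2 * (cmod (f t) * cmod (w t))"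
  let ?T = "LINT t:{a..a+1}|lebesgue. 2 * (cmod (f t) * cmod (w t))"
  have c: "continuous_on UNIV (\<lambda>t. (cmod (f t))\<^sup>2)" by (intro continuous_intros AC_deriv_continuous[OF f])
  note li = loc_int_norm_product[OF f]
  have S: "?S = (LINT t:{a..a+1}|lebesgue. (cmod (f t))\<^sup>2) + ?T"
    by (intro set_integral_add loc_intD loc_int_continuous c li)
  have pt: "(cmod (f x))\<^sup>2 \<le> ?S" if x: "x \<in> {a..a+1}" for x
  proof -
    have "(cmod (f x))\<^sup>2 - ?T = (LINT t:{a..a+1}|lebesgue. (cmod (f x))\<^sup>2 - ?T)" by (simp add: lint_const)
    also have "\<dots> \<le> (LINT t:{a..a+1}|lebesgue. (cmod (f t))\<^sup>2)"
    proof (rule set_integral_mono)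
      fix t assume "t \<in> {a..a+1}"
      from norm_square_oscillation[OF f x this] show "(cmod (f x))\<^sup>2 - ?T \<le> (cmod (f t))\<^sup>2" by simp
    qed (intro set_integrable_const loc_intD loc_int_continuous c)+
    finally show ?thesis using S by linarith
  qed
  have S0: "0 \<le> ?S" using pt[of a] by (smt (verit) atLeastAtMost_iff zero_le_power2)
  have "(LINT t:{a..a+1}|lebesgue. v t * (cmod (f t))\<^sup>2) \<le> (LINT t:{a..a+1}|lebesgue. v t * ?S)"
  proof (rule set_integral_mono)
    show "set_integrable lebesgue {a..a+1} (\<lambda>t. v t * (cmod (f t))\<^sup>2)"
      by (intro loc_intD loc_int_mult_continuous v c)
    show "set_integrable lebesgue {a..a+1} (\<lambda>t. v t * ?S)" by (intro set_integrable_mult_left loc_intD v)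
  qed (intro mult_left_mono pt v)
  also have "\<dots> = (LINT t:{a..a+1}|lebesgue. v t) * ?S" by (rule set_integral_mult_left)
  also have "\<dots> \<le> N * ?S" using N S0 by (intro mult_right_mono)
  finally show ?thesis .
qed

lemma weighted_square_interval:
  assumes f: "AC_deriv f w" and v: "loc_int v" "\<And>x. 0 \<le> v x"
    and N: "\<And>k. k < n \<Longrightarrow> (LINT t:{a + real k..a + real k + 1}|lebesgue. v t) \<le> N"
  shows "(LINT t:{a..a + real n}|lebesgue. v t * (cmod (f t))\<^sup>2)
    \<le> N * (LINT t:{a..a + real n}|lebesgue. (cmod (f t))\<^sup>2 + 2 * (cmod (f t) * cmod (w t)))"
  using N
proof (induction n)
  case 0
  have "(LINT t:{a..a}|lebesgue. g t) = 0" if "loc_int g" for g :: "real \<Rightarrow> real"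
    using prim_diff[OF that, of a a] by simp
  moreover have c: "continuous_on UNIV (\<lambda>t. (cmod (f t))\<^sup>2)" by (intro continuous_intros AC_deriv_continuous[OF f])
  moreover have li: "loc_int (\<lambda>t. 2 * (cmod (f t) * cmod (w t)))"
    using loc_int_mult_continuous[OF loc_int_norm[OF AC_deriv_loc_int[OF f]] continuous_on_norm[OF AC_deriv_continuous[OF f]]]
    by (intro loc_int_cmult) (simp add: mult.commute)
  ultimately show ?case
    using loc_int_mult_continuous[OF v(1) c] loc_int_add[OF loc_int_continuous[OF c] li] by simp
next
  case (Suc n)
  have c: "continuous_on UNIV (\<lambda>t. (cmod (f t))\<^sup>2)" by (intro continuous_intros AC_deriv_continuous[OF f])
  note li = loc_int_norm_product[OF f]
  have split: "(LINT t:{a..a + real (Suc n)}|lebesgue. g t) = (LINT t:{a..a + real n}|lebesgue. g t) + (LINT t:{a + real n..a + real n + 1}|lebesgue. g t)"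
    if "loc_int g" for g :: "real \<Rightarrow> real"
    using lint_combine[OF loc_intD[OF that], of a "a + real n" "a + real n + 1"] by (simp add: add_ac)
  show ?case
    unfolding split[OF loc_int_mult_continuous[OF v(1) c]] split[OF loc_int_add[OF loc_int_continuous[OF c] li]] distrib_left
    by (intro add_mono Suc.IH weighted_square_unit_interval[OF f v] Suc.prems) auto
qed

lemma nonneg_exhaustion:
  fixes g :: "real \<Rightarrow> real"
  assumes g: "loc_int g" "\<And>x. 0 \<le> g x" and B: "\<And>n::nat. (LINT t:{-real n..real n}|lebesgue. g t) \<le> B"
  shows "integrable lebesgue g" "(\<integral>x. g x \<partial>lebesgue) \<le> B"
proof -
  let ?g = "\<lambda>n x. indicator {-real n..real n} x *\<^sub>R g x"
  have i: "integrable lebesgue (?g n)" for n using loc_intD[OF g(1)] by (simp add: set_integrable_def)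
  have lim: "(\<lambda>n. ?g n x) \<longlonglongrightarrow> g x" for x by (rule indicator_exhausts)
  have mono: "mono (\<lambda>n. ?g n x)" for x
    using g(2)[of x] by (intro monoI) (auto simp: indicator_def)
  have "incseq (\<lambda>n. \<integral>x. ?g n x \<partial>lebesgue)"
    using mono i by (intro monoI integral_mono) (auto simp: mono_def)
  moreover have B': "(\<integral>x. ?g n x \<partial>lebesgue) \<le> B" for n using B[of n] by (simp add: set_lebesgue_integral_def)
  ultimately obtain L where L: "(\<lambda>n. \<integral>x. ?g n x \<partial>lebesgue) \<longlonglongrightarrow> L" using incseq_convergent by blast
  have m: "g \<in> borel_measurable lebesgue" by (rule loc_int_measurable[OF g(1)])
  show "integrable lebesgue g"
    by (rule integrable_monotone_convergence[OF i _ _ L m]) (use mono lim in auto)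
  have "(\<integral>x. g x \<partial>lebesgue) = L"
    by (rule integral_monotone_convergence[OF i _ _ L m]) (use mono lim in auto)
  then show "(\<integral>x. g x \<partial>lebesgue) \<le> B" using LIMSEQ_le_const2[OF L] B' by blast
qed

lemma lint_le_integral:
  fixes g :: "real \<Rightarrow> real"
  assumes "integrable lebesgue g" "\<And>x. 0 \<le> g x"
  shows "(LINT t:{a..b}|lebesgue. g t) \<le> (\<integral>x. g x \<partial>lebesgue)"
  unfolding set_lebesgue_integral_def using assms
  by (intro integral_mono integrable_mult_indicator) (auto simp: indicator_def)

lemma loc_int_neg_part:
  assumes q: "loc_int q" shows "loc_int (neg_part q)"
proof -
  have "loc_int (\<lambda>x. (1/2) * (\<bar>q x\<bar> + (-1) * q x))"
    using loc_int_norm[OF q] q by (intro loc_int_cmult loc_int_add) auto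
  moreover have "neg_part q = (\<lambda>x. (1/2) * (\<bar>q x\<bar> + (-1) * q x))" by (auto simp: neg_part_def)
  ultimately show ?thesis by simp
qed

section \<open>The quadratic form and its lower bound\<close>

text \<open>
  The coefficients after modification on null sets, so that positivity and the bounds hold at
  every point. Here \<open>s\<close> is \<open>1/p\<close>. The negative part of \<open>q\<close> is bounded by \<open>N\<close> on the intervals
  between consecutive integers, as in the definition of the uniform norm, because \<open>N\<close> enters the
  final constant; the bound \<open>Q\<close> for \<open>|q|\<close> serves only for finiteness and is assumed for all unit
  intervals.
\<close>
locale sturm_liouville =
  fixes s q r :: "real \<Rightarrow> real" and P c K N Q :: real
  assumes s_meas: "s \<in> borel_measurable lebesgue" and s_pos: "\<And>x. 0 < s x" and s_le: "\<And>x. s x \<le> P"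
    and r_loc: "loc_int r" and r_pos: "\<And>x. 0 < r x" and c_pos: "c > 0" and r_ge: "\<And>x. K < \<bar>x\<bar> \<Longrightarrow> c \<le> r x"
    and q_loc: "loc_int q" and Q: "\<And>x. (LINT t:{x..x+1}|lebesgue. \<bar>q t\<bar>) \<le> Q"
    and N: "\<And>n::int. (LINT t:{real_of_int n..real_of_int n + 1}|lebesgue. neg_part q t) \<le> N"
begin

lemma P_pos: "P > 0" using s_pos[of 0] s_le[of 0] by linarith

lemma neg_part_loc: "loc_int (neg_part q)" "0 \<le> neg_part q x" "- q x \<le> neg_part q x"
  using loc_int_neg_part[OF q_loc] by (auto simp: neg_part_def)

lemma N_nonneg: "N \<ge> 0"
  by (rule order_trans[OF lint_nonneg N[of 0]]) (rule neg_part_loc(2))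

lemma Q_nonneg: "Q \<ge> 0"
  by (rule order_trans[OF lint_nonneg Q[of 0]]) simp

lemma s_loc: "loc_int s"
  unfolding loc_int_def
proof (intro allI)
  fix a b
  show "set_integrable lebesgue {a..b} s"
    unfolding set_integrable_def
  proof (rule Bochner_Integration.integrable_bound)
    show "integrable lebesgue (\<lambda>x. indicator {a..b} x *\<^sub>R P)"
      using set_integrable_const[of a b P] by (simp add: set_integrable_def)
    show "(\<lambda>x. indicat_real {a..b} x *\<^sub>R s x) \<in> borel_measurable lebesgue"
      using s_meas by (intro borel_measurable_scaleR borel_measurable_indicator) auto
    show "AE x in lebesgue. norm (indicat_real {a..b} x *\<^sub>R s x) \<le> norm (indicat_real {a..b} x *\<^sub>R P)"
      using s_pos s_le P_pos by (intro AE_I2) (auto simp: indicator_def less_imp_le)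
  qed
qed

text \<open>
  The constants are chosen such that half of the energy survives in \<open>form_ge\<close>.
\<close>
lemma weighted_young: "2 * M * (x * y) \<le> (1/2) * (y\<^sup>2 / s t) + 2 * M\<^sup>2 * P * x\<^sup>2" if "M \<ge> 0"
proof -
  have "0 \<le> (y - 2 * M * s t * x)\<^sup>2 / (2 * s t)" using s_pos[of t] by simp
  also have "\<dots> = (1/2) * (y\<^sup>2 / s t) + 2 * M\<^sup>2 * s t * x\<^sup>2 - 2 * M * (x * y)"
    using s_pos[of t] by (simp add: field_simps power2_eq_square)
  finally have "2 * M * (x * y) \<le> (1/2) * (y\<^sup>2 / s t) + 2 * M\<^sup>2 * s t * x\<^sup>2" by simp
  also have "2 * M\<^sup>2 * s t * x\<^sup>2 \<le> 2 * M\<^sup>2 * P * x\<^sup>2"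
    using s_le[of t] by (intro mult_right_mono mult_left_mono) auto
  finally show ?thesis by simp
qed

text \<open>
  The form is a function of the pair of \<open>f\<close> and a derivative \<open>w\<close> of it; \<open>|w|\<^sup>2 / s\<close> is
  \<open>p |f'|\<^sup>2\<close>.
\<close>
definition in_form :: "(real \<Rightarrow> complex) \<Rightarrow> (real \<Rightarrow> complex) \<Rightarrow> bool" where
  "in_form f w \<longleftrightarrow> AC_deriv f w \<and> integrable lebesgue (\<lambda>x. (cmod (w x))\<^sup>2 / s x) \<and> integrable lebesgue (\<lambda>x. r x * (cmod (f x))\<^sup>2)"

definition energy :: "(real \<Rightarrow> complex) \<Rightarrow> real" where
  "energy w = (\<integral>x. (cmod (w x))\<^sup>2 / s x \<partial>lebesgue)"

definition mass :: "(real \<Rightarrow> complex) \<Rightarrow> real" where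
  "mass f = (\<integral>x. r x * (cmod (f x))\<^sup>2 \<partial>lebesgue)"

definition tform :: "(real \<Rightarrow> complex) \<Rightarrow> (real \<Rightarrow> complex) \<Rightarrow> real" where
  "tform f w = energy w + (\<integral>x. q x * (cmod (f x))\<^sup>2 \<partial>lebesgue)"

definition \<alpha> :: real where "\<alpha> = 2 * N + 4 * P * N\<^sup>2"

lemma alpha_nonneg: "\<alpha> \<ge> 0" using N_nonneg P_pos by (simp add: \<alpha>_def)

lemma weighted_interval:
  assumes f: "AC_deriv f w" and w: "loc_int (\<lambda>x. (cmod (w x))\<^sup>2 / s x)" and v: "loc_int v" "\<And>x. 0 \<le> v x" and M: "M \<ge> 0"
    and vM: "\<And>k. k < n \<Longrightarrow> (LINT t:{a + real k..a + real k + 1}|lebesgue. v t) \<le> M"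
  shows "(LINT t:{a..a + real n}|lebesgue. v t * (cmod (f t))\<^sup>2)
    \<le> (1/2) * (LINT t:{a..a + real n}|lebesgue. (cmod (w t))\<^sup>2 / s t)
      + (M + 2 * P * M\<^sup>2) * (LINT t:{a..a + real n}|lebesgue. (cmod (f t))\<^sup>2)"
proof -
  have c: "continuous_on UNIV (\<lambda>t. (cmod (f t))\<^sup>2)" by (intro continuous_intros AC_deriv_continuous[OF f])
  note li = loc_int_norm_product[OF f]
  let ?I = "{a..a + real n}"
  have "(LINT t:?I|lebesgue. v t * (cmod (f t))\<^sup>2) \<le> M * (LINT t:?I|lebesgue. (cmod (f t))\<^sup>2 + 2 * (cmod (f t) * cmod (w t)))"
    by (rule weighted_square_interval[OF f v vM])
  also have "\<dots> = (LINT t:?I|lebesgue. M * ((cmod (f t))\<^sup>2 + 2 * (cmod (f t) * cmod (w t))))"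
    by (rule set_integral_mult_right[symmetric])
  also have "\<dots> \<le> (LINT t:?I|lebesgue. (1/2) * ((cmod (w t))\<^sup>2 / s t) + (M + 2 * P * M\<^sup>2) * (cmod (f t))\<^sup>2)"
  proof (rule set_integral_mono)
    show "set_integrable lebesgue ?I (\<lambda>t. M * ((cmod (f t))\<^sup>2 + 2 * (cmod (f t) * cmod (w t))))"
      by (intro loc_intD loc_int_cmult loc_int_add loc_int_continuous c li)
    show "set_integrable lebesgue ?I (\<lambda>t. (1/2) * ((cmod (w t))\<^sup>2 / s t) + (M + 2 * P * M\<^sup>2) * (cmod (f t))\<^sup>2)"
      by (intro loc_intD loc_int_cmult loc_int_add loc_int_continuous c w)
    fix t
    show "M * ((cmod (f t))\<^sup>2 + 2 * (cmod (f t) * cmod (w t))) \<le> (1/2) * ((cmod (w t))\<^sup>2 / s t) + (M + 2 * P * M\<^sup>2) * (cmod (f t))\<^sup>2"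
      using weighted_young[OF M, of "cmod (f t)" "cmod (w t)" t] by (simp add: algebra_simps)
  qed
  also have "\<dots> = (LINT t:?I|lebesgue. (1/2) * ((cmod (w t))\<^sup>2 / s t)) + (LINT t:?I|lebesgue. (M + 2 * P * M\<^sup>2) * (cmod (f t))\<^sup>2)"
    by (intro set_integral_add loc_intD loc_int_cmult loc_int_continuous c w)
  finally show ?thesis unfolding set_integral_mult_right .
qed

text \<open>
  \<open>r\<close> is bounded below outside \<open>[-K, K]\<close>, and \<open>f\<close> is bounded on \<open>[-K, K]\<close>.
\<close>
lemma square_integrable:
  fixes f :: "real \<Rightarrow> complex"
  assumes "continuous_on UNIV f" "integrable lebesgue (\<lambda>x. r x * (cmod (f x))\<^sup>2)"
  shows "integrable lebesgue (\<lambda>x. (cmod (f x))\<^sup>2)"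
proof (rule Bochner_Integration.integrable_bound)
  have c: "continuous_on UNIV (\<lambda>t. (cmod (f t))\<^sup>2)" by (intro continuous_intros assms)
  show "integrable lebesgue (\<lambda>x. (1/c) * (r x * (cmod (f x))\<^sup>2) + indicator {-K..K} x *\<^sub>R (cmod (f x))\<^sup>2)"
    using loc_intD[OF loc_int_continuous[OF c]] assms(2) by (intro Bochner_Integration.integrable_add) (auto simp: set_integrable_def)
  show "(\<lambda>x. (cmod (f x))\<^sup>2) \<in> borel_measurable lebesgue"
    using borel_measurable_continuous_onI[OF c] by (rule measurable_completion[of _ lborel borel, simplified])
  show "AE x in lebesgue. norm ((cmod (f x))\<^sup>2) \<le> norm ((1/c) * (r x * (cmod (f x))\<^sup>2) + indicator {-K..K} x *\<^sub>R (cmod (f x))\<^sup>2)"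
  proof (rule AE_I2)
    fix x
    have nn: "0 \<le> (1/c) * (r x * (cmod (f x))\<^sup>2)" using c_pos r_pos[of x] by simp
    let ?Y = "(1/c) * (r x * (cmod (f x))\<^sup>2) + indicator {-K..K} x *\<^sub>R (cmod (f x))\<^sup>2"
    have "(cmod (f x))\<^sup>2 \<le> ?Y"
    proof (cases "x \<in> {-K..K}")
      case True
      then show ?thesis using nn by simp
    next
      case False
      then have "c \<le> r x" by (intro r_ge) auto
      then have "1 * (cmod (f x))\<^sup>2 \<le> (r x / c) * (cmod (f x))\<^sup>2" using c_pos by (intro mult_right_mono) auto
      then show ?thesis using False by simp
    qed
    then have "(cmod (f x))\<^sup>2 \<le> norm ?Y" unfolding real_norm_def using abs_ge_self[of ?Y] by linarith
    then show "norm ((cmod (f x))\<^sup>2) \<le> norm ?Y" by simp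
  qed
qed

lemma in_formD:
  assumes "in_form f w"
  shows "AC_deriv f w" "integrable lebesgue (\<lambda>x. (cmod (w x))\<^sup>2 / s x)" "integrable lebesgue (\<lambda>x. r x * (cmod (f x))\<^sup>2)"
    "integrable lebesgue (\<lambda>x. (cmod (f x))\<^sup>2)" "continuous_on UNIV f"
  using assms square_integrable by (auto simp: in_form_def intro: AC_deriv_continuous)

lemma weighted_line:
  assumes fw: "in_form f w" and v: "loc_int v" "\<And>x. 0 \<le> v x"
    and vM: "\<And>n::int. (LINT t:{real_of_int n..real_of_int n + 1}|lebesgue. v t) \<le> M"
  shows "integrable lebesgue (\<lambda>x. v x * (cmod (f x))\<^sup>2)"
    "(\<integral>x. v x * (cmod (f x))\<^sup>2 \<partial>lebesgue) \<le> (1/2) * energy w + (M + 2 * P * M\<^sup>2) * (\<integral>x. (cmod (f x))\<^sup>2 \<partial>lebesgue)"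
proof -
  note f = in_formD[OF fw]
  have M: "M \<ge> 0" by (rule order_trans[OF lint_nonneg vM[of 0]]) (rule v(2))
  have c: "continuous_on UNIV (\<lambda>t. (cmod (f t))\<^sup>2)" by (intro continuous_intros f)
  have lv: "loc_int (\<lambda>x. v x * (cmod (f x))\<^sup>2)" by (rule loc_int_mult_continuous[OF v(1) c])
  have "(LINT t:{-real n..real n}|lebesgue. v t * (cmod (f t))\<^sup>2) \<le> (1/2) * energy w + (M + 2 * P * M\<^sup>2) * (\<integral>x. (cmod (f x))\<^sup>2 \<partial>lebesgue)" for n :: nat
  proof -
    have vM': "(LINT t:{- real n + real k..- real n + real k + 1}|lebesgue. v t) \<le> M" for k
      using vM[of "int k - int n"] by (simp add: algebra_simps)
    have "(LINT t:{-real n..- real n + real (2*n)}|lebesgue. v t * (cmod (f t))\<^sup>2)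
      \<le> (1/2) * (LINT t:{-real n..- real n + real (2*n)}|lebesgue. (cmod (w t))\<^sup>2 / s t)
      + (M + 2 * P * M\<^sup>2) * (LINT t:{-real n..- real n + real (2*n)}|lebesgue. (cmod (f t))\<^sup>2)"
      by (rule weighted_interval[OF f(1) loc_int_of_integrable[OF f(2)] v M vM'])
    also have "\<dots> \<le> (1/2) * energy w + (M + 2 * P * M\<^sup>2) * (\<integral>x. (cmod (f x))\<^sup>2 \<partial>lebesgue)"
      unfolding energy_def using M P_pos f s_pos
      by (intro add_mono mult_left_mono lint_le_integral) (auto simp: less_imp_le)
    finally show ?thesis by simp
  qed
  from nonneg_exhaustion[OF lv _ this] v(2)
  show "integrable lebesgue (\<lambda>x. v x * (cmod (f x))\<^sup>2)"
    "(\<integral>x. v x * (cmod (f x))\<^sup>2 \<partial>lebesgue) \<le> (1/2) * energy w + (M + 2 * P * M\<^sup>2) * (\<integral>x. (cmod (f x))\<^sup>2 \<partial>lebesgue)"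
    by auto
qed

lemma q_integrable:
  assumes "in_form f w" shows "integrable lebesgue (\<lambda>x. \<bar>q x\<bar> * (cmod (f x))\<^sup>2)" "integrable lebesgue (\<lambda>x. q x * (cmod (f x))\<^sup>2)"
proof -
  show *: "integrable lebesgue (\<lambda>x. \<bar>q x\<bar> * (cmod (f x))\<^sup>2)"
    by (rule weighted_line(1)[OF assms _ _ Q]) (use loc_int_norm[OF q_loc] in auto)
  have c: "continuous_on UNIV (\<lambda>t. (cmod (f t))\<^sup>2)" by (intro continuous_intros in_formD[OF assms])
  have "q \<in> borel_measurable lebesgue" by (rule loc_int_measurable[OF q_loc])
  moreover have "(\<lambda>x. (cmod (f x))\<^sup>2) \<in> borel_measurable lebesgue"
    using borel_measurable_continuous_onI[OF c] by (rule measurable_completion[of _ lborel borel, simplified])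
  ultimately show "integrable lebesgue (\<lambda>x. q x * (cmod (f x))\<^sup>2)"
    by (intro Bochner_Integration.integrable_bound[OF *]) (auto simp: abs_mult)
qed

text \<open>
  With \<open>v\<close> the negative part of \<open>q\<close> and \<open>M = N\<close>, the unit-interval estimate spends half of the
  energy, and the coefficient \<open>N + 2 P N\<^sup>2\<close> of \<open>\<integral> |f|\<^sup>2\<close> is \<open>\<alpha>/2\<close>.
\<close>
lemma form_ge:
  assumes "in_form f w"
  shows "tform f w \<ge> (1/2) * energy w - (\<alpha>/2) * (\<integral>x. (cmod (f x))\<^sup>2 \<partial>lebesgue)"
proof -
  note n = weighted_line[OF assms neg_part_loc(1) neg_part_loc(2) N]
  have "- (\<integral>x. neg_part q x * (cmod (f x))\<^sup>2 \<partial>lebesgue) = (\<integral>x. - (neg_part q x * (cmod (f x))\<^sup>2) \<partial>lebesgue)"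
    by simp
  also have "\<dots> \<le> (\<integral>x. q x * (cmod (f x))\<^sup>2 \<partial>lebesgue)"
  proof (rule integral_mono)
    fix x
    have "- neg_part q x * (cmod (f x))\<^sup>2 \<le> q x * (cmod (f x))\<^sup>2"
      using neg_part_loc(3)[of x] by (intro mult_right_mono) auto
    then show "- (neg_part q x * (cmod (f x))\<^sup>2) \<le> q x * (cmod (f x))\<^sup>2" by simp
  qed (use n(1) q_integrable[OF assms] in auto)
  finally have le: "- (\<integral>x. neg_part q x * (cmod (f x))\<^sup>2 \<partial>lebesgue) \<le> (\<integral>x. q x * (cmod (f x))\<^sup>2 \<partial>lebesgue)" .
  have half: "\<alpha>/2 = N + 2 * P * N\<^sup>2" by (simp add: \<alpha>_def)
  show ?thesis using n(2) le unfolding tform_def half by linarith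
qed

lemma energy_nonneg: "energy w \<ge> 0"
  unfolding energy_def using s_pos by (intro integral_nonneg_AE AE_I2) (simp add: less_imp_le)

lemma mass_nonneg: "mass f \<ge> 0"
  unfolding mass_def using r_pos by (intro integral_nonneg_AE AE_I2) (simp add: less_imp_le)

lemma square_small_somewhere:
  fixes f :: "real \<Rightarrow> complex"
  assumes "continuous_on UNIV f" "integrable lebesgue (\<lambda>x. (cmod (f x))\<^sup>2)" and e: "e > 0"
  shows "\<exists>y\<ge>Y. (cmod (f y))\<^sup>2 < e" "\<exists>y\<le>Y. (cmod (f y))\<^sup>2 < e"
proof -
  let ?F = "\<integral>x. (cmod (f x))\<^sup>2 \<partial>lebesgue"
  have c: "continuous_on UNIV (\<lambda>t. (cmod (f t))\<^sup>2)" by (intro continuous_intros assms)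
  have *: "\<exists>t\<in>{a..b}. (cmod (f t))\<^sup>2 < e" if "a \<le> b" "(b - a) * e > ?F" for a b :: real
  proof (rule ccontr)
    assume "\<not> ?thesis"
    then have ge: "e \<le> (cmod (f t))\<^sup>2" if "t \<in> {a..b}" for t using that by (meson not_less)
    have "(b - a) * e = (LINT t:{a..b}|lebesgue. e)" using that by (simp add: lint_const)
    also have "\<dots> \<le> (LINT t:{a..b}|lebesgue. (cmod (f t))\<^sup>2)"
      by (intro set_integral_mono ge set_integrable_const loc_intD loc_int_continuous c)
    also have "\<dots> \<le> ?F" by (rule lint_le_integral[OF assms(2)]) simp
    finally show False using that by simp
  qed
  have F0: "?F \<ge> 0" by simp
  define l where "l = ?F / e + 1"
  have l: "l > 0" "l * e > ?F" using F0 e by (auto simp: l_def field_simps add_pos_nonneg)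
  show "\<exists>y\<ge>Y. (cmod (f y))\<^sup>2 < e" using *[of Y "Y + l"] l by force
  show "\<exists>y\<le>Y. (cmod (f y))\<^sup>2 < e" using *[of "Y - l" Y] l by force
qed

text \<open>
  Integrate the derivative of \<open>|f|\<^sup>2\<close> from \<open>x\<close> to a far point where \<open>|f|\<^sup>2\<close> is almost zero, and
  split \<open>2 |f| |w|\<close> by Young's inequality with a free parameter.
\<close>
lemma pointwise_bound:
  assumes "in_form f w" and t: "\<theta> > 0"
  shows "(cmod (f x))\<^sup>2 \<le> \<theta> * energy w + (P / \<theta>) * (\<integral>x. (cmod (f x))\<^sup>2 \<partial>lebesgue)" (is "_ \<le> ?B")
proof (rule field_le_epsilon)
  fix e :: real assume "e > 0"
  note f = in_formD[OF assms(1)]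
  obtain y where y: "y \<ge> x" "(cmod (f y))\<^sup>2 < e" using square_small_somewhere(1)[OF f(5,4) \<open>e > 0\<close>] by blast
  have c: "continuous_on UNIV (\<lambda>t. (cmod (f t))\<^sup>2)" by (intro continuous_intros f)
  note li = loc_int_norm_product[OF f(1)]
  have lr: "loc_int (\<lambda>t. \<theta> * ((cmod (w t))\<^sup>2 / s t))" "loc_int (\<lambda>t. (P/\<theta>) * (cmod (f t))\<^sup>2)"
    by (intro loc_int_cmult loc_int_of_integrable f loc_int_continuous c)+
  have "(cmod (f x))\<^sup>2 \<le> (cmod (f y))\<^sup>2 + (LINT t:{x..y}|lebesgue. 2 * (cmod (f t) * cmod (w t)))"
    by (rule norm_square_oscillation[OF f(1)]) (use y in auto)
  also have "(LINT t:{x..y}|lebesgue. 2 * (cmod (f t) * cmod (w t))) \<le> (LINT t:{x..y}|lebesgue. \<theta> * ((cmod (w t))\<^sup>2 / s t) + (P/\<theta>) * (cmod (f t))\<^sup>2)"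
  proof (rule set_integral_mono)
    fix z
    have "2 * (1/(2*\<theta>)) * (cmod (f z) * cmod (w z)) \<le> (1/2) * ((cmod (w z))\<^sup>2 / s z) + 2 * (1/(2*\<theta>))\<^sup>2 * P * (cmod (f z))\<^sup>2"
      using t by (intro weighted_young) auto
    then have "2 * \<theta> * (2 * (1/(2*\<theta>)) * (cmod (f z) * cmod (w z))) \<le> 2 * \<theta> * ((1/2) * ((cmod (w z))\<^sup>2 / s z) + 2 * (1/(2*\<theta>))\<^sup>2 * P * (cmod (f z))\<^sup>2)"
      using t by (intro mult_left_mono) auto
    also have "2 * \<theta> * ((1/2) * ((cmod (w z))\<^sup>2 / s z) + 2 * (1/(2*\<theta>))\<^sup>2 * P * (cmod (f z))\<^sup>2)
       = \<theta> * ((cmod (w z))\<^sup>2 / s z) + (P/\<theta>) * (cmod (f z))\<^sup>2"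
      using t by (simp add: distrib_left power2_eq_square)
    also have "2 * \<theta> * (2 * (1/(2*\<theta>)) * (cmod (f z) * cmod (w z))) = 2 * (cmod (f z) * cmod (w z))" using t by simp
    finally show "2 * (cmod (f z) * cmod (w z)) \<le> \<theta> * ((cmod (w z))\<^sup>2 / s z) + (P/\<theta>) * (cmod (f z))\<^sup>2" .
  qed (intro loc_intD li loc_int_add lr)+
  also have "\<dots> = \<theta> * (LINT t:{x..y}|lebesgue. (cmod (w t))\<^sup>2 / s t) + (P/\<theta>) * (LINT t:{x..y}|lebesgue. (cmod (f t))\<^sup>2)"
    unfolding set_integral_mult_right[symmetric] by (intro set_integral_add loc_intD lr)
  also have "\<dots> \<le> ?B"
    unfolding energy_def using t P_pos f s_pos
    by (intro add_mono mult_left_mono lint_le_integral) (auto simp: less_imp_le)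
  finally show "(cmod (f x))\<^sup>2 \<le> ?B + e" using y by simp
qed

text \<open>
  Only a negative form value needs an argument. It forces \<open>energy w \<le> \<alpha> F\<close> with \<open>F = \<integral> |f|\<^sup>2\<close>,
  whence \<open>|f|\<^sup>2 \<le> \<beta> F\<close> at every point: \<open>\<theta> = sqrt (P/\<alpha>)\<close> balances the two terms of
  \<open>pointwise_bound\<close>. The set \<open>\<Omega>\<close> therefore carries at most the fraction \<open>|\<Omega>| \<beta> < 1\<close> of \<open>F\<close>, and
  off \<open>\<Omega>\<close> the density \<open>|f|\<^sup>2\<close> is at most \<open>G r |f|\<^sup>2\<close>.
\<close>
theorem form_lower_bound:
  assumes fw: "in_form f w" and G: "G \<ge> 0" and \<Omega>: "\<Omega> \<in> sets lebesgue"
    and fin: "\<alpha> > 0 \<Longrightarrow> emeasure lebesgue \<Omega> \<noteq> \<infinity>"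
    and small: "measure lebesgue \<Omega> * sqrt (4 * P * \<alpha>) < 1"
    and off: "AE x in lebesgue. x \<notin> \<Omega> \<longrightarrow> 1 \<le> G * r x"
  shows "tform f w \<ge> - (\<alpha> * G / (1 - measure lebesgue \<Omega> * sqrt (4 * P * \<alpha>))) * mass f"
proof (cases "tform f w \<ge> 0")
  case True
  have "\<alpha> * G / (1 - measure lebesgue \<Omega> * sqrt (4 * P * \<alpha>)) * mass f \<ge> 0"
    using alpha_nonneg G mass_nonneg small by (intro mult_nonneg_nonneg divide_nonneg_nonneg) auto
  with True show ?thesis by linarith
next
  case False
  note f = in_formD[OF fw]
  define F where "F = (\<integral>x. (cmod (f x))\<^sup>2 \<partial>lebesgue)"
  have F0: "F \<ge> 0" by (simp add: F_def)
  have ge: "tform f w \<ge> (1/2) * energy w - (\<alpha>/2) * F" using form_ge[OF fw] by (simp add: F_def)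
  have "\<alpha> \<noteq> 0" using False ge energy_nonneg[of w] by auto
  then have a: "\<alpha> > 0" using alpha_nonneg by simp
  have E: "energy w \<le> \<alpha> * F" using False ge by simp
  define \<theta> where "\<theta> = sqrt (P / \<alpha>)"
  have \<theta>: "\<theta> > 0" "\<theta> * \<theta> = P / \<alpha>" using P_pos a by (auto simp: \<theta>_def)
  have beta: "sqrt (4 * P * \<alpha>) = 2 * \<theta> * \<alpha>"
  proof (rule real_sqrt_unique)
    show "(2 * \<theta> * \<alpha>)\<^sup>2 = 4 * P * \<alpha>" using \<theta> a by (simp add: power2_eq_square) (simp add: field_simps)
  qed (use \<theta> a in simp)
  let ?b = "sqrt (4 * P * \<alpha>)" and ?m = "measure lebesgue \<Omega>"
  have pw: "(cmod (f x))\<^sup>2 \<le> ?b * F" for x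
  proof -
    have "(cmod (f x))\<^sup>2 \<le> \<theta> * energy w + (P / \<theta>) * F" unfolding F_def by (rule pointwise_bound[OF fw \<theta>(1)])
    also have "\<dots> \<le> \<theta> * (\<alpha> * F) + (P / \<theta>) * F" using E \<theta> by (intro add_right_mono mult_left_mono) auto
    also have "P / \<theta> = \<theta> * \<alpha>" using \<theta> a by (simp add: field_simps)
    finally show ?thesis unfolding beta by (simp add: algebra_simps)
  qed
  have "F \<le> (\<integral>x. G * (r x * (cmod (f x))\<^sup>2) + indicator \<Omega> x * (?b * F) \<partial>lebesgue)"
    unfolding F_def
  proof (rule integral_mono_AE)
    have "integrable lebesgue (\<lambda>x. indicator \<Omega> x * (?b * F))"
      using fin[OF a] \<Omega> by (intro integrable_mult_left) (auto simp: less_top)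
    then show "integrable lebesgue (\<lambda>x. G * (r x * (cmod (f x))\<^sup>2) + indicator \<Omega> x * (?b * (\<integral>x. (cmod (f x))\<^sup>2 \<partial>lebesgue)))"
      using f by (intro Bochner_Integration.integrable_add) (auto simp: F_def)
    show "AE x in lebesgue. (cmod (f x))\<^sup>2 \<le> G * (r x * (cmod (f x))\<^sup>2) + indicator \<Omega> x * (?b * (\<integral>x. (cmod (f x))\<^sup>2 \<partial>lebesgue))"
      using off
    proof eventually_elim
      case (elim x)
      show ?case
      proof (cases "x \<in> \<Omega>")
        case True
        have "0 \<le> G * (r x * (cmod (f x))\<^sup>2)" using G r_pos[of x] by simp
        then show ?thesis using pw[of x] True by (simp add: F_def)
      next
        case False
        then have "1 * (cmod (f x))\<^sup>2 \<le> (G * r x) * (cmod (f x))\<^sup>2" using elim by (intro mult_right_mono) auto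
        then show ?thesis using False by (simp add: mult.assoc)
      qed
    qed
  qed (rule f)
  also have "\<dots> = G * mass f + ?m * (?b * F)"
    using f fin[OF a] \<Omega> by (subst Bochner_Integration.integral_add) (auto simp: mass_def less_top)
  finally have "(1 - ?m * ?b) * F \<le> G * mass f" by (simp add: algebra_simps)
  then have F: "F \<le> G * mass f / (1 - ?m * ?b)" using small by (simp add: pos_le_divide_eq mult.commute)
  have "- (\<alpha> * G / (1 - ?m * ?b)) * mass f = - (\<alpha> * (G * mass f / (1 - ?m * ?b)))" by simp
  also have "\<dots> \<le> - (\<alpha> * F)" using F a by (intro le_imp_neg_le mult_left_mono) auto
  also have "\<dots> \<le> - ((\<alpha>/2) * F)" using a F0 by simp
  also have "\<dots> \<le> tform f w" using ge energy_nonneg[of w] by simp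
  finally show ?thesis .
qed

end

section \<open>The maximal domain lies in the form domain\<close>

lemma continuous_measurable:
  fixes g :: "real \<Rightarrow> 'a::euclidean_space"
  shows "continuous_on UNIV g \<Longrightarrow> g \<in> borel_measurable lebesgue"
  by (intro loc_int_measurable loc_int_continuous)

lemma loc_int_of_real:
  "loc_int v \<Longrightarrow> loc_int (\<lambda>x. complex_of_real (v x))"
  unfolding loc_int_def set_integrable_def
  using integrable_of_real[where 'a=complex] by (fastforce simp: scaleR_conv_of_real)

lemma lint_exhaust:
  fixes g :: "real \<Rightarrow> 'a::euclidean_space"
  assumes g: "integrable lebesgue g" and x: "\<And>n. x n \<le> - real n" and y: "\<And>n. real n \<le> y n"
  shows "(\<lambda>n. LINT t:{x n..y n}|lebesgue. g t) \<longlonglongrightarrow> (\<integral>t. g t \<partial>lebesgue)"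
  unfolding set_lebesgue_integral_def
proof (rule integral_dominated_convergence[where w="\<lambda>t. norm (g t)"])
  show "AE t in lebesgue. (\<lambda>n. indicat_real {x n..y n} t *\<^sub>R g t) \<longlonglongrightarrow> g t"
  proof (intro AE_I2 tendsto_eventually)
    fix t
    show "\<forall>\<^sub>F n in sequentially. indicat_real {x n..y n} t *\<^sub>R g t = g t"
      using eventually_ge_at_top[of "nat \<lceil>\<bar>t\<bar>\<rceil>"]
    proof eventually_elim
      case (elim n)
      then have "\<bar>t\<bar> \<le> real n" by (simp add: nat_ceiling_le_eq)
      then show ?case using x[of n] y[of n] by (auto simp: indicator_def)
    qed
  qed
  show "(\<lambda>t. indicat_real {x n..y n} t *\<^sub>R g t) \<in> borel_measurable lebesgue" for n
    using g by (intro borel_measurable_scaleR borel_measurable_indicator) auto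
qed (use g in \<open>auto simp: indicator_def\<close>)

lemma tail_small:
  fixes g :: "real \<Rightarrow> real"
  assumes g: "integrable lebesgue g" "\<And>x. 0 \<le> g x" and e: "e > 0"
  shows "\<exists>n::nat. (\<forall>y\<ge>real n. (LINT t:{real n..y}|lebesgue. g t) \<le> e) \<and> (\<forall>y\<le>-real n. (LINT t:{y..-real n}|lebesgue. g t) \<le> e)"
proof -
  let ?I = "\<integral>t. g t \<partial>lebesgue"
  have "\<forall>\<^sub>F n in sequentially. (LINT t:{-real n..real n}|lebesgue. g t) > ?I - e"
    by (rule order_tendstoD(1)[OF lint_exhaust[OF g(1)]]) (use e in auto)
  then obtain n where n: "(LINT t:{-real n..real n}|lebesgue. g t) > ?I - e"
    by (meson eventually_happens trivial_limit_sequentially)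
  have l: "loc_int g" by (rule loc_int_of_integrable[OF g(1)])
  have "(LINT t:{real n..y}|lebesgue. g t) \<le> e" if "real n \<le> y" for y
    using lint_combine[OF loc_intD[OF l], of "-real n" "real n" y] lint_le_integral[OF g, of "-real n" y] n that by auto
  moreover have "(LINT t:{y..-real n}|lebesgue. g t) \<le> e" if "y \<le> - real n" for y
    using lint_combine[OF loc_intD[OF l], of y "-real n" "real n"] lint_le_integral[OF g, of y "real n"] n that by auto
  ultimately show ?thesis by blast
qed

context sturm_liouville
begin

text \<open>
  The equation \<open>\<tau> f = k\<close> as a first-order system for \<open>f\<close> and its quasi-derivative \<open>u = p f'\<close>,
  which needs no division by \<open>r\<close> or \<open>s\<close>.
\<close>
definition solves :: "(real \<Rightarrow> complex) \<Rightarrow> (real \<Rightarrow> complex) \<Rightarrow> (real \<Rightarrow> complex) \<Rightarrow> bool" where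
  "solves f u k \<longleftrightarrow> AC_deriv f (\<lambda>x. of_real (s x) * u x) \<and> AC_deriv u (\<lambda>x. of_real (q x) * f x - of_real (r x) * k x)"

definition in_L2 :: "(real \<Rightarrow> complex) \<Rightarrow> bool" where
  "in_L2 h \<longleftrightarrow> h \<in> borel_measurable lebesgue \<and> integrable lebesgue (\<lambda>x. r x * (cmod (h x))\<^sup>2)"

definition in_dom :: "(real \<Rightarrow> complex) \<Rightarrow> (real \<Rightarrow> complex) \<Rightarrow> (real \<Rightarrow> complex) \<Rightarrow> bool" where
  "in_dom f u k \<longleftrightarrow> solves f u k \<and> in_L2 f \<and> in_L2 k"

lemma r_meas: "r \<in> borel_measurable lebesgue" by (rule loc_int_measurable[OF r_loc])

text \<open>
  The second part is Young's inequality; with \<open>d\<close> at the caller's disposal it takes the place of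
  the Cauchy-Schwarz inequality.
\<close>
lemma L2_product:
  assumes "in_L2 h" "in_L2 f"
  shows "integrable lebesgue (\<lambda>x. of_real (r x) * h x * cnj (f x))"
    "d > 0 \<Longrightarrow> cmod (\<integral>x. of_real (r x) * h x * cnj (f x) \<partial>lebesgue) \<le> mass h / (2 * d) + d / 2 * mass f"
proof -
  have bound: "cmod (of_real (r x) * h x * cnj (f x)) \<le> (1/(2*d)) * (r x * (cmod (h x))\<^sup>2) + (d/2) * (r x * (cmod (f x))\<^sup>2)" if d: "d > 0" for x d
  proof -
    have "0 \<le> (cmod (h x) - d * cmod (f x))\<^sup>2 / (2 * d)" using d by simp
    also have "\<dots> = (1/(2*d)) * (cmod (h x))\<^sup>2 + (d/2) * (cmod (f x))\<^sup>2 - cmod (h x) * cmod (f x)"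
      using d by (simp add: field_simps power2_eq_square)
    finally have "cmod (h x) * cmod (f x) \<le> (1/(2*d)) * (cmod (h x))\<^sup>2 + (d/2) * (cmod (f x))\<^sup>2" by simp
    then have "r x * (cmod (h x) * cmod (f x)) \<le> r x * ((1/(2*d)) * (cmod (h x))\<^sup>2 + (d/2) * (cmod (f x))\<^sup>2)"
      using r_pos[of x] by (intro mult_left_mono) auto
    also have "\<dots> = (1/(2*d)) * (r x * (cmod (h x))\<^sup>2) + (d/2) * (r x * (cmod (f x))\<^sup>2)"
      by (simp add: algebra_simps)
    finally show ?thesis using r_pos[of x] by (simp add: norm_mult)
  qed
  have i: "integrable lebesgue (\<lambda>x. (1/(2*d)) * (r x * (cmod (h x))\<^sup>2) + (d/2) * (r x * (cmod (f x))\<^sup>2))" for d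
    using assms by (intro Bochner_Integration.integrable_add integrable_mult_right) (auto simp: in_L2_def)
  have [measurable]: "h \<in> borel_measurable lebesgue" "f \<in> borel_measurable lebesgue" "r \<in> borel_measurable lebesgue"
    using assms r_meas by (auto simp: in_L2_def)
  have cm: "(\<lambda>x. cnj (f x)) \<in> borel_measurable lebesgue"
    by (rule borel_measurable_continuous_on[OF continuous_on_cnj[OF continuous_on_id]]) measurable
  have m: "(\<lambda>x. of_real (r x) * h x * cnj (f x)) \<in> borel_measurable lebesgue"
    using cm by measurable
  show *: "integrable lebesgue (\<lambda>x. of_real (r x) * h x * cnj (f x))"
  proof (rule Bochner_Integration.integrable_bound[OF i[of 1] m], rule AE_I2)
    fix x
    show "cmod (of_real (r x) * h x * cnj (f x)) \<le> norm ((1/(2*1)) * (r x * (cmod (h x))\<^sup>2) + (1/2) * (r x * (cmod (f x))\<^sup>2))"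
      using bound[of 1 x] unfolding real_norm_def by (meson abs_ge_self order_trans zero_less_one)
  qed
  show "cmod (\<integral>x. of_real (r x) * h x * cnj (f x) \<partial>lebesgue) \<le> mass h / (2 * d) + d / 2 * mass f" if d: "d > 0"
  proof -
    have "cmod (\<integral>x. of_real (r x) * h x * cnj (f x) \<partial>lebesgue) \<le> (\<integral>x. cmod (of_real (r x) * h x * cnj (f x)) \<partial>lebesgue)"
      by (rule integral_norm_bound)
    also have "\<dots> \<le> (\<integral>x. (1/(2*d)) * (r x * (cmod (h x))\<^sup>2) + (d/2) * (r x * (cmod (f x))\<^sup>2) \<partial>lebesgue)"
      by (intro integral_mono integrable_norm * i bound d)
    also have "\<dots> = mass h / (2 * d) + d / 2 * mass f"
      using assms unfolding mass_def by (subst Bochner_Integration.integral_add) (auto simp: in_L2_def)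
    finally show ?thesis .
  qed
qed

lemma in_L2_add:
  assumes "in_L2 f" "in_L2 g" shows "in_L2 (\<lambda>x. a * f x + b * g x)"
  unfolding in_L2_def
proof
  have [measurable]: "f \<in> borel_measurable lebesgue" "g \<in> borel_measurable lebesgue" "r \<in> borel_measurable lebesgue"
    using assms r_meas by (auto simp: in_L2_def)
  show "(\<lambda>x. a * f x + b * g x) \<in> borel_measurable lebesgue" by measurable
  show "integrable lebesgue (\<lambda>x. r x * (cmod (a * f x + b * g x))\<^sup>2)"
  proof (rule Bochner_Integration.integrable_bound)
    show "integrable lebesgue (\<lambda>x. (2 * (cmod a)\<^sup>2) * (r x * (cmod (f x))\<^sup>2) + (2 * (cmod b)\<^sup>2) * (r x * (cmod (g x))\<^sup>2))"
      using assms by (intro Bochner_Integration.integrable_add integrable_mult_right) (auto simp: in_L2_def)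
    show "(\<lambda>x. r x * (cmod (a * f x + b * g x))\<^sup>2) \<in> borel_measurable lebesgue" by measurable
    show "AE x in lebesgue. norm (r x * (cmod (a * f x + b * g x))\<^sup>2) \<le> norm ((2 * (cmod a)\<^sup>2) * (r x * (cmod (f x))\<^sup>2) + (2 * (cmod b)\<^sup>2) * (r x * (cmod (g x))\<^sup>2))"
    proof (rule AE_I2)
      fix x
      have "(cmod (a * f x + b * g x))\<^sup>2 \<le> (cmod (a * f x) + cmod (b * g x))\<^sup>2"
        by (intro power_mono norm_triangle_ineq) simp
      also have "\<dots> \<le> 2 * (cmod (a * f x))\<^sup>2 + 2 * (cmod (b * g x))\<^sup>2"
        using sum_squares_bound[of "cmod (a * f x)" "cmod (b * g x)"] by (simp add: power2_sum)
      finally have "r x * (cmod (a * f x + b * g x))\<^sup>2 \<le> r x * (2 * (cmod (a * f x))\<^sup>2 + 2 * (cmod (b * g x))\<^sup>2)"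
        using r_pos[of x] by (intro mult_left_mono) auto
      also have "\<dots> = (2 * (cmod a)\<^sup>2) * (r x * (cmod (f x))\<^sup>2) + (2 * (cmod b)\<^sup>2) * (r x * (cmod (g x))\<^sup>2)"
        by (simp add: norm_mult power_mult_distrib algebra_simps)
      finally have le: "r x * (cmod (a * f x + b * g x))\<^sup>2 \<le> (2 * (cmod a)\<^sup>2) * (r x * (cmod (f x))\<^sup>2) + (2 * (cmod b)\<^sup>2) * (r x * (cmod (g x))\<^sup>2)" .
      have "0 \<le> r x * (cmod (a * f x + b * g x))\<^sup>2" using r_pos[of x] by simp
      then show "norm (r x * (cmod (a * f x + b * g x))\<^sup>2) \<le> norm ((2 * (cmod a)\<^sup>2) * (r x * (cmod (f x))\<^sup>2) + (2 * (cmod b)\<^sup>2) * (r x * (cmod (g x))\<^sup>2))"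
        unfolding real_norm_def using le by linarith
    qed
  qed
qed

lemma AC_deriv_conjugate_product:
  assumes "solves g u k" "AC_deriv f w"
  shows "AC_deriv (\<lambda>x. u x * cnj (f x)) (\<lambda>x. u x * cnj (w x) + (of_real (q x) * g x - of_real (r x) * k x) * cnj (f x))"
  using assms by (intro AC_deriv_mult AC_deriv_cnj) (auto simp: solves_def)

text \<open>
  An interval of length at least one is covered by two blocks of unit intervals, one from each
  end. The double covering is compensated by applying the estimate to \<open>4 |q|\<close>.
\<close>
lemma potential_interval_bound:
  assumes f: "AC_deriv f w" and w: "loc_int (\<lambda>x. (cmod (w x))\<^sup>2 / s x)" and xy: "x + 1 \<le> y"
  shows "(LINT t:{x..y}|lebesgue. \<bar>q t\<bar> * (cmod (f t))\<^sup>2)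
    \<le> (1/4) * (LINT t:{x..y}|lebesgue. (cmod (w t))\<^sup>2 / s t)
      + (2 * Q + 16 * P * Q\<^sup>2) * (LINT t:{x..y}|lebesgue. (cmod (f t))\<^sup>2)"
proof -
  define n where "n = nat \<lfloor>y - x\<rfloor>"
  have n: "real n \<le> y - x" "y - x \<le> 2 * real n"
  proof -
    have "1 \<le> \<lfloor>y - x\<rfloor>" using xy by (simp add: le_floor_iff)
    then have "real n = of_int \<lfloor>y - x\<rfloor>" "1 \<le> real n" by (auto simp: n_def)
    then show "real n \<le> y - x" "y - x \<le> 2 * real n" using floor_correct[of "y - x"] by linarith+
  qed
  have c: "continuous_on UNIV (\<lambda>t. (cmod (f t))\<^sup>2)" by (intro continuous_intros AC_deriv_continuous[OF f])
  have ql: "loc_int (\<lambda>t. \<bar>q t\<bar>)" using loc_int_norm[OF q_loc] by simp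
  have v: "loc_int (\<lambda>t. 4 * \<bar>q t\<bar>)" by (intro loc_int_cmult ql)
  have g: "loc_int (\<lambda>t. \<bar>q t\<bar> * (cmod (f t))\<^sup>2)" by (rule loc_int_mult_continuous[OF ql c])
  have w0: "0 \<le> (cmod (w t))\<^sup>2 / s t" for t using s_pos[of t] by simp
  have part: "(LINT t:{a..a + real n}|lebesgue. \<bar>q t\<bar> * (cmod (f t))\<^sup>2)
    \<le> (1/8) * (LINT t:{x..y}|lebesgue. (cmod (w t))\<^sup>2 / s t)
      + (Q + 8 * P * Q\<^sup>2) * (LINT t:{x..y}|lebesgue. (cmod (f t))\<^sup>2)" if a: "x \<le> a" "a + real n \<le> y" for a
  proof -
    have "(LINT t:{a + real k..a + real k + 1}|lebesgue. 4 * \<bar>q t\<bar>) \<le> 4 * Q" for k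
      using Q[of "a + real k"] by simp
    then have "(LINT t:{a..a + real n}|lebesgue. 4 * \<bar>q t\<bar> * (cmod (f t))\<^sup>2)
      \<le> (1/2) * (LINT t:{a..a + real n}|lebesgue. (cmod (w t))\<^sup>2 / s t)
      + (4 * Q + 2 * P * (4 * Q)\<^sup>2) * (LINT t:{a..a + real n}|lebesgue. (cmod (f t))\<^sup>2)"
      using Q_nonneg by (intro weighted_interval[OF f w v]) auto
    also have "\<dots> \<le> (1/2) * (LINT t:{x..y}|lebesgue. (cmod (w t))\<^sup>2 / s t)
      + (4 * Q + 2 * P * (4 * Q)\<^sup>2) * (LINT t:{x..y}|lebesgue. (cmod (f t))\<^sup>2)"
      using Q_nonneg P_pos a by (intro add_mono mult_left_mono lint_mono_interval w w0 loc_int_continuous[OF c]) auto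
    also have "(LINT t:{a..a + real n}|lebesgue. 4 * \<bar>q t\<bar> * (cmod (f t))\<^sup>2) = 4 * (LINT t:{a..a + real n}|lebesgue. \<bar>q t\<bar> * (cmod (f t))\<^sup>2)"
      by (simp add: mult.assoc)
    finally show ?thesis by (simp add: power2_eq_square algebra_simps)
  qed
  have "(LINT t:{x..y}|lebesgue. \<bar>q t\<bar> * (cmod (f t))\<^sup>2)
    = (LINT t:{x..x + real n}|lebesgue. \<bar>q t\<bar> * (cmod (f t))\<^sup>2) + (LINT t:{x + real n..y}|lebesgue. \<bar>q t\<bar> * (cmod (f t))\<^sup>2)"
    using n by (intro lint_combine loc_intD[OF g]) auto
  also have "(LINT t:{x + real n..y}|lebesgue. \<bar>q t\<bar> * (cmod (f t))\<^sup>2) \<le> (LINT t:{y - real n..y - real n + real n}|lebesgue. \<bar>q t\<bar> * (cmod (f t))\<^sup>2)"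
    by (rule lint_mono_interval[OF g]) (use n in auto)
  finally show ?thesis using part[of x] part[of "y - real n"] n by (simp add: algebra_simps)
qed

text \<open>
  The derivative of \<open>Re (u cnj f)\<close> is \<open>s |u|\<^sup>2 + q |f|\<^sup>2 - Re (r k cnj f)\<close>. The potential term
  costs a quarter of the energy and a multiple of \<open>\<integral> |f|\<^sup>2\<close>; the last term is integrable.
\<close>
lemma flux_growth:
  assumes d: "in_dom f u k"
  shows "\<exists>C. \<forall>x y. x + 1 \<le> y \<longrightarrow>
    Re (u y * cnj (f y)) - Re (u x * cnj (f x)) \<ge> (1/2) * (LINT t:{x..y}|lebesgue. s t * (cmod (u t))\<^sup>2) - C"
proof -
  define w where "w x = of_real (s x) * u x" for x
  have f: "AC_deriv f w" and u: "AC_deriv u (\<lambda>x. of_real (q x) * f x - of_real (r x) * k x)"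
    and fL: "in_L2 f" and kL: "in_L2 k" and sol: "solves f u k"
    using d by (auto simp: in_dom_def solves_def w_def[abs_def])
  have wu: "(cmod (w t))\<^sup>2 / s t = s t * (cmod (u t))\<^sup>2" for t
    using s_pos[of t] by (simp add: w_def norm_mult power2_eq_square)
  have lw: "loc_int (\<lambda>x. s x * (cmod (u x))\<^sup>2)"
    by (intro loc_int_mult_continuous s_loc continuous_intros AC_deriv_continuous[OF u])
  have c: "continuous_on UNIV (\<lambda>t. (cmod (f t))\<^sup>2)" by (intro continuous_intros AC_deriv_continuous[OF f])
  have f2: "integrable lebesgue (\<lambda>x. (cmod (f x))\<^sup>2)"
    using fL by (intro square_integrable AC_deriv_continuous[OF f]) (simp add: in_L2_def)
  have ql: "loc_int (\<lambda>t. \<bar>q t\<bar> * (cmod (f t))\<^sup>2)" using loc_int_norm[OF q_loc] by (intro loc_int_mult_continuous c) simp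
  define F where "F = (\<integral>x. (cmod (f x))\<^sup>2 \<partial>lebesgue)"
  define C where "C = (2 * Q + 16 * P * Q\<^sup>2) * F + (mass k + mass f)"
  have main: "Re (u y * cnj (f y)) - Re (u x * cnj (f x)) \<ge> (1/2) * (LINT t:{x..y}|lebesgue. s t * (cmod (u t))\<^sup>2) - C" if xy: "x + 1 \<le> y" for x y
  proof -
    let ?D = "\<lambda>x. Re (u x * cnj (w x) + (of_real (q x) * f x - of_real (r x) * k x) * cnj (f x))"
    have A: "AC_deriv (\<lambda>x. Re (u x * cnj (f x))) ?D"
      by (rule AC_deriv_bounded_linear[OF bounded_linear_Re AC_deriv_conjugate_product[OF sol f]])
    let ?L = "\<lambda>t. s t * (cmod (u t))\<^sup>2 - \<bar>q t\<bar> * (cmod (f t))\<^sup>2 - (r t * (cmod (k t))\<^sup>2 + r t * (cmod (f t))\<^sup>2)"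
    have ll: "loc_int (\<lambda>t. r t * (cmod (k t))\<^sup>2 + r t * (cmod (f t))\<^sup>2)"
      using fL kL by (intro loc_int_add loc_int_of_integrable) (auto simp: in_L2_def)
    have le: "?L t \<le> ?D t" for t
    proof -
      have 1: "Re (u t * cnj (w t)) = s t * (cmod (u t))\<^sup>2"
        unfolding cmod_power2 w_def by (simp add: power2_eq_square algebra_simps)
      have 2: "Re (of_real (q t) * f t * cnj (f t)) = q t * (cmod (f t))\<^sup>2"
        unfolding cmod_power2 by (simp add: power2_eq_square algebra_simps)
      have "\<bar>Re (k t * cnj (f t))\<bar> \<le> cmod (k t) * cmod (f t)"
        using abs_Re_le_cmod[of "k t * cnj (f t)"] by (simp add: norm_mult)
      also have "\<dots> \<le> (cmod (k t))\<^sup>2 + (cmod (f t))\<^sup>2"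
        using sum_squares_bound[of "cmod (k t)" "cmod (f t)"] zero_le_power2[of "cmod (k t)"] zero_le_power2[of "cmod (f t)"] by linarith
      finally have "r t * \<bar>Re (k t * cnj (f t))\<bar> \<le> r t * ((cmod (k t))\<^sup>2 + (cmod (f t))\<^sup>2)"
        using r_pos[of t] by (intro mult_left_mono) auto
      moreover have "Re (of_real (r t) * k t * cnj (f t)) = r t * Re (k t * cnj (f t))" by (simp add: algebra_simps)
      moreover have "r t * Re (k t * cnj (f t)) \<le> r t * \<bar>Re (k t * cnj (f t))\<bar>"
        using r_pos[of t] by (intro mult_left_mono) auto
      ultimately have 3: "Re (of_real (r t) * k t * cnj (f t)) \<le> r t * (cmod (k t))\<^sup>2 + r t * (cmod (f t))\<^sup>2"
        by (simp add: distrib_left)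
      have 4: "- (\<bar>q t\<bar> * (cmod (f t))\<^sup>2) \<le> q t * (cmod (f t))\<^sup>2"
        using mult_right_mono[of "- \<bar>q t\<bar>" "q t" "(cmod (f t))\<^sup>2"] by simp
      have "?D t = Re (u t * cnj (w t)) + Re (of_real (q t) * f t * cnj (f t)) - Re (of_real (r t) * k t * cnj (f t))"
        by (simp only: left_diff_distrib plus_complex.sel minus_complex.sel add_diff_eq)
      then show ?thesis using 1 2 3 4 by linarith
    qed
    have "(LINT t:{x..y}|lebesgue. s t * (cmod (u t))\<^sup>2) - (LINT t:{x..y}|lebesgue. \<bar>q t\<bar> * (cmod (f t))\<^sup>2)
        - (LINT t:{x..y}|lebesgue. r t * (cmod (k t))\<^sup>2 + r t * (cmod (f t))\<^sup>2) = (LINT t:{x..y}|lebesgue. ?L t)"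
      by (simp add: set_integral_diff loc_intD lw ql ll)
    also have "\<dots> \<le> (LINT t:{x..y}|lebesgue. ?D t)"
      by (rule set_integral_mono) (intro set_integral_diff loc_intD lw ql ll AC_deriv_loc_int[OF A] le)+
    also have "\<dots> = Re (u y * cnj (f y)) - Re (u x * cnj (f x))"
      using xy by (intro AC_deriv_diff_eq[OF A, symmetric]) simp
    finally have 1: "(LINT t:{x..y}|lebesgue. s t * (cmod (u t))\<^sup>2) - (LINT t:{x..y}|lebesgue. \<bar>q t\<bar> * (cmod (f t))\<^sup>2)
        - (LINT t:{x..y}|lebesgue. r t * (cmod (k t))\<^sup>2 + r t * (cmod (f t))\<^sup>2) \<le> Re (u y * cnj (f y)) - Re (u x * cnj (f x))" .
    have "(LINT t:{x..y}|lebesgue. r t * (cmod (k t))\<^sup>2 + r t * (cmod (f t))\<^sup>2) \<le> (\<integral>t. r t * (cmod (k t))\<^sup>2 + r t * (cmod (f t))\<^sup>2 \<partial>lebesgue)"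
      using fL kL r_pos by (intro lint_le_integral) (auto simp: in_L2_def less_imp_le intro!: add_nonneg_nonneg)
    also have "\<dots> = mass k + mass f"
      using fL kL unfolding mass_def by (intro Bochner_Integration.integral_add) (auto simp: in_L2_def)
    finally have 2: "(LINT t:{x..y}|lebesgue. r t * (cmod (k t))\<^sup>2 + r t * (cmod (f t))\<^sup>2) \<le> mass k + mass f" .
    have "(LINT t:{x..y}|lebesgue. \<bar>q t\<bar> * (cmod (f t))\<^sup>2) \<le> (1/4) * (LINT t:{x..y}|lebesgue. s t * (cmod (u t))\<^sup>2)
      + (2 * Q + 16 * P * Q\<^sup>2) * (LINT t:{x..y}|lebesgue. (cmod (f t))\<^sup>2)"
      using potential_interval_bound[OF f _ xy] lw unfolding wu by blast
    also have "(LINT t:{x..y}|lebesgue. (cmod (f t))\<^sup>2) \<le> F"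
      unfolding F_def by (rule lint_le_integral[OF f2]) simp
    finally have 3: "(LINT t:{x..y}|lebesgue. \<bar>q t\<bar> * (cmod (f t))\<^sup>2) \<le> (1/4) * (LINT t:{x..y}|lebesgue. s t * (cmod (u t))\<^sup>2)
      + (2 * Q + 16 * P * Q\<^sup>2) * F" using Q_nonneg P_pos by (simp add: mult_left_mono)
    have "0 \<le> (LINT t:{x..y}|lebesgue. s t * (cmod (u t))\<^sup>2)"
      using s_pos by (intro lint_nonneg) (simp add: less_imp_le)
    with 1 2 3 show ?thesis unfolding C_def by linarith
  qed
  then show ?thesis by blast
qed

text \<open>
  If the energy were infinite at the right end, the flux \<open>Re (u cnj f)\<close> would be positive from
  some point on. It is, up to the factor \<open>2 s > 0\<close>, the derivative of \<open>|f|\<^sup>2\<close>, so \<open>|f|\<^sup>2\<close> would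
  be increasing from there and not integrable. At the left end the signs are reversed.
\<close>
lemma in_dom_in_form:
  assumes d: "in_dom f u k"
  shows "in_form f (\<lambda>x. of_real (s x) * u x)"
proof -
  have f: "AC_deriv f (\<lambda>x. of_real (s x) * u x)" and u: "AC_deriv u (\<lambda>x. of_real (q x) * f x - of_real (r x) * k x)"
    and fL: "in_L2 f"
    using d by (auto simp: in_dom_def solves_def)
  let ?H = "\<lambda>x y. LINT t:{x..y}|lebesgue. s t * (cmod (u t))\<^sup>2"
  let ?J = "\<lambda>x. Re (u x * cnj (f x))"
  have lw: "loc_int (\<lambda>x. s x * (cmod (u x))\<^sup>2)"
    by (intro loc_int_mult_continuous s_loc continuous_intros AC_deriv_continuous[OF u])
  have su0: "0 \<le> s x * (cmod (u x))\<^sup>2" for x using s_pos[of x] by simp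
  have f2: "integrable lebesgue (\<lambda>x. (cmod (f x))\<^sup>2)"
    using fL by (intro square_integrable AC_deriv_continuous[OF f]) (simp add: in_L2_def)
  note small = square_small_somewhere[OF AC_deriv_continuous[OF f] f2]
  obtain C where C: "\<And>x y. x + 1 \<le> y \<Longrightarrow> ?J y - ?J x \<ge> (1/2) * ?H x y - C"
    using flux_growth[OF d] by blast
  have sq: "(cmod (f y))\<^sup>2 - (cmod (f x))\<^sup>2 = (LINT t:{x..y}|lebesgue. 2 * (s t * ?J t))" if "x \<le> y" for x y
  proof -
    have "2 * Re (of_real (s t) * u t * cnj (f t)) = 2 * (s t * ?J t)" for t
      by (simp add: algebra_simps)
    then show ?thesis using AC_deriv_diff_eq[OF AC_deriv_norm_square[OF f] that] by (simp only:)
  qed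
  have nz: "f x \<noteq> 0" if "\<bar>?J x\<bar> \<ge> 1" for x using that by auto
  define B where "B = 2 * (C + \<bar>?J 0\<bar> + 1)"
  have right: "?H 0 y \<le> B" if y: "y \<ge> 1" for y
  proof (rule ccontr)
    assume nb: "\<not> ?H 0 y \<le> B"
    have J: "?J t \<ge> 1" if "t \<ge> y" for t
    proof -
      have "?H 0 y \<le> ?H 0 t" using that by (intro lint_mono_interval lw su0) auto
      moreover have "?J t - ?J 0 \<ge> (1/2) * ?H 0 t - C" using that y by (intro C) simp
      moreover have "\<bar>?J 0\<bar> \<ge> - ?J 0" by simp
      ultimately show ?thesis using nb unfolding B_def not_le by argo
    qed
    have "(cmod (f t))\<^sup>2 \<ge> (cmod (f y))\<^sup>2" if t: "t \<ge> y" for t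
    proof -
      have "0 \<le> (LINT t:{y..t}|lebesgue. 2 * (s t * ?J t))"
      proof (rule lint_nonneg)
        fix z assume "z \<in> {y..t}"
        then show "0 \<le> 2 * (s z * ?J z)" using J[of z] s_pos[of z] by simp
      qed
      then show ?thesis using sq[OF t] by linarith
    qed
    moreover have "(cmod (f y))\<^sup>2 > 0" using nz[of y] J[of y] by simp
    ultimately show False using small(1)[of "(cmod (f y))\<^sup>2" y] by (meson not_less)
  qed
  have left: "?H (-y) 0 \<le> B" if y: "y \<ge> 1" for y
  proof (rule ccontr)
    assume nb: "\<not> ?H (-y) 0 \<le> B"
    have J: "?J t \<le> - 1" if "t \<le> -y" for t
    proof -
      have "?H (-y) 0 \<le> ?H t 0" using that by (intro lint_mono_interval lw su0) auto
      moreover have "?J 0 - ?J t \<ge> (1/2) * ?H t 0 - C" using that y by (intro C) simp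
      moreover have "\<bar>?J 0\<bar> \<ge> ?J 0" by simp
      ultimately show ?thesis using nb unfolding B_def not_le by argo
    qed
    have "(cmod (f t))\<^sup>2 \<ge> (cmod (f (-y)))\<^sup>2" if t: "t \<le> -y" for t
    proof -
      have "0 \<le> (LINT t:{t..-y}|lebesgue. - (2 * (s t * ?J t)))"
      proof (rule lint_nonneg)
        fix z assume "z \<in> {t..-y}"
        then have "s z * ?J z \<le> 0" using J[of z] s_pos[of z] by (intro mult_nonneg_nonpos) auto
        then show "0 \<le> - (2 * (s z * ?J z))" by simp
      qed
      also have "\<dots> = - (LINT t:{t..-y}|lebesgue. 2 * (s t * ?J t))"
        unfolding set_lebesgue_integral_def by simp
      finally show ?thesis using sq[OF t] by linarith
    qed
    moreover have "(cmod (f (-y)))\<^sup>2 > 0" using nz[of "-y"] J[of "-y"] by simp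
    ultimately show False using small(2)[of "(cmod (f (-y)))\<^sup>2" "-y"] by (meson not_less)
  qed
  have "?H (-real n) (real n) \<le> 2 * B" for n :: nat
  proof -
    have "?H (-real n) (real n) \<le> ?H (-real (Suc n)) (real (Suc n))" by (intro lint_mono_interval lw su0) auto
    also have "\<dots> = ?H (-real (Suc n)) 0 + ?H 0 (real (Suc n))" by (intro lint_combine loc_intD lw) auto
    also have "\<dots> \<le> 2 * B" using right[of "real (Suc n)"] left[of "real (Suc n)"] by simp
    finally show ?thesis .
  qed
  from nonneg_exhaustion(1)[OF lw su0 this] have i: "integrable lebesgue (\<lambda>x. s x * (cmod (u x))\<^sup>2)" .
  have "(cmod (of_real (s t) * u t))\<^sup>2 / s t = s t * (cmod (u t))\<^sup>2" for t
    using s_pos[of t] by (simp add: norm_mult power2_eq_square)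
  then show ?thesis using f i fL by (simp add: in_form_def in_L2_def)
qed

text \<open>
  Suppose \<open>|u f| \<ge> l\<close> on a ray, with \<open>S\<close> the supremum of \<open>|f|\<close> there. Then
  \<open>|w| \<le> |u| |w| |f| / l \<le> (S/l) |u w|\<close>, and far out the integral of \<open>|u w|\<close> is at most \<open>l/2\<close>.
  As \<open>f\<close> becomes arbitrarily small somewhere beyond every point, it follows that \<open>S \<le> S/2\<close>, so
  \<open>f = 0\<close> on the ray, a contradiction.
\<close>
lemma boundary_term_small:
  assumes fw: "in_form f w" and u: "integrable lebesgue (\<lambda>x. cmod (u x) * cmod (w x))" and l: "l > 0"
  shows "\<exists>y\<ge>Y. cmod (u y) * cmod (f y) < l" "\<exists>y\<le>Y. cmod (u y) * cmod (f y) < l"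
proof -
  note f = in_formD[OF fw]
  let ?g = "\<lambda>t. cmod (u t) * cmod (w t)"
  obtain n :: nat where tail: "\<And>y. y \<ge> real n \<Longrightarrow> (LINT t:{real n..y}|lebesgue. ?g t) \<le> l/2"
    "\<And>y. y \<le> -real n \<Longrightarrow> (LINT t:{y..-real n}|lebesgue. ?g t) \<le> l/2"
    using tail_small[OF u, of "l/2"] l by auto
  have lg: "loc_int ?g" by (rule loc_int_of_integrable[OF u])
  obtain B where B: "\<And>x. cmod (f x) \<le> B"
  proof -
    have "(cmod (f x))\<^sup>2 \<le> 1 * energy w + (P / 1) * (\<integral>x. (cmod (f x))\<^sup>2 \<partial>lebesgue)" for x
      by (rule pointwise_bound[OF fw]) simp
    then have "cmod (f x) \<le> sqrt (1 * energy w + (P / 1) * (\<integral>x. (cmod (f x))\<^sup>2 \<partial>lebesgue))" for x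
      by (rule real_le_rsqrt)
    then show ?thesis using that by blast
  qed
  (* The case of two points \<open>a\<close>, \<open>b\<close> in arbitrary order serves both ends of the line. *)
  have step: "cmod (f a) \<le> cmod (f b) + S / 2"
    if big: "\<And>t. t \<in> {min a b..max a b} \<Longrightarrow> l \<le> cmod (u t) * cmod (f t)"
      and S: "\<And>t. t \<in> {min a b..max a b} \<Longrightarrow> cmod (f t) \<le> S" and int: "(LINT t:{min a b..max a b}|lebesgue. ?g t) \<le> l/2" for a b S
  proof -
    let ?I = "{min a b..max a b}"
    have "cmod (f a) \<le> S" by (rule S) simp
    then have S0: "S \<ge> 0" by (meson norm_ge_zero order_trans)
    have lw: "loc_int (\<lambda>t. cmod (w t))" using loc_int_norm[OF AC_deriv_loc_int[OF f(1)]] .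
    have "cmod (f (max a b) - f (min a b)) \<le> (LINT t:?I|lebesgue. cmod (w t))"
      by (subst AC_deriv_diff_eq[OF f(1)]) (simp_all add: norm_lint_le loc_intD[OF AC_deriv_loc_int[OF f(1)]])
    then have "cmod (f a - f b) \<le> (LINT t:?I|lebesgue. cmod (w t))"
      by (cases "a \<le> b") (simp_all add: norm_minus_commute)
    also have "\<dots> \<le> (LINT t:?I|lebesgue. (S / l) * ?g t)"
    proof (rule set_integral_mono)
      fix t assume t: "t \<in> ?I"
      have "l * cmod (w t) \<le> (cmod (u t) * cmod (f t)) * cmod (w t)" by (intro mult_right_mono big t) simp
      also have "\<dots> \<le> (cmod (u t) * S) * cmod (w t)" by (intro mult_right_mono mult_left_mono S t) auto
      finally show "cmod (w t) \<le> (S / l) * ?g t" using l by (simp add: field_simps)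
    qed (intro loc_intD lw loc_int_cmult lg)+
    also have "\<dots> = (S / l) * (LINT t:?I|lebesgue. ?g t)" by (rule set_integral_mult_right)
    also have "\<dots> \<le> (S / l) * (l / 2)" using S0 l by (intro mult_left_mono int) auto
    also have "\<dots> = S / 2" using l by simp
    finally show ?thesis using norm_triangle_ineq2[of "f a" "f b"] by linarith
  qed
  have nz: "cmod (f t) > 0" if "l \<le> cmod (u t) * cmod (f t)" for t using that l by auto
  have no_ray: False
    if Z: "Z \<in> I" and big: "\<And>t. t \<in> I \<Longrightarrow> l \<le> cmod (u t) * cmod (f t)"
      and near: "\<And>a e. a \<in> I \<Longrightarrow> e > 0 \<Longrightarrow> \<exists>b. {min a b..max a b} \<subseteq> I \<and> (cmod (f b))\<^sup>2 < e \<and>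
        (LINT t:{min a b..max a b}|lebesgue. ?g t) \<le> l/2" for I Z
  proof -
    define S where "S = (SUP t\<in>I. cmod (f t))"
    have bdd: "bdd_above ((\<lambda>t. cmod (f t)) ` I)" using B by (intro bdd_aboveI[of _ B]) auto
    have S: "cmod (f t) \<le> S" if "t \<in> I" for t unfolding S_def using that bdd by (intro cSUP_upper)
    have "cmod (f a) \<le> S / 2" if a: "a \<in> I" for a
    proof (rule field_le_epsilon)
      fix e :: real assume e: "e > 0"
      then have "e\<^sup>2 > 0" by simp
      from near[OF a this] obtain b where b: "{min a b..max a b} \<subseteq> I" "(cmod (f b))\<^sup>2 < e\<^sup>2"
        "(LINT t:{min a b..max a b}|lebesgue. ?g t) \<le> l/2" by blast
      have "cmod (f b) < e" by (rule power2_less_imp_less[OF b(2)]) (use e in simp)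
      moreover have "cmod (f a) \<le> cmod (f b) + S / 2"
        by (rule step[OF _ _ b(3)]) (use b(1) in \<open>auto intro: big S\<close>)
      ultimately show "cmod (f a) \<le> S / 2 + e" by simp
    qed
    then have "S \<le> S / 2" unfolding S_def using Z by (intro cSUP_least) auto
    then have "S \<le> 0" by simp
    then show False using S[OF Z] nz[OF big[OF Z]] by linarith
  qed
  note small = square_small_somewhere[OF f(5,4)]
  show "\<exists>y\<ge>Y. cmod (u y) * cmod (f y) < l"
  proof (rule ccontr)
    assume no: "\<not> ?thesis"
    define Z where "Z = max Y (real n)"
    show False
    proof (rule no_ray[of Z "{Z..}"])
      show "l \<le> cmod (u t) * cmod (f t)" if "t \<in> {Z..}" for t using no that by (auto simp: Z_def not_less)
      fix a e :: real assume a: "a \<in> {Z..}" and "e > 0"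
      then obtain b where b: "b \<ge> a" "(cmod (f b))\<^sup>2 < e" using small(1) by blast
      have "(LINT t:{a..b}|lebesgue. ?g t) \<le> (LINT t:{real n..b}|lebesgue. ?g t)"
        using a by (intro lint_mono_interval lg) (auto simp: Z_def)
      also have "\<dots> \<le> l/2" using a b by (intro tail) (auto simp: Z_def)
      finally show "\<exists>b. {min a b..max a b} \<subseteq> {Z..} \<and> (cmod (f b))\<^sup>2 < e \<and> (LINT t:{min a b..max a b}|lebesgue. ?g t) \<le> l/2"
        using a b by (intro exI[of _ b]) auto
    qed simp
  qed
  show "\<exists>y\<le>Y. cmod (u y) * cmod (f y) < l"
  proof (rule ccontr)
    assume no: "\<not> ?thesis"
    define Z where "Z = min Y (-real n)"
    show False
    proof (rule no_ray[of Z "{..Z}"])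
      show "l \<le> cmod (u t) * cmod (f t)" if "t \<in> {..Z}" for t using no that by (auto simp: Z_def not_less)
      fix a e :: real assume a: "a \<in> {..Z}" and "e > 0"
      then obtain b where b: "b \<le> a" "(cmod (f b))\<^sup>2 < e" using small(2) by blast
      have "(LINT t:{b..a}|lebesgue. ?g t) \<le> (LINT t:{b..-real n}|lebesgue. ?g t)"
        using a by (intro lint_mono_interval lg) (auto simp: Z_def)
      also have "\<dots> \<le> l/2" using a b by (intro tail) (auto simp: Z_def)
      finally show "\<exists>b. {min a b..max a b} \<subseteq> {..Z} \<and> (cmod (f b))\<^sup>2 < e \<and> (LINT t:{min a b..max a b}|lebesgue. ?g t) \<le> l/2"
        using a b by (intro exI[of _ b]) auto
    qed simp
  qed
qed

end

section \<open>Green's identity and coercivity\<close>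

lemma borel_measurable_cnj:
  "f \<in> borel_measurable M \<Longrightarrow> (\<lambda>x. cnj (f x)) \<in> borel_measurable M"
  by (rule borel_measurable_continuous_on[OF continuous_on_cnj[OF continuous_on_id]])

context sturm_liouville
begin

lemma form_product:
  assumes gu: "in_form g (\<lambda>x. of_real (s x) * u x)" and um: "continuous_on UNIV u" and fw: "in_form f w"
  shows "integrable lebesgue (\<lambda>x. u x * cnj (w x))" "integrable lebesgue (\<lambda>x. of_real (q x) * g x * cnj (f x))"
    "integrable lebesgue (\<lambda>x. cmod (u x) * cmod (w x))"
proof -
  note f = in_formD[OF fw] and g = in_formD[OF gu]
  have wu: "(cmod (of_real (s t) * u t))\<^sup>2 / s t = s t * (cmod (u t))\<^sup>2" for t
    using s_pos[of t] by (simp add: norm_mult power2_eq_square)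
  have um': "u \<in> borel_measurable lebesgue" by (rule continuous_measurable[OF um])
  have wm: "w \<in> borel_measurable lebesgue" by (rule loc_int_measurable[OF AC_deriv_loc_int[OF f(1)]])
  have fm: "f \<in> borel_measurable lebesgue" "g \<in> borel_measurable lebesgue" by (rule continuous_measurable[OF f(5)], rule continuous_measurable[OF g(5)])
  have i1: "integrable lebesgue (\<lambda>x. s x * (cmod (u x))\<^sup>2 + (cmod (w x))\<^sup>2 / s x)"
    using f(2) g(2) unfolding wu by (rule Bochner_Integration.integrable_add[rotated])
  have le1: "cmod (u x) * cmod (w x) \<le> s x * (cmod (u x))\<^sup>2 + (cmod (w x))\<^sup>2 / s x" for x
  proof -
    have "0 \<le> (s x * cmod (u x) - cmod (w x))\<^sup>2 / s x" using s_pos[of x] by simp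
    also have "\<dots> = s x * (cmod (u x))\<^sup>2 + (cmod (w x))\<^sup>2 / s x - 2 * (cmod (u x) * cmod (w x))"
      using s_pos[of x] by (simp add: field_simps power2_eq_square)
    finally have "2 * (cmod (u x) * cmod (w x)) \<le> s x * (cmod (u x))\<^sup>2 + (cmod (w x))\<^sup>2 / s x" by simp
    moreover have "0 \<le> cmod (u x) * cmod (w x)" by simp
    ultimately show ?thesis by linarith
  qed
  show 1: "integrable lebesgue (\<lambda>x. u x * cnj (w x))"
  proof (rule Bochner_Integration.integrable_bound[OF i1])
    show "AE x in lebesgue. norm (u x * cnj (w x)) \<le> norm (s x * (cmod (u x))\<^sup>2 + (cmod (w x))\<^sup>2 / s x)"
      using le1 by (intro AE_I2) (simp add: norm_mult abs_of_nonneg order_trans[OF _ le1])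
  qed (intro borel_measurable_times um' borel_measurable_cnj wm)
  then show "integrable lebesgue (\<lambda>x. cmod (u x) * cmod (w x))"
    using integrable_norm[OF 1] by (simp add: norm_mult)
  have i2: "integrable lebesgue (\<lambda>x. \<bar>q x\<bar> * (cmod (g x))\<^sup>2 + \<bar>q x\<bar> * (cmod (f x))\<^sup>2)"
    by (intro Bochner_Integration.integrable_add q_integrable(1)[OF gu] q_integrable(1)[OF fw])
  show "integrable lebesgue (\<lambda>x. of_real (q x) * g x * cnj (f x))"
  proof (rule Bochner_Integration.integrable_bound[OF i2])
    show "AE x in lebesgue. norm (of_real (q x) * g x * cnj (f x)) \<le> norm (\<bar>q x\<bar> * (cmod (g x))\<^sup>2 + \<bar>q x\<bar> * (cmod (f x))\<^sup>2)"
    proof (rule AE_I2)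
      fix x
      have "cmod (g x) * cmod (f x) \<le> (cmod (g x))\<^sup>2 + (cmod (f x))\<^sup>2"
        using sum_squares_bound[of "cmod (g x)" "cmod (f x)"] zero_le_power2[of "cmod (g x)"] zero_le_power2[of "cmod (f x)"] by linarith
      then have "\<bar>q x\<bar> * (cmod (g x) * cmod (f x)) \<le> \<bar>q x\<bar> * ((cmod (g x))\<^sup>2 + (cmod (f x))\<^sup>2)"
        by (intro mult_left_mono) auto
      then show "norm (of_real (q x) * g x * cnj (f x)) \<le> norm (\<bar>q x\<bar> * (cmod (g x))\<^sup>2 + \<bar>q x\<bar> * (cmod (f x))\<^sup>2)"
        by (simp add: norm_mult distrib_left mult.assoc)
    qed
    show "(\<lambda>x. of_real (q x) * g x * cnj (f x)) \<in> borel_measurable lebesgue"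
      by (intro borel_measurable_times borel_measurable_cnj fm loc_int_measurable[OF loc_int_of_real[OF q_loc]])
  qed
qed

lemma in_form_L2: "in_form f w \<Longrightarrow> in_L2 f"
  using in_formD(3,5) by (auto simp: in_L2_def intro: continuous_measurable)

text \<open>
  The derivative of \<open>u cnj f\<close> is integrable over the line, and \<open>u cnj f\<close> tends to zero along a
  sequence of points at each end.
\<close>
theorem green:
  assumes g: "in_dom g u k" and fw: "in_form f w"
  shows "(\<integral>x. of_real (r x) * k x * cnj (f x) \<partial>lebesgue) =
    (\<integral>x. u x * cnj (w x) \<partial>lebesgue) + (\<integral>x. of_real (q x) * g x * cnj (f x) \<partial>lebesgue)"
proof -
  have sol: "solves g u k" and kL: "in_L2 k" using g by (auto simp: in_dom_def)
  have um: "continuous_on UNIV u" using sol by (auto simp: solves_def intro: AC_deriv_continuous)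
  note f = in_formD[OF fw]
  note fp = form_product[OF in_dom_in_form[OF g] um fw]
  note rk = L2_product(1)[OF kL in_form_L2[OF fw]]
  let ?d = "\<lambda>x. u x * cnj (w x) + (of_real (q x) * g x - of_real (r x) * k x) * cnj (f x)"
  have d: "?d = (\<lambda>x. u x * cnj (w x) + of_real (q x) * g x * cnj (f x) - of_real (r x) * k x * cnj (f x))"
    by (simp add: algebra_simps)
  have di: "integrable lebesgue ?d"
    unfolding d by (intro Bochner_Integration.integrable_diff Bochner_Integration.integrable_add fp rk)
  have A: "AC_deriv (\<lambda>x. u x * cnj (f x)) ?d" by (rule AC_deriv_conjugate_product[OF sol f(1)])
  have "\<forall>n. \<exists>y\<ge>real n. cmod (u y) * cmod (f y) < inverse (real (Suc n))"
    by (intro allI boundary_term_small(1)[OF fw fp(3)]) simp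
  then obtain y where y: "\<And>n. real n \<le> y n" "\<And>n. cmod (u (y n)) * cmod (f (y n)) < inverse (real (Suc n))" by metis
  have "\<forall>n. \<exists>y\<le>-real n. cmod (u y) * cmod (f y) < inverse (real (Suc n))"
    by (intro allI boundary_term_small(2)[OF fw fp(3)]) simp
  then obtain x where x: "\<And>n. x n \<le> - real n" "\<And>n. cmod (u (x n)) * cmod (f (x n)) < inverse (real (Suc n))" by metis
  have lim0: "(\<lambda>n. u (z n) * cnj (f (z n))) \<longlonglongrightarrow> 0" if "\<And>n. cmod (u (z n)) * cmod (f (z n)) < inverse (real (Suc n))" for z
  proof (rule tendsto_norm_zero_cancel, rule tendsto_sandwich[OF _ _ tendsto_const LIMSEQ_inverse_real_of_nat])
    show "\<forall>\<^sub>F n in sequentially. norm (u (z n) * cnj (f (z n))) \<le> inverse (real (Suc n))"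
      using that by (intro always_eventually allI less_imp_le) (simp only: norm_mult complex_mod_cnj)
  qed simp
  have "(\<lambda>n. u (y n) * cnj (f (y n)) - u (x n) * cnj (f (x n))) \<longlonglongrightarrow> 0 - 0"
    by (intro tendsto_diff lim0 x y)
  moreover have "u (y n) * cnj (f (y n)) - u (x n) * cnj (f (x n)) = (LINT t:{x n..y n}|lebesgue. ?d t)" for n
    by (rule AC_deriv_diff_eq[OF A]) (use x(1)[of n] y(1)[of n] in linarith)
  moreover have "(\<lambda>n. LINT t:{x n..y n}|lebesgue. ?d t) \<longlonglongrightarrow> (\<integral>t. ?d t \<partial>lebesgue)"
    by (rule lint_exhaust[OF di x(1) y(1)])
  ultimately have "(\<integral>t. ?d t \<partial>lebesgue) = 0" using LIMSEQ_unique by fastforce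
  moreover have "(\<integral>t. ?d t \<partial>lebesgue) = (\<integral>x. u x * cnj (w x) \<partial>lebesgue) + (\<integral>x. of_real (q x) * g x * cnj (f x) \<partial>lebesgue)
     - (\<integral>x. of_real (r x) * k x * cnj (f x) \<partial>lebesgue)"
    unfolding d using fp rk by simp
  ultimately show ?thesis by simp
qed

lemma green_self:
  assumes g: "in_dom f u k"
  shows "(\<integral>x. of_real (r x) * k x * cnj (f x) \<partial>lebesgue) = of_real (tform f (\<lambda>x. of_real (s x) * u x))"
proof -
  have "u x * cnj (of_real (s x) * u x) = of_real ((cmod (of_real (s x) * u x))\<^sup>2 / s x)" for x
  proof -
    have "u x * cnj (of_real (s x) * u x) = of_real (s x) * (u x * cnj (u x))" by simp
    also have "\<dots> = of_real (s x * (cmod (u x))\<^sup>2)" by (simp only: complex_norm_square of_real_mult)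
    also have "s x * (cmod (u x))\<^sup>2 = (cmod (of_real (s x) * u x))\<^sup>2 / s x"
      using s_pos[of x] by (simp add: norm_mult power2_eq_square)
    finally show ?thesis .
  qed
  then have 1: "(\<integral>x. u x * cnj (of_real (s x) * u x) \<partial>lebesgue) = of_real (energy (\<lambda>x. of_real (s x) * u x))"
    unfolding energy_def by (simp only: integral_complex_of_real)
  have "of_real (q x) * f x * cnj (f x) = complex_of_real (q x * (cmod (f x))\<^sup>2)" for x
    by (simp only: complex_norm_square of_real_mult mult.assoc)
  then have 2: "(\<integral>x. of_real (q x) * f x * cnj (f x) \<partial>lebesgue) = of_real (\<integral>x. q x * (cmod (f x))\<^sup>2 \<partial>lebesgue)"
    by (simp only: integral_complex_of_real)
  show ?thesis unfolding green[OF g in_dom_in_form[OF g]] 1 2 tform_def by simp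
qed

lemma mass_complex:
  "(\<integral>x. of_real (r x) * f x * cnj (f x) \<partial>lebesgue) = of_real (mass f)"
proof -
  have "of_real (r x) * f x * cnj (f x) = complex_of_real (r x * (cmod (f x))\<^sup>2)" for x
    by (simp only: complex_norm_square of_real_mult mult.assoc)
  then show ?thesis unfolding mass_def by (simp only: integral_complex_of_real)
qed

text \<open>
  The points outside the half-line \<open>[m, \<infinity>)\<close>.
\<close>
definition off_axis :: "real \<Rightarrow> complex \<Rightarrow> bool" where
  "off_axis m z \<longleftrightarrow> Im z \<noteq> 0 \<or> Re z < m"

text \<open>
  A positive lower bound for the distance from \<open>z\<close> to the half-line \<open>[m, \<infinity>)\<close>.
\<close>
definition gap :: "real \<Rightarrow> complex \<Rightarrow> real" where
  "gap m z = (if Im z \<noteq> 0 then \<bar>Im z\<bar> else m - Re z)"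

lemma gap_pos: "off_axis m z \<Longrightarrow> gap m z > 0"
  by (auto simp: off_axis_def gap_def)

lemma gap_bound:
  assumes "m * F \<le> t" "F \<ge> 0" "off_axis m z"
  shows "gap m z * F \<le> cmod (of_real t - z * of_real F)"
proof (cases "Im z = 0")
  case False
  then have "gap m z * F = \<bar>Im (of_real t - z * of_real F)\<bar>" using assms by (simp add: gap_def abs_mult)
  then show ?thesis using abs_Im_le_cmod[of "of_real t - z * of_real F"] by simp
next
  case True
  then have "gap m z * F \<le> \<bar>Re (of_real t - z * of_real F)\<bar>" using assms by (simp add: gap_def algebra_simps)
  then show ?thesis using abs_Re_le_cmod[of "of_real t - z * of_real F"] by simp
qed

lemma mass_bound:
  assumes "in_L2 h" "in_L2 f" "d > 0" "d * mass f \<le> cmod (\<integral>x. of_real (r x) * h x * cnj (f x) \<partial>lebesgue)"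
  shows "mass f \<le> mass h / d\<^sup>2"
proof -
  have "d * mass f \<le> mass h / (2 * d) + d / 2 * mass f"
    using L2_product(2)[OF assms(1-3)] assms(4) by linarith
  then have "d / 2 * mass f \<le> mass h / (2 * d)" by simp
  then have "d * mass f \<le> mass h / d" using assms(3) by (simp add: field_simps)
  then show ?thesis using assms(3) by (simp add: pos_le_divide_eq power2_eq_square mult_ac)
qed

text \<open>
  By Green's identity the inner product of \<open>(T - z) f\<close> and \<open>f\<close> is \<open>S[f] - z mass f\<close>. It is at
  least \<open>gap m z * mass f\<close> in modulus, since \<open>S[f] / mass f\<close> lies in \<open>[m, \<infinity>)\<close>.
\<close>
lemma coercive:
  assumes d: "in_dom f u k" and z: "off_axis m z" and m: "\<And>f w. in_form f w \<Longrightarrow> m * mass f \<le> tform f w"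
  shows "mass f \<le> mass (\<lambda>x. k x - z * f x) / (gap m z)\<^sup>2"
proof -
  have L: "in_L2 f" "in_L2 k" using d by (auto simp: in_dom_def)
  have h: "in_L2 (\<lambda>x. k x - z * f x)" using in_L2_add[OF L(2,1), of 1 "-z"] by simp
  have "(\<integral>x. of_real (r x) * (k x - z * f x) * cnj (f x) \<partial>lebesgue)
    = (\<integral>x. of_real (r x) * k x * cnj (f x) - z * (of_real (r x) * f x * cnj (f x)) \<partial>lebesgue)"
    by (simp add: algebra_simps)
  also have "\<dots> = of_real (tform f (\<lambda>x. of_real (s x) * u x)) - z * of_real (mass f)"
    using L2_product(1)[OF L(2,1)] L2_product(1)[OF L(1,1)]
    by (simp add: green_self[OF d] mass_complex)
  finally have "cmod (\<integral>x. of_real (r x) * (k x - z * f x) * cnj (f x) \<partial>lebesgue) \<ge> gap m z * mass f"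
    using gap_bound[OF m[OF in_dom_in_form[OF d]] mass_nonneg z] by simp
  then show ?thesis by (intro mass_bound h L gap_pos z)
qed

section \<open>Cutoffs and Dirichlet problems\<close>

text \<open>
  Extension by zero, the reason why forms of Dirichlet problems on intervals inherit the lower
  bound of the form on the line.
\<close>
lemma AC_deriv_cutoff:
  fixes f w :: "real \<Rightarrow> complex"
  assumes f: "AC_deriv f w" and ab: "a \<le> b" "f a = 0" "f b = 0"
  shows "AC_deriv (\<lambda>x. indicator {a..b} x *\<^sub>R f x) (\<lambda>x. indicator {a..b} x *\<^sub>R w x)"
proof -
  let ?w = "\<lambda>x. indicator {a..b} x *\<^sub>R w x"
  have l: "loc_int ?w" by (rule loc_int_restrict[OF loc_intD[OF AC_deriv_loc_int[OF f]]])
  have in_ab: "prim ?w y - prim ?w x = f y - f x" if "a \<le> x" "x \<le> y" "y \<le> b" for x y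
  proof -
    have "(LINT t:{x..y}|lebesgue. ?w t) = (LINT t:{x..y}|lebesgue. w t)"
      unfolding set_lebesgue_integral_def using that by (intro Bochner_Integration.integral_cong) (auto simp: indicator_def)
    then show ?thesis using prim_diff[OF l that(2)] AC_deriv_diff_eq[OF f that(2)] by simp
  qed
  have out: "prim ?w y = prim ?w x" if "x \<le> y" "y \<le> a \<or> b \<le> x" for x y
  proof -
    have ae: "AE t in lebesgue. t \<noteq> a" "AE t in lebesgue. t \<noteq> b"
      using AE_lborel_singleton by (auto intro!: AE_completion elim: eventually_mono)
    have "(LINT t:{x..y}|lebesgue. ?w t) = 0"
      unfolding set_lebesgue_integral_def
    proof (rule integral_eq_zero_AE)
      show "AE t in lebesgue. indicat_real {x..y} t *\<^sub>R ?w t = 0"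
        using ae by eventually_elim (use that in \<open>auto simp: indicator_def\<close>)
    qed
    then show ?thesis using prim_diff[OF l that(1)] by simp
  qed
  have "(\<lambda>x. indicator {a..b} x *\<^sub>R f x) = (\<lambda>x. - prim ?w a + prim ?w x)"
  proof
    fix x
    consider "x < a" | "a \<le> x" "x \<le> b" | "b < x" by linarith
    then show "indicator {a..b} x *\<^sub>R f x = - prim ?w a + prim ?w x"
    proof cases
      case 1
      then show ?thesis using out[of x a] by simp
    next
      case 2
      then show ?thesis using in_ab[of a x] ab by (simp add: algebra_simps)
    next
      case 3
      then show ?thesis using out[of b x] in_ab[of a b] ab by (simp add: algebra_simps)
    qed
  qed
  then show ?thesis using AC_deriv_prim[OF l] by (simp only:)
qed

lemma cutoff_in_form:
  fixes f w :: "real \<Rightarrow> complex"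
  assumes f: "AC_deriv f w" and ab: "a \<le> b" "f a = 0" "f b = 0" and w: "loc_int (\<lambda>x. (cmod (w x))\<^sup>2 / s x)"
  shows "in_form (\<lambda>x. indicator {a..b} x *\<^sub>R f x) (\<lambda>x. indicator {a..b} x *\<^sub>R w x)"
    "mass (\<lambda>x. indicator {a..b} x *\<^sub>R f x) = (LINT x:{a..b}|lebesgue. r x * (cmod (f x))\<^sup>2)"
    "tform (\<lambda>x. indicator {a..b} x *\<^sub>R f x) (\<lambda>x. indicator {a..b} x *\<^sub>R w x)
      = (LINT x:{a..b}|lebesgue. (cmod (w x))\<^sup>2 / s x) + (LINT x:{a..b}|lebesgue. q x * (cmod (f x))\<^sup>2)"
proof -
  have c: "continuous_on UNIV (\<lambda>t. (cmod (f t))\<^sup>2)" by (intro continuous_intros AC_deriv_continuous[OF f])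
  have e: "v x * (cmod (indicator {a..b} x *\<^sub>R g x))\<^sup>2 = indicator {a..b} x *\<^sub>R (v x * (cmod (g x))\<^sup>2)" for v g x
    by (auto simp: indicator_def)
  have e': "(cmod (indicator {a..b} x *\<^sub>R g x))\<^sup>2 / s x = indicator {a..b} x *\<^sub>R ((cmod (g x))\<^sup>2 / s x)" for g x
    by (auto simp: indicator_def)
  show "in_form (\<lambda>x. indicator {a..b} x *\<^sub>R f x) (\<lambda>x. indicator {a..b} x *\<^sub>R w x)"
    unfolding in_form_def e e' using AC_deriv_cutoff[OF f ab] loc_intD[OF w, of a b] loc_intD[OF loc_int_mult_continuous[OF r_loc c], of a b]
    by (simp add: set_integrable_def)
  show "mass (\<lambda>x. indicator {a..b} x *\<^sub>R f x) = (LINT x:{a..b}|lebesgue. r x * (cmod (f x))\<^sup>2)"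
    unfolding mass_def e set_lebesgue_integral_def ..
  show "tform (\<lambda>x. indicator {a..b} x *\<^sub>R f x) (\<lambda>x. indicator {a..b} x *\<^sub>R w x)
      = (LINT x:{a..b}|lebesgue. (cmod (w x))\<^sup>2 / s x) + (LINT x:{a..b}|lebesgue. q x * (cmod (f x))\<^sup>2)"
    unfolding tform_def energy_def e e' set_lebesgue_integral_def ..
qed

text \<open>
  The conclusion includes the end points of the interval, where \<open>f\<close> vanishes by continuity from
  inside.
\<close>
lemma zero_if_mass_zero:
  fixes f :: "real \<Rightarrow> complex"
  assumes c: "continuous_on UNIV f" and ab: "a < b" and zero: "(LINT x:{a..b}|lebesgue. r x * (cmod (f x))\<^sup>2) \<le> 0" and x: "x \<in> {a..b}"
  shows "f x = 0"
proof (rule ccontr)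
  assume nz: "f x \<noteq> 0"
  have c2: "continuous_on UNIV (\<lambda>t. (cmod (f t))\<^sup>2)" by (intro continuous_intros c)
  have li: "set_integrable lebesgue {a..b} (\<lambda>x. r x * (cmod (f x))\<^sup>2)"
    by (intro loc_intD loc_int_mult_continuous r_loc c2)
  have "0 \<le> (LINT x:{a..b}|lebesgue. r x * (cmod (f x))\<^sup>2)"
    using r_pos by (intro lint_nonneg) (simp add: less_imp_le)
  with zero have "(\<integral>x. indicator {a..b} x *\<^sub>R (r x * (cmod (f x))\<^sup>2) \<partial>lebesgue) = 0"
    by (simp add: set_lebesgue_integral_def)
  then have "AE x in lebesgue. indicator {a..b} x *\<^sub>R (r x * (cmod (f x))\<^sup>2) = 0"
    using li r_pos by (subst (asm) integral_nonneg_eq_0_iff_AE) (auto simp: set_integrable_def less_imp_le indicator_def)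
  then have ae: "AE x in lebesgue. x \<in> {a..b} \<longrightarrow> (cmod (f x))\<^sup>2 = 0"
  proof eventually_elim
    case (elim x)
    then show ?case using r_pos[of x] by (auto simp: indicator_def)
  qed
  define e where "e = (cmod (f x))\<^sup>2 / 2"
  have e: "e > 0" using nz by (simp add: e_def)
  have "((\<lambda>t. (cmod (f t))\<^sup>2) \<longlongrightarrow> (cmod (f x))\<^sup>2) (at x)"
    using c2 by (simp add: continuous_on_def)
  then have "\<forall>\<^sub>F t in at x. (cmod (f t))\<^sup>2 > e" by (rule order_tendstoD(1)) (use nz in \<open>simp add: e_def\<close>)
  then obtain d where d: "d > 0" "\<And>t. t \<noteq> x \<Longrightarrow> dist t x < d \<Longrightarrow> (cmod (f t))\<^sup>2 > e"
    unfolding eventually_at by auto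
  have d': "(cmod (f t))\<^sup>2 > e" if "\<bar>t - x\<bar> < d" for t
  proof (cases "t = x")
    case True
    then show ?thesis using nz by (simp add: e_def)
  next
    case False
    then show ?thesis using d(2)[of t] that by (simp add: dist_real_def)
  qed
  define y where "y = max a (x - d/2)"
  define y' where "y' = min b (x + d/2)"
  have y: "y < y'" "{y..y'} \<subseteq> {a..b}" "\<And>t. t \<in> {y..y'} \<Longrightarrow> \<bar>t - x\<bar> < d"
    using x ab d(1) by (auto simp: y_def y'_def)
  have "(y' - y) * e = (LINT t:{y..y'}|lebesgue. e)" using y by (simp add: lint_const)
  also have "\<dots> \<le> (LINT t:{y..y'}|lebesgue. (cmod (f t))\<^sup>2)"
    by (intro set_integral_mono set_integrable_const loc_intD loc_int_continuous c2 less_imp_le[OF d'] y)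
  also have "\<dots> = 0"
    unfolding set_lebesgue_integral_def
  proof (rule integral_eq_zero_AE)
    show "AE t in lebesgue. indicat_real {y..y'} t *\<^sub>R (cmod (f t))\<^sup>2 = 0"
      using ae by eventually_elim (use y(2) in \<open>auto simp: indicator_def\<close>)
  qed
  finally show False using e y(1) by (simp add: mult_le_0_iff)
qed

text \<open>
  The argument of \<open>coercive\<close> for the extension of \<open>f\<close> by zero. The boundary terms vanish because
  \<open>f\<close> does at both ends. The bound is independent of the interval, as the limit of growing
  intervals in \<open>resolvent_onto\<close> requires.
\<close>
lemma dirichlet_bound:
  assumes sol: "solves f u (\<lambda>x. z * f x + h x)" and ab: "a \<le> b" "f a = 0" "f b = 0" and z: "off_axis m z"
    and m: "\<And>f w. in_form f w \<Longrightarrow> m * mass f \<le> tform f w" and h: "in_L2 h"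
  shows "(LINT x:{a..b}|lebesgue. r x * (cmod (f x))\<^sup>2) \<le> mass h / (gap m z)\<^sup>2"
proof -
  define w where "w x = of_real (s x) * u x" for x
  have f: "AC_deriv f w" and u: "continuous_on UNIV u" using sol by (auto simp: solves_def w_def[abs_def] intro: AC_deriv_continuous)
  have fc: "continuous_on UNIV f" by (rule AC_deriv_continuous[OF f])
  have c: "continuous_on UNIV (\<lambda>t. (cmod (f t))\<^sup>2)" by (intro continuous_intros fc)
  have wu: "(cmod (w t))\<^sup>2 / s t = s t * (cmod (u t))\<^sup>2" for t
    using s_pos[of t] by (simp add: w_def norm_mult power2_eq_square)
  have lw: "loc_int (\<lambda>x. (cmod (w x))\<^sup>2 / s x)"
    unfolding wu by (intro loc_int_mult_continuous s_loc continuous_intros u)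
  let ?f = "\<lambda>x. indicator {a..b} x *\<^sub>R f x" and ?w = "\<lambda>x. indicator {a..b} x *\<^sub>R w x"
  note cut = cutoff_in_form[OF f ab lw]
  note A = AC_deriv_conjugate_product[OF sol f]
  let ?d = "\<lambda>x. u x * cnj (w x) + (of_real (q x) * f x - of_real (r x) * (z * f x + h x)) * cnj (f x)"
  have "0 = (LINT x:{a..b}|lebesgue. ?d x)" using AC_deriv_diff_eq[OF A ab(1)] ab by simp
  also have "\<dots> = (LINT x:{a..b}|lebesgue. of_real ((cmod (w x))\<^sup>2 / s x + q x * (cmod (f x))\<^sup>2) - z * of_real (r x * (cmod (f x))\<^sup>2)
      - of_real (r x) * h x * cnj (f x))"
  proof (rule set_lebesgue_integral_cong)
    have "?d x = of_real ((cmod (w x))\<^sup>2 / s x + q x * (cmod (f x))\<^sup>2) - z * of_real (r x * (cmod (f x))\<^sup>2)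
      - of_real (r x) * h x * cnj (f x)" for x
    proof -
      have 1: "u x * cnj (w x) = of_real (s x) * (u x * cnj (u x))" by (simp add: w_def)
      show ?thesis unfolding wu 1 of_real_add of_real_mult complex_norm_square by (simp add: algebra_simps)
    qed
    then show "\<forall>x. x \<in> {a..b} \<longrightarrow> ?d x = of_real ((cmod (w x))\<^sup>2 / s x + q x * (cmod (f x))\<^sup>2) - z * of_real (r x * (cmod (f x))\<^sup>2)
      - of_real (r x) * h x * cnj (f x)" by blast
  qed simp
  also have "\<dots> = (LINT x:{a..b}|lebesgue. of_real ((cmod (w x))\<^sup>2 / s x + q x * (cmod (f x))\<^sup>2)) - z * (LINT x:{a..b}|lebesgue. of_real (r x * (cmod (f x))\<^sup>2))
      - (LINT x:{a..b}|lebesgue. of_real (r x) * h x * cnj (f x))"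
  proof -
    have i1: "loc_int (\<lambda>x. complex_of_real ((cmod (w x))\<^sup>2 / s x + q x * (cmod (f x))\<^sup>2))"
      by (intro loc_int_of_real loc_int_add lw loc_int_mult_continuous q_loc c)
    have i2: "loc_int (\<lambda>x. complex_of_real (r x * (cmod (f x))\<^sup>2))"
      by (intro loc_int_of_real loc_int_mult_continuous r_loc c)
    have fL: "in_L2 ?f" by (rule in_form_L2[OF cut(1)])
    have "set_integrable lebesgue {a..b} (\<lambda>x. of_real (r x) * h x * cnj (?f x))"
      by (rule loc_intD[OF loc_int_of_integrable[OF L2_product(1)[OF h fL]]])
    then have i3: "set_integrable lebesgue {a..b} (\<lambda>x. of_real (r x) * h x * cnj (f x))"
      by (subst set_integrable_cong[where f'="\<lambda>x. of_real (r x) * h x * cnj (?f x)"]) (auto simp: indicator_def)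
    show ?thesis using loc_intD[OF i1] loc_intD[OF i2] i3
      by (simp add: set_integral_diff set_integrable_mult_right)
  qed
  also have "(LINT x:{a..b}|lebesgue. complex_of_real ((cmod (w x))\<^sup>2 / s x + q x * (cmod (f x))\<^sup>2)) = of_real (tform ?f ?w)"
    unfolding set_integral_complex_of_real cut(3)
    by (subst set_integral_add) (intro loc_intD lw loc_int_mult_continuous q_loc c refl)+
  also have "(LINT x:{a..b}|lebesgue. complex_of_real (r x * (cmod (f x))\<^sup>2)) = of_real (mass ?f)"
    unfolding set_integral_complex_of_real cut(2) ..
  also have "(LINT x:{a..b}|lebesgue. of_real (r x) * h x * cnj (f x)) = (\<integral>x. of_real (r x) * h x * cnj (?f x) \<partial>lebesgue)"
    unfolding set_lebesgue_integral_def by (intro Bochner_Integration.integral_cong) (auto simp: indicator_def)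
  finally have eq: "(\<integral>x. of_real (r x) * h x * cnj (?f x) \<partial>lebesgue) = of_real (tform ?f ?w) - z * of_real (mass ?f)" by simp
  have "gap m z * mass ?f \<le> cmod (\<integral>x. of_real (r x) * h x * cnj (?f x) \<partial>lebesgue)"
    unfolding eq by (rule gap_bound[OF m[OF cut(1)] mass_nonneg z])
  then have "mass ?f \<le> mass h / (gap m z)\<^sup>2"
    by (intro mass_bound h in_form_L2[OF cut(1)] gap_pos z)
  then show ?thesis unfolding cut(2) .
qed

end

section \<open>Solving the inhomogeneous equation on the line\<close>

lemma lint_positive:
  fixes g :: "real \<Rightarrow> real"
  assumes g: "loc_int g" "\<And>x. 0 < g x" and ab: "a < b"
  shows "0 < (LINT t:{a..b}|lebesgue. g t)"
proof (rule ccontr)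
  assume "\<not> ?thesis"
  moreover have "0 \<le> (LINT t:{a..b}|lebesgue. g t)" using g(2) by (intro lint_nonneg less_imp_le)
  ultimately have "(\<integral>x. indicator {a..b} x *\<^sub>R g x \<partial>lebesgue) = 0"
    by (simp add: set_lebesgue_integral_def)
  then have ae: "AE x in lebesgue. indicator {a..b} x *\<^sub>R g x = 0"
    using loc_intD[OF g(1), of a b] g(2)
    by (subst (asm) integral_nonneg_eq_0_iff_AE) (auto simp: set_integrable_def less_imp_le indicator_def)
  have "b - a = (LINT t:{a..b}|lebesgue. 1)" using ab by (simp add: lint_const)
  also have "\<dots> = 0"
    unfolding set_lebesgue_integral_def
  proof (rule integral_eq_zero_AE)
    show "AE x in lebesgue. indicat_real {a..b} x *\<^sub>R 1 = (0::real)"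
      using ae by eventually_elim (use g(2) in \<open>auto simp: indicator_def less_imp_neq[OF g(2), symmetric]\<close>)
  qed
  finally show False using ab by simp
qed

context sturm_liouville
begin

lemma L2_loc_int:
  assumes h: "in_L2 h" shows "loc_int (\<lambda>x. of_real (r x) * h x)"
  unfolding loc_int_def set_integrable_def
proof (intro allI)
  fix a b
  have i: "integrable lebesgue (\<lambda>x. indicator {a..b} x *\<^sub>R (r x + r x * (cmod (h x))\<^sup>2))"
    using loc_intD[OF loc_int_add[OF r_loc loc_int_of_integrable], of "\<lambda>x. r x * (cmod (h x))\<^sup>2" a b] h
    by (simp add: in_L2_def set_integrable_def)
  show "integrable lebesgue (\<lambda>x. indicat_real {a..b} x *\<^sub>R (of_real (r x) * h x))"
  proof (rule Bochner_Integration.integrable_bound[OF i])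
    show "(\<lambda>x. indicat_real {a..b} x *\<^sub>R (complex_of_real (r x) * h x)) \<in> borel_measurable lebesgue"
      using h loc_int_measurable[OF loc_int_of_real[OF r_loc]]
      by (intro borel_measurable_scaleR borel_measurable_times borel_measurable_indicator) (auto simp: in_L2_def)
    show "AE x in lebesgue. norm (indicat_real {a..b} x *\<^sub>R (complex_of_real (r x) * h x)) \<le> norm (indicat_real {a..b} x *\<^sub>R (r x + r x * (cmod (h x))\<^sup>2))"
    proof (rule AE_I2)
      fix x
      have "2 * cmod (h x) \<le> 1 + (cmod (h x))\<^sup>2" using sum_squares_bound[of 1 "cmod (h x)"] by simp
      then have "cmod (h x) \<le> 1 + (cmod (h x))\<^sup>2" using norm_ge_zero[of "h x"] by linarith
      then have "r x * cmod (h x) \<le> r x * (1 + (cmod (h x))\<^sup>2)" using r_pos[of x] by (intro mult_left_mono) auto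
      also have "\<dots> = norm (r x + r x * (cmod (h x))\<^sup>2)" using r_pos[of x] by (simp add: distrib_left)
      finally show "norm (indicat_real {a..b} x *\<^sub>R (complex_of_real (r x) * h x)) \<le> norm (indicat_real {a..b} x *\<^sub>R (r x + r x * (cmod (h x))\<^sup>2))"
        using r_pos[of x] by (simp add: norm_mult indicator_def)
    qed
  qed
qed

lemma quadratic_continuous:
  fixes F \<phi> \<psi> :: "real \<Rightarrow> complex"
  assumes c: "continuous_on UNIV F" "continuous_on UNIV \<phi>" "continuous_on UNIV \<psi>"
  shows "continuous_on UNIV (\<lambda>v. LINT x:{a..b}|lebesgue. r x * (cmod (F x + fst v * \<phi> x + snd v * \<psi> x))\<^sup>2)"
proof (rule continuous_on_sequentiallyI)
  fix v :: "nat \<Rightarrow> complex \<times> complex" and l assume lim: "v \<longlonglongrightarrow> l"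
  have "Bseq v" using lim by (intro convergent_imp_Bseq convergentI)
  then obtain C where C: "\<And>n. norm (v n) \<le> C" unfolding Bseq_def by blast
  have C0: "C \<ge> 0" using C[of 0] by (meson norm_ge_zero order_trans)
  have cc: "continuous_on UNIV (\<lambda>x. (cmod (F x + fst w * \<phi> x + snd w * \<psi> x))\<^sup>2)" for w
    by (intro continuous_intros c)
  have cd: "continuous_on UNIV (\<lambda>x. (cmod (F x) + C * cmod (\<phi> x) + C * cmod (\<psi> x))\<^sup>2)"
    by (intro continuous_intros c)
  show "(\<lambda>n. LINT x:{a..b}|lebesgue. r x * (cmod (F x + fst (v n) * \<phi> x + snd (v n) * \<psi> x))\<^sup>2)
    \<longlonglongrightarrow> (LINT x:{a..b}|lebesgue. r x * (cmod (F x + fst l * \<phi> x + snd l * \<psi> x))\<^sup>2)"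
    unfolding set_lebesgue_integral_def
  proof (rule integral_dominated_convergence)
    show "integrable lebesgue (\<lambda>x. indicator {a..b} x *\<^sub>R (r x * (cmod (F x) + C * cmod (\<phi> x) + C * cmod (\<psi> x))\<^sup>2))"
      using loc_intD[OF loc_int_mult_continuous[OF r_loc cd]] by (simp add: set_integrable_def)
    show "(\<lambda>x. indicator {a..b} x *\<^sub>R (r x * (cmod (F x + fst l * \<phi> x + snd l * \<psi> x))\<^sup>2)) \<in> borel_measurable lebesgue"
      "(\<lambda>x. indicator {a..b} x *\<^sub>R (r x * (cmod (F x + fst (v n) * \<phi> x + snd (v n) * \<psi> x))\<^sup>2)) \<in> borel_measurable lebesgue" for n
      using loc_intD[OF loc_int_mult_continuous[OF r_loc cc]] by (auto simp: set_integrable_def intro: borel_measurable_integrable)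
    show "AE x in lebesgue. (\<lambda>n. indicator {a..b} x *\<^sub>R (r x * (cmod (F x + fst (v n) * \<phi> x + snd (v n) * \<psi> x))\<^sup>2))
      \<longlonglongrightarrow> indicator {a..b} x *\<^sub>R (r x * (cmod (F x + fst l * \<phi> x + snd l * \<psi> x))\<^sup>2)"
      by (intro AE_I2 tendsto_intros tendsto_fst tendsto_snd lim)
    show "AE x in lebesgue. norm (indicator {a..b} x *\<^sub>R (r x * (cmod (F x + fst (v n) * \<phi> x + snd (v n) * \<psi> x))\<^sup>2))
      \<le> indicator {a..b} x *\<^sub>R (r x * (cmod (F x) + C * cmod (\<phi> x) + C * cmod (\<psi> x))\<^sup>2)" for n
    proof (rule AE_I2)
      fix x
      have n: "cmod (fst (v n)) \<le> C" "cmod (snd (v n)) \<le> C"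
        using C[of n] norm_fst_le[of "fst (v n)" "snd (v n)"] norm_snd_le[of "snd (v n)" "fst (v n)"] by auto
      have "cmod (F x + fst (v n) * \<phi> x + snd (v n) * \<psi> x) \<le> cmod (F x) + cmod (fst (v n)) * cmod (\<phi> x) + cmod (snd (v n)) * cmod (\<psi> x)"
        by (metis norm_mult norm_triangle_le norm_triangle_ineq add_right_mono)
      also have "\<dots> \<le> cmod (F x) + C * cmod (\<phi> x) + C * cmod (\<psi> x)"
        using n by (intro add_mono mult_right_mono) auto
      finally have "(cmod (F x + fst (v n) * \<phi> x + snd (v n) * \<psi> x))\<^sup>2 \<le> (cmod (F x) + C * cmod (\<phi> x) + C * cmod (\<psi> x))\<^sup>2"
        by (intro power_mono) auto
      then show "norm (indicator {a..b} x *\<^sub>R (r x * (cmod (F x + fst (v n) * \<phi> x + snd (v n) * \<psi> x))\<^sup>2))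
      \<le> indicator {a..b} x *\<^sub>R (r x * (cmod (F x) + C * cmod (\<phi> x) + C * cmod (\<psi> x))\<^sup>2)"
        using r_pos[of x] by (simp add: indicator_def abs_mult mult_left_mono)
    qed
  qed
qed

text \<open>
  All solutions of the equation are \<open>fp + g v\<close>, with a particular solution \<open>fp\<close> and, for \<open>v\<close> in
  a two-dimensional complex space, solutions \<open>g v\<close> of the homogeneous equation. The vectors \<open>v\<close>
  for which the mass of \<open>fp + g v\<close> over \<open>[-n, n]\<close> is at most the bound of \<open>dirichlet_bound\<close> form
  a set that is closed and bounded; it is nonempty because it contains the solution of the
  Dirichlet problem, and it shrinks as \<open>n\<close> grows. A vector in the intersection of these sets
  gives a solution in \<open>L\<^sup>2\<close>. The sets play the part of Weyl's nested discs.
\<close>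
theorem resolvent_onto:
  assumes z: "off_axis m z" and m: "\<And>f w. in_form f w \<Longrightarrow> m * mass f \<le> tform f w" and h: "in_L2 h"
  shows "\<exists>f u. in_dom f u (\<lambda>x. z * f x + h x)"
proof -
  define A where "A x = complex_of_real (s x)" for x
  define B where "B x = complex_of_real (q x) + (- z) * complex_of_real (r x)" for x
  have lA: "loc_int A" unfolding A_def by (rule loc_int_of_real[OF s_loc])
  have lB: "loc_int B" unfolding B_def
    by (rule loc_int_add[OF loc_int_of_real[OF q_loc]])
      (use loc_int_mult_continuous[OF loc_int_of_real[OF r_loc] continuous_on_const[of _ "- z"]] in \<open>simp only: mult.commute\<close>)
  define \<rho> where "\<rho> x = complex_of_real (r x) * h x" for x
  have l\<rho>: "loc_int \<rho>" unfolding \<rho>_def by (rule L2_loc_int[OF h])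
  have c0: "continuous_on UNIV (\<lambda>x. - prim \<rho> x)" by (intro continuous_intros ac_continuous ac_prim l\<rho>)
  obtain \<phi> \<phi>u where \<phi>: "loc_int (\<lambda>x. A x * \<phi>u x)" "loc_int (\<lambda>x. B x * \<phi> x)"
    "\<And>x. \<phi> x = 1 + prim (\<lambda>x. A x * \<phi>u x) x" "\<And>x. \<phi>u x = 0 + prim (\<lambda>x. B x * \<phi> x) x"
    using linear_system_solvable[OF lA lB continuous_on_const[of _ 1] continuous_on_const[of _ 0]] by blast
  obtain \<psi> \<psi>u where \<psi>: "loc_int (\<lambda>x. A x * \<psi>u x)" "loc_int (\<lambda>x. B x * \<psi> x)"
    "\<And>x. \<psi> x = 0 + prim (\<lambda>x. A x * \<psi>u x) x" "\<And>x. \<psi>u x = 1 + prim (\<lambda>x. B x * \<psi> x) x"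
    using linear_system_solvable[OF lA lB continuous_on_const[of _ 0] continuous_on_const[of _ 1]] by blast
  obtain fp up where fp: "loc_int (\<lambda>x. A x * up x)" "loc_int (\<lambda>x. B x * fp x)"
    "\<And>x. fp x = 0 + prim (\<lambda>x. A x * up x) x" "\<And>x. up x = - prim \<rho> x + prim (\<lambda>x. B x * fp x) x"
    using linear_system_solvable[OF lA lB continuous_on_const[of _ 0] c0] by blast
  have D\<phi>: "AC_deriv \<phi> (\<lambda>x. A x * \<phi>u x)" "AC_deriv \<phi>u (\<lambda>x. B x * \<phi> x)"
    using AC_deriv_prim[OF \<phi>(1), of 1] AC_deriv_prim[OF \<phi>(2), of 0] unfolding \<phi>(3)[symmetric] \<phi>(4)[symmetric] .
  have D\<psi>: "AC_deriv \<psi> (\<lambda>x. A x * \<psi>u x)" "AC_deriv \<psi>u (\<lambda>x. B x * \<psi> x)"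
    using AC_deriv_prim[OF \<psi>(1), of 0] AC_deriv_prim[OF \<psi>(2), of 1] unfolding \<psi>(3)[symmetric] \<psi>(4)[symmetric] .
  have Dfp: "AC_deriv fp (\<lambda>x. A x * up x)"
    using AC_deriv_prim[OF fp(1), of 0] unfolding fp(3)[symmetric] .
  have "AC_deriv (\<lambda>x. (0 + prim (\<lambda>x. - \<rho> x) x) + (0 + prim (\<lambda>x. B x * fp x) x)) (\<lambda>x. - \<rho> x + B x * fp x)"
    by (intro AC_deriv_add AC_deriv_prim loc_int_uminus l\<rho> fp)
  moreover have "(0 + prim (\<lambda>x. - \<rho> x) x) + (0 + prim (\<lambda>x. B x * fp x) x) = up x" for x
    unfolding prim_uminus[OF l\<rho>] fp(4)[of x] by simp
  ultimately have Dup: "AC_deriv up (\<lambda>x. - \<rho> x + B x * fp x)" by (simp only:)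
  have scale: "AC_deriv g w \<Longrightarrow> AC_deriv (\<lambda>x. a * g x) (\<lambda>x. a * w x)" for a :: complex and g w
    by (rule AC_deriv_bounded_linear[OF bounded_linear_mult_right])
  define g where "g v x = fst v * \<phi> x + snd v * \<psi> x" for v :: "complex \<times> complex" and x
  define gu where "gu v x = fst v * \<phi>u x + snd v * \<psi>u x" for v :: "complex \<times> complex" and x
  have Dg: "AC_deriv (g v) (\<lambda>x. A x * gu v x)" for v
    using AC_deriv_add[OF scale[OF D\<phi>(1), of "fst v"] scale[OF D\<psi>(1), of "snd v"]]
    by (simp add: g_def[abs_def] gu_def algebra_simps)
  have Dgu: "AC_deriv (gu v) (\<lambda>x. B x * g v x)" for v
    using AC_deriv_add[OF scale[OF D\<phi>(2), of "fst v"] scale[OF D\<psi>(2), of "snd v"]]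
    by (simp add: gu_def[abs_def] g_def algebra_simps)
  have sol_f: "solves (\<lambda>x. fp x + g v x) (\<lambda>x. up x + gu v x) (\<lambda>x. z * (fp x + g v x) + h x)" for v
    unfolding solves_def
    using AC_deriv_add[OF Dfp Dg[of v]] AC_deriv_add[OF Dup Dgu[of v]]
    by (simp add: A_def B_def \<rho>_def algebra_simps)
  have sol_g: "solves (g v) (gu v) (\<lambda>x. z * g v x + 0)" for v
    unfolding solves_def using Dg[of v] Dgu[of v] by (simp add: A_def B_def algebra_simps)
  have cont: "continuous_on UNIV \<phi>" "continuous_on UNIV \<psi>" "continuous_on UNIV fp" "continuous_on UNIV (g v)" for v
    by (rule AC_deriv_continuous[OF D\<phi>(1)] AC_deriv_continuous[OF D\<psi>(1)] AC_deriv_continuous[OF Dfp] AC_deriv_continuous[OF Dg])+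
  (* The homogeneous solutions are determined by their values on an interval: \<open>v\<close> is the pair of
     initial values at \<open>0\<close>, and \<open>u\<close> is recovered from the increment of \<open>f\<close> since \<open>s > 0\<close>. *)
  have vanish: "v = 0" if n: "n > 0" and zero: "\<And>x. x \<in> {-n..n} \<Longrightarrow> g v x = 0" for v n
  proof -
    have "g v 0 = fst v" by (simp add: g_def \<phi>(3)[of 0] \<psi>(3)[of 0])
    then have a: "fst v = 0" using zero[of 0] n by simp
    have gu0: "gu v 0 = snd v" using a by (simp add: gu_def \<psi>(4)[of 0])
    have guc: "gu v x = snd v" if x: "x \<in> {0..n}" for x
    proof -
      have "gu v x - gu v 0 = (LINT t:{0..x}|lebesgue. B t * g v t)"
        by (rule AC_deriv_diff_eq[OF Dgu]) (use x in simp)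
      also have "\<dots> = (LINT t:{0..x}|lebesgue. 0)"
        by (rule set_lebesgue_integral_cong) (use zero x n in auto)
      finally show ?thesis using gu0 by simp
    qed
    have "g v n - g v 0 = (LINT t:{0..n}|lebesgue. A t * gu v t)"
      by (rule AC_deriv_diff_eq[OF Dg]) (use n in simp)
    also have "\<dots> = (LINT t:{0..n}|lebesgue. of_real (s t) * snd v)"
      by (rule set_lebesgue_integral_cong) (use guc in \<open>auto simp: A_def\<close>)
    also have "\<dots> = of_real (LINT t:{0..n}|lebesgue. s t) * snd v"
      by (simp add: set_integral_complex_of_real)
    finally have "of_real (LINT t:{0..n}|lebesgue. s t) * snd v = 0" using zero n by simp
    moreover have "(LINT t:{0..n}|lebesgue. s t) > 0" by (rule lint_positive[OF s_loc s_pos n])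
    ultimately have "snd v = 0" by auto
    with a show ?thesis by (simp add: prod_eq_iff)
  qed
  have L0: "in_L2 (\<lambda>x. 0)" by (simp add: in_L2_def)
  have M0: "mass (\<lambda>x. 0) = 0" by (simp add: mass_def)
  (* Uniqueness in the Dirichlet problem, by the bound with zero right-hand side. *)
  have inj: "v = 0" if n: "n > 0" and zero: "g v n = 0" "g v (-n) = 0" for v n
  proof (rule vanish[OF n])
    fix x assume x: "x \<in> {-n..n}"
    have "(LINT x:{-n..n}|lebesgue. r x * (cmod (g v x))\<^sup>2) \<le> mass (\<lambda>x. 0) / (gap m z)\<^sup>2"
      by (rule dirichlet_bound[OF sol_g _ _ _ z m L0]) (use n zero in auto)
    then have le: "(LINT x:{-n..n}|lebesgue. r x * (cmod (g v x))\<^sup>2) \<le> 0" by (simp only: M0 div_0)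
    show "g v x = 0" by (rule zero_if_mass_zero[OF cont(4) _ le x]) (use n in simp)
  qed
  (* By uniqueness the determinant of the boundary conditions is nonzero; Cramer's rule gives
     the solution. *)
  have solve: "\<exists>v. fp n + g v n = 0 \<and> fp (-n) + g v (-n) = 0" if n: "n > 0" for n
  proof -
    define D where "D = \<phi> (-n) * \<psi> n - \<psi> (-n) * \<phi> n"
    have "D \<noteq> 0"
    proof
      assume D: "D = 0"
      have "(\<psi> n, - \<phi> n) = 0" by (rule inj[OF n]) (use D in \<open>auto simp: g_def D_def algebra_simps\<close>)
      then have 1: "\<psi> n = 0" "\<phi> n = 0" by (auto simp: prod_eq_iff)
      have "(\<psi> (-n), - \<phi> (-n)) = 0" by (rule inj[OF n]) (use 1 in \<open>auto simp: g_def\<close>)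
      then have 2: "\<psi> (-n) = 0" "\<phi> (-n) = 0" by (auto simp: prod_eq_iff)
      have "(1::complex, 0::complex) = 0" by (rule inj[OF n]) (use 1 2 in \<open>auto simp: g_def\<close>)
      then show False by (simp add: prod_eq_iff)
    qed
    then have "fp n + g ((fp n * \<psi> (-n) - fp (-n) * \<psi> n) / D, (fp (-n) * \<phi> n - fp n * \<phi> (-n)) / D) n = 0"
      "fp (-n) + g ((fp n * \<psi> (-n) - fp (-n) * \<psi> n) / D, (fp (-n) * \<phi> n - fp n * \<phi> (-n)) / D) (-n) = 0"
      by (simp_all add: g_def field_simps) (simp_all add: D_def algebra_simps)
    then show ?thesis by blast
  qed
  define bd where "bd = mass h / (gap m z)\<^sup>2"
  define E where "E n v = (LINT x:{-n..n}|lebesgue. r x * (cmod (fp x + g v x))\<^sup>2)" for n :: real and v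
  define W where "W n = {v. E (real (Suc n)) v \<le> bd}" for n
  have Wne: "W n \<noteq> {}" for n
  proof -
    obtain v where v: "fp (real (Suc n)) + g v (real (Suc n)) = 0" "fp (-real (Suc n)) + g v (-real (Suc n)) = 0"
      using solve[of "real (Suc n)"] by auto
    have "E (real (Suc n)) v \<le> bd"
      unfolding E_def bd_def by (rule dirichlet_bound[OF sol_f _ _ _ z m h]) (use v in auto)
    then have "v \<in> W n" by (simp only: W_def mem_Collect_eq)
    then show ?thesis by blast
  qed
  have loc_sq: "loc_int (\<lambda>x. r x * (cmod (k x))\<^sup>2)" if "continuous_on UNIV k" for k :: "real \<Rightarrow> complex"
    by (intro loc_int_mult_continuous r_loc continuous_intros that)
  have cfg: "continuous_on UNIV (\<lambda>x. fp x + g v x)" for v by (intro continuous_intros cont)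
  have nn: "0 \<le> r x * (cmod (k x))\<^sup>2" for k :: "real \<Rightarrow> complex" and x using r_pos[of x] by simp
  have Wmono: "W n \<subseteq> W k" if "k \<le> n" for k n
  proof
    fix v assume v: "v \<in> W n"
    have "E (real (Suc k)) v \<le> E (real (Suc n)) v"
      unfolding E_def using that by (intro lint_mono_interval loc_sq[OF cfg] nn) auto
    then show "v \<in> W k" using v by (simp add: W_def)
  qed
  have Wclosed: "closed (W n)" for n
  proof -
    have "continuous_on UNIV (E (real (Suc n)))"
      unfolding E_def[abs_def] g_def add.assoc[symmetric] by (rule quadratic_continuous[OF cont(3,1,2)])
    then show ?thesis unfolding W_def by (intro closed_Collect_le continuous_intros)
  qed
  (* \<open>E0\<close> is a positive definite quadratic form in \<open>v\<close>, so it dominates \<open>|v|\<^sup>2\<close>. This makes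
     \<open>W 0\<close> bounded. *)
  define E0 where "E0 v = (LINT x:{-1..1}|lebesgue. r x * (cmod (g v x))\<^sup>2)" for v
  have E0_nn: "0 \<le> E0 v" for v unfolding E0_def by (rule lint_nonneg) (rule nn)
  have E0_scale: "E0 (t *\<^sub>R v) = t\<^sup>2 * E0 v" for t v
  proof -
    have "r x * (cmod (g (t *\<^sub>R v) x))\<^sup>2 = t\<^sup>2 * (r x * (cmod (g v x))\<^sup>2)" for x
    proof -
      have "g (t *\<^sub>R v) x = of_real t * g v x" by (simp add: g_def scaleR_conv_of_real algebra_simps)
      then show ?thesis by (simp add: norm_mult power_mult_distrib)
    qed
    then show ?thesis unfolding E0_def by (simp only: set_integral_mult_right)
  qed
  obtain \<kappa> where \<kappa>: "\<kappa> > 0" "\<And>v. \<kappa> * (norm v)\<^sup>2 \<le> E0 v"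
  proof -
    have "continuous_on UNIV (\<lambda>v. LINT x:{-1..1}|lebesgue. r x * (cmod (0 + fst v * \<phi> x + snd v * \<psi> x))\<^sup>2)"
      by (rule quadratic_continuous[OF continuous_on_const cont(1,2)])
    then have "continuous_on UNIV E0" unfolding E0_def[abs_def] g_def by simp
    then have "continuous_on (sphere 0 1) E0" by (rule continuous_on_subset) simp
    moreover have "(1, 0) \<in> sphere (0::complex \<times> complex) 1" by (simp add: norm_Pair)
    then have "sphere (0::complex \<times> complex) 1 \<noteq> {}" by blast
    ultimately obtain v0 where v0: "v0 \<in> sphere 0 1" "\<And>v. v \<in> sphere 0 1 \<Longrightarrow> E0 v0 \<le> E0 v"
      using continuous_attains_inf[OF compact_sphere] by blast
    have "E0 v0 > 0"
    proof (rule ccontr)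
      assume "\<not> ?thesis"
      then have le: "(LINT x:{-1..1}|lebesgue. r x * (cmod (g v0 x))\<^sup>2) \<le> 0" by (simp add: E0_def)
      have "v0 = 0" by (rule vanish[of 1]) (auto intro: zero_if_mass_zero[OF cont(4) _ le])
      then show False using v0(1) by simp
    qed
    moreover have "E0 v0 * (norm v)\<^sup>2 \<le> E0 v" for v
    proof (cases "v = 0")
      case False
      have "E0 v0 \<le> E0 (inverse (norm v) *\<^sub>R v)" using False by (intro v0(2)) simp
      then have "E0 v0 * (norm v)\<^sup>2 \<le> (inverse (norm v))\<^sup>2 * E0 v * (norm v)\<^sup>2"
        unfolding E0_scale by (intro mult_right_mono) auto
      then show ?thesis using False by (simp add: power2_eq_square field_simps)
    qed (use E0_nn in simp)
    ultimately show ?thesis using that by blast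
  qed
  have Wbounded: "bounded (W 0)"
  proof -
    define c1 where "c1 = (LINT x:{-1..1}|lebesgue. r x * (cmod (fp x))\<^sup>2)"
    have "norm v \<le> sqrt ((2 * bd + 2 * c1) / \<kappa>)" if v: "v \<in> W 0" for v
    proof (rule real_le_rsqrt)
      have "E0 v \<le> (LINT x:{-1..1}|lebesgue. 2 * (r x * (cmod (fp x + g v x))\<^sup>2) + 2 * (r x * (cmod (fp x))\<^sup>2))"
        unfolding E0_def
      proof (rule set_integral_mono)
        fix x
        have "cmod (g v x) \<le> cmod (fp x + g v x) + cmod (fp x)"
          using norm_triangle_ineq4[of "fp x + g v x" "fp x"] by simp
        then have "(cmod (g v x))\<^sup>2 \<le> (cmod (fp x + g v x) + cmod (fp x))\<^sup>2" by (intro power_mono) auto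
        also have "\<dots> \<le> 2 * (cmod (fp x + g v x))\<^sup>2 + 2 * (cmod (fp x))\<^sup>2"
          using sum_squares_bound[of "cmod (fp x + g v x)" "cmod (fp x)"] by (simp add: power2_sum)
        finally have "r x * (cmod (g v x))\<^sup>2 \<le> r x * (2 * (cmod (fp x + g v x))\<^sup>2 + 2 * (cmod (fp x))\<^sup>2)"
          using r_pos[of x] by (intro mult_left_mono) auto
        then show "r x * (cmod (g v x))\<^sup>2 \<le> 2 * (r x * (cmod (fp x + g v x))\<^sup>2) + 2 * (r x * (cmod (fp x))\<^sup>2)"
          by (simp add: algebra_simps)
      qed (intro loc_intD loc_int_add loc_int_cmult loc_sq cont cfg)+
      also have "\<dots> = 2 * E 1 v + 2 * c1"
        unfolding E_def c1_def set_integral_mult_right[symmetric]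
        by (intro set_integral_add loc_intD loc_int_cmult loc_sq cont cfg)
      also have "\<dots> \<le> 2 * bd + 2 * c1" using v by (simp add: W_def)
      finally have "\<kappa> * (norm v)\<^sup>2 \<le> 2 * bd + 2 * c1" using \<kappa>(2)[of v] by linarith
      then show "(norm v)\<^sup>2 \<le> (2 * bd + 2 * c1) / \<kappa>" using \<kappa>(1) by (simp add: pos_le_divide_eq mult.commute)
    qed
    then show ?thesis unfolding bounded_iff by blast
  qed
  have "compact (W n)" for n
    using Wclosed[of n] bounded_subset[OF Wbounded Wmono[of 0 n]] by (simp add: compact_eq_bounded_closed)
  from compact_nest[OF this Wne Wmono] have "\<Inter>(range W) \<noteq> {}" .
  then obtain v where "v \<in> \<Inter>(range W)" by (meson ex_in_conv)
  then have v: "v \<in> W n" for n by (meson INT_D UNIV_I)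
  have "(LINT x:{-real n..real n}|lebesgue. r x * (cmod (fp x + g v x))\<^sup>2) \<le> bd" for n
  proof -
    have "(LINT x:{-real n..real n}|lebesgue. r x * (cmod (fp x + g v x))\<^sup>2) \<le> E (real (Suc n)) v"
      unfolding E_def by (intro lint_mono_interval loc_sq[OF cfg] nn) auto
    also have "\<dots> \<le> bd" using v[of n] by (simp add: W_def)
    finally show ?thesis .
  qed
  then have "integrable lebesgue (\<lambda>x. r x * (cmod (fp x + g v x))\<^sup>2)"
    by (rule nonneg_exhaustion(1)[OF loc_sq[OF cfg[of v]] nn[of _ "\<lambda>x. fp x + g v x"]])
  then have fL: "in_L2 (\<lambda>x. fp x + g v x)" unfolding in_L2_def using continuous_measurable[OF cfg] by blast
  have "in_L2 (\<lambda>x. z * (fp x + g v x) + h x)" using in_L2_add[OF fL h, of z 1] by simp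
  then have "in_dom (\<lambda>x. fp x + g v x) (\<lambda>x. up x + gu v x) (\<lambda>x. z * (fp x + g v x) + h x)"
    unfolding in_dom_def using sol_f[of v] fL by blast
  then show ?thesis by blast
qed

end

section \<open>The bottom of the form\<close>

lemma integral_square_expansion:
  fixes A B :: "'a \<Rightarrow> real" and C :: "'a \<Rightarrow> complex"
  assumes A: "integrable M A" and B: "integrable M B" and C: "integrable M C"
  shows "integrable M (\<lambda>x. A x - 2 * \<theta> * Re (C x) + \<theta>\<^sup>2 * B x)"
    "(\<integral>x. A x - 2 * \<theta> * Re (C x) + \<theta>\<^sup>2 * B x \<partial>M) = (\<integral>x. A x \<partial>M) - 2 * \<theta> * Re (\<integral>x. C x \<partial>M) + \<theta>\<^sup>2 * (\<integral>x. B x \<partial>M)"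
proof -
  have R: "integrable M (\<lambda>x. Re (C x))" by (rule integrable_bounded_linear[OF bounded_linear_Re C])
  have 1: "integrable M (\<lambda>x. 2 * \<theta> * Re (C x))" "integrable M (\<lambda>x. \<theta>\<^sup>2 * B x)"
    by (intro integrable_mult_right R B)+
  have 2: "integrable M (\<lambda>x. A x - 2 * \<theta> * Re (C x))" by (rule Bochner_Integration.integrable_diff[OF A 1(1)])
  show "integrable M (\<lambda>x. A x - 2 * \<theta> * Re (C x) + \<theta>\<^sup>2 * B x)" by (rule Bochner_Integration.integrable_add[OF 2 1(2)])
  show "(\<integral>x. A x - 2 * \<theta> * Re (C x) + \<theta>\<^sup>2 * B x \<partial>M) = (\<integral>x. A x \<partial>M) - 2 * \<theta> * Re (\<integral>x. C x \<partial>M) + \<theta>\<^sup>2 * (\<integral>x. B x \<partial>M)"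
    unfolding Bochner_Integration.integral_add[OF 2 1(2)] Bochner_Integration.integral_diff[OF A 1(1)]
      integral_mult_right_zero integral_bounded_linear[OF bounded_linear_Re C] ..
qed

context sturm_liouville
begin

text \<open>
  The cross terms with a function \<open>g\<close> of the operator domain are inner products with \<open>g\<close> and
  with \<open>T g = k\<close>, by Green's identity.
\<close>
lemma form_minus_multiple:
  assumes f: "in_form f w" and g: "in_dom g u k"
  defines "v \<equiv> \<lambda>x. of_real (s x) * u x"
  shows "in_form (\<lambda>x. f x - of_real \<theta> * g x) (\<lambda>x. w x - of_real \<theta> * v x)" (is ?form)
    and "mass (\<lambda>x. f x - of_real \<theta> * g x) = mass f - 2 * \<theta> * Re (\<integral>x. of_real (r x) * g x * cnj (f x) \<partial>lebesgue) + \<theta>\<^sup>2 * mass g" (is ?mass)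
    and "tform (\<lambda>x. f x - of_real \<theta> * g x) (\<lambda>x. w x - of_real \<theta> * v x)
      = tform f w - 2 * \<theta> * Re (\<integral>x. of_real (r x) * k x * cnj (f x) \<partial>lebesgue) + \<theta>\<^sup>2 * tform g v" (is ?tform)
proof -
  have gv: "in_form g v" unfolding v_def by (rule in_dom_in_form[OF g])
  note F = in_formD[OF f] and G = in_formD[OF gv]
  have um: "continuous_on UNIV u" using g by (auto simp: in_dom_def solves_def intro: AC_deriv_continuous)
  note fp = form_product[OF gv[unfolded v_def] um f]
  note rg = L2_product(1)[OF in_form_L2[OF gv] in_form_L2[OF f]]
  have sq: "(cmod (a - of_real \<theta> * b))\<^sup>2 = (cmod a)\<^sup>2 - 2 * \<theta> * Re (b * cnj a) + \<theta>\<^sup>2 * (cmod b)\<^sup>2" for a b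
    unfolding cmod_power2 by (simp add: power2_eq_square algebra_simps)
  have rsq: "r x * (cmod (f x - of_real \<theta> * g x))\<^sup>2 = r x * (cmod (f x))\<^sup>2 - 2 * \<theta> * Re (of_real (r x) * g x * cnj (f x)) + \<theta>\<^sup>2 * (r x * (cmod (g x))\<^sup>2)" for x
    unfolding sq by (simp add: algebra_simps)
  have qsq: "q x * (cmod (f x - of_real \<theta> * g x))\<^sup>2 = q x * (cmod (f x))\<^sup>2 - 2 * \<theta> * Re (of_real (q x) * g x * cnj (f x)) + \<theta>\<^sup>2 * (q x * (cmod (g x))\<^sup>2)" for x
    unfolding sq by (simp add: algebra_simps)
  have wsq: "(cmod (w x - of_real \<theta> * v x))\<^sup>2 / s x = (cmod (w x))\<^sup>2 / s x - 2 * \<theta> * Re (u x * cnj (w x)) + \<theta>\<^sup>2 * ((cmod (v x))\<^sup>2 / s x)" for x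
  proof -
    have "Re (v x * cnj (w x)) = s x * Re (u x * cnj (w x))" by (simp add: v_def algebra_simps)
    then show ?thesis unfolding sq using s_pos[of x] by (simp add: field_simps)
  qed
  have "AC_deriv (\<lambda>x. f x - of_real \<theta> * g x) (\<lambda>x. w x - of_real \<theta> * v x)"
    by (intro AC_deriv_diff F AC_deriv_bounded_linear[OF bounded_linear_mult_right] G)
  then show ?form
    unfolding in_form_def rsq wsq
    by (intro conjI integral_square_expansion(1) F G fp rg)
  show ?mass
    unfolding mass_def rsq by (rule integral_square_expansion(2)[OF F(3) G(3) rg])
  have q1: "(\<integral>x. q x * (cmod (f x - of_real \<theta> * g x))\<^sup>2 \<partial>lebesgue) = (\<integral>x. q x * (cmod (f x))\<^sup>2 \<partial>lebesgue)
    - 2 * \<theta> * Re (\<integral>x. of_real (q x) * g x * cnj (f x) \<partial>lebesgue) + \<theta>\<^sup>2 * (\<integral>x. q x * (cmod (g x))\<^sup>2 \<partial>lebesgue)"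
    unfolding qsq by (rule integral_square_expansion(2)[OF q_integrable(2)[OF f] q_integrable(2)[OF gv] fp(2)])
  have e1: "energy (\<lambda>x. w x - of_real \<theta> * v x) = energy w - 2 * \<theta> * Re (\<integral>x. u x * cnj (w x) \<partial>lebesgue) + \<theta>\<^sup>2 * energy v"
    unfolding energy_def wsq by (rule integral_square_expansion(2)[OF F(2) G(2) fp(1)])
  show ?tform
    unfolding tform_def q1 e1 green[OF g f] by (simp add: algebra_simps)
qed

text \<open>
  The lower bound of the form with a constant \<open>n\<close> as comparison function. For \<open>n \<ge> 1/c\<close> the set
  where \<open>n r < 1\<close> lies in \<open>[-K, K]\<close>, and it decreases to the empty set because \<open>r > 0\<close>, so that
  its measure becomes small enough.
\<close>
lemma semibounded: "\<exists>M. \<forall>f w. in_form f w \<longrightarrow> M * mass f \<le> tform f w"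
proof -
  define \<Omega> where "\<Omega> n = {x \<in> {-K..K}. r x * real n < 1}" for n :: nat
  have sets: "\<Omega> n \<in> sets lebesgue" for n
  proof -
    have [measurable]: "r \<in> borel_measurable lebesgue" by (rule r_meas)
    have "{x \<in> space lebesgue. r x * real n < 1} \<in> sets lebesgue" by measurable
    then have "{-K..K} \<inter> {x \<in> space lebesgue. r x * real n < 1} \<in> sets lebesgue" by (intro sets.Int) auto
    moreover have "{-K..K} \<inter> {x \<in> space lebesgue. r x * real n < 1} = \<Omega> n" by (auto simp: \<Omega>_def)
    ultimately show ?thesis by simp
  qed
  have fin: "emeasure lebesgue (\<Omega> n) \<noteq> \<infinity>" for n
  proof -
    have "{-K..K} \<in> lmeasurable" by simp
    moreover have "\<Omega> n \<subseteq> {-K..K}" unfolding \<Omega>_def by blast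
    ultimately have "\<Omega> n \<in> lmeasurable" using sets by (rule fmeasurableI2)
    then have "emeasure lebesgue (\<Omega> n) \<noteq> top" by (rule fmeasurableD2)
    then show ?thesis by (simp only: infinity_ennreal_def not_False_eq_True)
  qed
  have "decseq \<Omega>"
    unfolding decseq_def \<Omega>_def
  proof (intro allI impI subsetI)
    fix m n :: nat and x assume "m \<le> n" "x \<in> {x \<in> {-K..K}. r x * real n < 1}"
    moreover from this have "r x * real m \<le> r x * real n" using r_pos[of x] by (intro mult_left_mono) auto
    ultimately show "x \<in> {x \<in> {-K..K}. r x * real m < 1}" by auto
  qed
  then have "(\<lambda>n. measure lebesgue (\<Omega> n)) \<longlonglongrightarrow> measure lebesgue (\<Inter>n. \<Omega> n)"
    by (intro Lim_measure_decseq image_subsetI sets fin)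
  moreover have "(\<Inter>n. \<Omega> n) = {}"
  proof -
    have "x \<notin> (\<Inter>n. \<Omega> n)" for x
    proof -
      obtain n :: nat where "1 / r x \<le> real n" using real_arch_simple by blast
      then have "\<not> r x * real n < 1" using r_pos[of x] by (simp add: field_simps)
      then show ?thesis unfolding \<Omega>_def by blast
    qed
    then show ?thesis by blast
  qed
  ultimately have "(\<lambda>n. measure lebesgue (\<Omega> n) * sqrt (4 * P * \<alpha>)) \<longlonglongrightarrow> 0 * sqrt (4 * P * \<alpha>)"
    by (intro tendsto_mult_right) simp
  then have "\<forall>\<^sub>F n in sequentially. measure lebesgue (\<Omega> n) * sqrt (4 * P * \<alpha>) < 1"
    by (rule order_tendstoD) simp
  moreover have "\<forall>\<^sub>F n in sequentially. n \<ge> nat \<lceil>1/c\<rceil>" by (rule eventually_ge_at_top)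
  ultimately have "\<forall>\<^sub>F n in sequentially. measure lebesgue (\<Omega> n) * sqrt (4 * P * \<alpha>) < 1 \<and> n \<ge> nat \<lceil>1/c\<rceil>"
    by (rule eventually_conj)
  then obtain n where n: "measure lebesgue (\<Omega> n) * sqrt (4 * P * \<alpha>) < 1" "n \<ge> nat \<lceil>1/c\<rceil>"
    using eventually_happens'[OF sequentially_bot] by blast
  have n2: "1 \<le> real n * c" using n(2) c_pos by (simp add: nat_ceiling_le_eq field_simps)
  have off: "1 \<le> real n * r x" if "x \<notin> \<Omega> n" for x
  proof (cases "x \<in> {-K..K}")
    case True
    then show ?thesis using that by (auto simp: \<Omega>_def not_less mult.commute)
  next
    case False
    then have "c \<le> r x" by (intro r_ge) auto
    then have "real n * c \<le> real n * r x" by (intro mult_left_mono) auto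
    then show ?thesis using n2 by linarith
  qed
  have "- (\<alpha> * real n / (1 - measure lebesgue (\<Omega> n) * sqrt (4 * P * \<alpha>))) * mass f \<le> tform f w" if "in_form f w" for f w
  proof (rule form_lower_bound[OF that of_nat_0_le_iff sets fin n(1)])
    show "AE x in lebesgue. x \<notin> \<Omega> n \<longrightarrow> 1 \<le> real n * r x" using off by (intro AE_I2 impI)
  qed
  then show ?thesis by blast
qed

text \<open>
  A bump on \<open>[0, 2]\<close> adapted to the coefficients: \<open>f = \<sigma> (\<sigma>(2) - \<sigma>)\<close> with \<open>\<sigma> = prim s\<close>. Smooth
  bumps may have infinite energy, as \<open>1/s\<close> need not be locally integrable.
\<close>
lemma form_nontrivial: "\<exists>f w. in_form f w \<and> mass f > 0"
proof -
  let ?S = "prim s"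
  have S: "AC_deriv (\<lambda>x. complex_of_real (?S x)) (\<lambda>x. of_real (s x))"
    by (rule AC_deriv_bounded_linear[OF bounded_linear_of_real]) (use AC_deriv_prim[OF s_loc, of 0] in simp)
  have cst: "AC_deriv (\<lambda>x. c) (\<lambda>x. 0)" for c :: complex
  proof -
    have "loc_int (\<lambda>x::real. 0::complex)" by (simp add: loc_int_def set_integrable_def)
    moreover have "prim (\<lambda>x. 0::complex) x = 0" for x by (auto simp: prim_def)
    ultimately show ?thesis using AC_deriv_prim[of "\<lambda>x. 0::complex" c] by simp
  qed
  have B: "AC_deriv (\<lambda>x. of_real (?S 2) - complex_of_real (?S x)) (\<lambda>x. 0 - of_real (s x))"
    by (rule AC_deriv_diff[OF cst S])
  define f where "f x = complex_of_real (?S x) * (of_real (?S 2) - of_real (?S x))" for x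
  define w where "w x = complex_of_real (?S x) * (0 - of_real (s x)) + of_real (s x) * (of_real (?S 2) - of_real (?S x))" for x
  have f: "AC_deriv f w" unfolding f_def[abs_def] w_def[abs_def] by (rule AC_deriv_mult[OF S B])
  have Sc: "continuous_on UNIV ?S" by (intro ac_continuous ac_prim s_loc)
  have w2: "(cmod (w x))\<^sup>2 / s x = s x * (?S 2 - 2 * ?S x)\<^sup>2" for x
  proof -
    have "w x = of_real (s x * (?S 2 - 2 * ?S x))" by (simp add: w_def algebra_simps)
    then have "cmod (w x) = \<bar>s x * (?S 2 - 2 * ?S x)\<bar>" by (simp only: norm_of_real)
    then show ?thesis using s_pos[of x] by (simp add: power_mult_distrib power2_eq_square)
  qed
  have lw: "loc_int (\<lambda>x. (cmod (w x))\<^sup>2 / s x)"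
    unfolding w2 by (intro loc_int_mult_continuous s_loc continuous_intros Sc)
  have f0: "f 0 = 0" "f 2 = 0" by (simp_all add: f_def)
  note cut = cutoff_in_form[OF f _ f0 lw]
  have "mass (\<lambda>x. indicator {0..2} x *\<^sub>R f x) > 0"
  proof (rule ccontr)
    assume "\<not> ?thesis"
    then have "(LINT x:{0..2}|lebesgue. r x * (cmod (f x))\<^sup>2) \<le> 0" using cut(2) by simp
    then have "f 1 = 0" by (intro zero_if_mass_zero[OF AC_deriv_continuous[OF f], of 0 2]) auto
    moreover have "?S 1 > 0" "?S 2 - ?S 1 > 0"
      using prim_diff[OF s_loc, of 0 1] prim_diff[OF s_loc, of 1 2] lint_positive[OF s_loc s_pos, of 0 1] lint_positive[OF s_loc s_pos, of 1 2] by auto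
    ultimately show False by (simp add: f_def)
  qed
  then show ?thesis using cut(1) by force
qed

definition bottom :: real where
  "bottom = Inf {tform f w / mass f | f w. in_form f w \<and> mass f > 0}"

text \<open>
  For \<open>mass f = 0\<close>, when the quotient is absent, semiboundedness gives \<open>tform f w \<ge> 0\<close>.
\<close>
lemma bottom_le:
  assumes "in_form f w" shows "bottom * mass f \<le> tform f w"
proof -
  obtain M where M: "\<And>f w. in_form f w \<Longrightarrow> M * mass f \<le> tform f w" using semibounded by blast
  show ?thesis
  proof (cases "mass f > 0")
    case True
    have "bottom \<le> tform f w / mass f"
      unfolding bottom_def
    proof (rule cInf_lower)
      show "bdd_below {tform f w / mass f | f w. in_form f w \<and> mass f > 0}"
        using M by (intro bdd_belowI[of _ M]) (auto simp: pos_le_divide_eq)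
    qed (use assms True in blast)
    then show ?thesis using True by (simp add: pos_le_divide_eq)
  next
    case False
    then have "mass f = 0" using mass_nonneg[of f] by simp
    then show ?thesis using M[OF assms] by simp
  qed
qed

lemma bottom_ge:
  assumes "\<And>f w. in_form f w \<Longrightarrow> M * mass f \<le> tform f w" shows "M \<le> bottom"
  unfolding bottom_def
proof (rule cInf_greatest)
  show "{tform f w / mass f | f w. in_form f w \<and> mass f > 0} \<noteq> {}" using form_nontrivial by blast
  fix x assume "x \<in> {tform f w / mass f | f w. in_form f w \<and> mass f > 0}"
  then show "M \<le> x" using assms by (auto simp: pos_le_divide_eq)
qed

lemma mass_cong_AE:
  assumes "AE x in lebesgue. f x = g x" "f \<in> borel_measurable lebesgue" "g \<in> borel_measurable lebesgue"
  shows "mass f = mass g"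
  unfolding mass_def
proof (rule integral_cong_AE)
  have [measurable]: "r \<in> borel_measurable lebesgue" "f \<in> borel_measurable lebesgue" "g \<in> borel_measurable lebesgue"
    using assms r_meas by auto
  show "(\<lambda>x. r x * (cmod (f x))\<^sup>2) \<in> borel_measurable lebesgue" "(\<lambda>x. r x * (cmod (g x))\<^sup>2) \<in> borel_measurable lebesgue" by measurable
  show "AE x in lebesgue. r x * (cmod (f x))\<^sup>2 = r x * (cmod (g x))\<^sup>2" using assms(1) by eventually_elim simp
qed

text \<open>
  Let \<open>m\<close> be the bottom, and for \<open>f\<close> in the form domain let \<open>g\<close> solve \<open>(T - m) g = f\<close>. The form
  \<open>S - m mass\<close> is nonnegative at \<open>f - g/e\<close>; expanding, its cross term is \<open>-2 mass f / e\<close> and its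
  value at \<open>g\<close> is the inner product of \<open>f\<close> and \<open>g\<close>, at most \<open>e mass f\<close> if \<open>e\<close> is large compared
  with the norm of the inverse. So \<open>S[f] - m mass f \<ge> mass f / e\<close> for all \<open>f\<close>, against the
  choice of \<open>m\<close>.
\<close>
theorem bottom_not_regular:
  assumes onto: "\<And>h. in_L2 h \<Longrightarrow> \<exists>g u k. in_dom g u k \<and> (AE x in lebesgue. k x - of_real bottom * g x = h x)"
    and bound: "\<And>g u k. in_dom g u k \<Longrightarrow> mass g \<le> D * mass (\<lambda>x. k x - of_real bottom * g x)"
  shows False
proof -
  (* The inner product of \<open>f\<close> and \<open>g\<close> is at most \<open>(mass f + mass g)/2 \<le> e mass f\<close>. *)
  define e where "e = (1 + max 0 D) / 2"
  have e: "e > 0" by (simp add: e_def)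
  have "(bottom + 1/e) * mass f \<le> tform f w" if fw: "in_form f w" for f w
  proof -
    have fL: "in_L2 f" by (rule in_form_L2[OF fw])
    obtain g u k where d: "in_dom g u k" and eq: "AE x in lebesgue. k x - of_real bottom * g x = f x"
      using onto[OF fL] by blast
    have gL: "in_L2 g" "in_L2 k" using d by (auto simp: in_dom_def)
    have hL: "in_L2 (\<lambda>x. k x - of_real bottom * g x)" using in_L2_add[OF gL(2,1), of 1 "- of_real bottom"] by simp
    let ?ip = "\<lambda>a b. \<integral>x. of_real (r x) * a x * cnj (b x) \<partial>lebesgue"
    have ip: "?ip k y - of_real bottom * ?ip g y = ?ip f y" if yL: "in_L2 y" for y
    proof -
      have "?ip f y = (\<integral>x. of_real (r x) * k x * cnj (y x) - of_real bottom * (of_real (r x) * g x * cnj (y x)) \<partial>lebesgue)"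
      proof (rule integral_cong_AE)
        show "(\<lambda>x. of_real (r x) * f x * cnj (y x)) \<in> borel_measurable lebesgue" using L2_product(1)[OF fL yL] by (rule borel_measurable_integrable)
        show "(\<lambda>x. of_real (r x) * k x * cnj (y x) - of_real bottom * (of_real (r x) * g x * cnj (y x))) \<in> borel_measurable lebesgue"
          by (intro borel_measurable_integrable Bochner_Integration.integrable_diff integrable_mult_right L2_product(1) gL yL)
        show "AE x in lebesgue. of_real (r x) * f x * cnj (y x) = of_real (r x) * k x * cnj (y x) - of_real bottom * (of_real (r x) * g x * cnj (y x))"
          using eq by eventually_elim (auto simp: algebra_simps)
      qed
      also have "\<dots> = ?ip k y - of_real bottom * ?ip g y"
        using L2_product(1)[OF gL(2) yL] L2_product(1)[OF gL(1) yL] by simp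
      finally show ?thesis ..
    qed
    have "mass (\<lambda>x. k x - of_real bottom * g x) = mass f"
      using eq hL fL by (intro mass_cong_AE) (auto simp: in_L2_def)
    then have mg: "mass g \<le> max 0 D * mass f"
      using bound[OF d] mult_right_mono[of D "max 0 D" "mass f"] mass_nonneg[of f] by simp
    let ?v = "\<lambda>x. of_real (s x) * u x"
    have tg: "tform g ?v - bottom * mass g = Re (?ip f g)"
    proof -
      have "Re (?ip k g - of_real bottom * ?ip g g) = tform g ?v - bottom * mass g"
        unfolding green_self[OF d] mass_complex by simp
      then show ?thesis using ip[OF gL(1)] by simp
    qed
    have "Re (?ip f g) \<le> mass f / (2 * 1) + 1 / 2 * mass g"
      using L2_product(2)[OF fL gL(1) zero_less_one] complex_Re_le_cmod[of "?ip f g"] by linarith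
    also have "\<dots> \<le> e * mass f" using mg by (simp add: e_def algebra_simps)
    finally have Sg: "tform g ?v - bottom * mass g \<le> e * mass f" unfolding tg .
    let ?l = "1 / e"
    note fa = form_minus_multiple[OF fw d, of ?l]
    have "Re (?ip k f - of_real bottom * ?ip g f) = mass f"
      unfolding ip[OF fL] mass_complex by simp
    then have cross: "Re (?ip k f) - bottom * Re (?ip g f) = mass f" by simp
    have "0 \<le> (tform f w - 2 * ?l * Re (?ip k f) + ?l\<^sup>2 * tform g ?v)
       - bottom * (mass f - 2 * ?l * Re (?ip g f) + ?l\<^sup>2 * mass g)"
      using bottom_le[OF fa(1)] unfolding fa(2,3) by simp
    also have "\<dots> = (tform f w - bottom * mass f) - 2 * ?l * (Re (?ip k f) - bottom * Re (?ip g f)) + ?l\<^sup>2 * (tform g ?v - bottom * mass g)"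
      by (simp add: algebra_simps)
    also have "\<dots> \<le> (tform f w - bottom * mass f) - 2 * ?l * mass f + ?l\<^sup>2 * (e * mass f)"
      unfolding cross using Sg by (intro add_left_mono mult_left_mono) auto
    also have "?l\<^sup>2 * (e * mass f) = ?l * mass f" using e by (simp add: power2_eq_square)
    finally show ?thesis by (simp add: algebra_simps)
  qed
  then have "bottom + 1/e \<le> bottom" by (rule bottom_ge)
  then show False using e by simp
qed

end

context sturm_liouville
begin

section \<open>The operator in the weighted space\<close>

lemma continuous_AE_eq:
  fixes f g :: "real \<Rightarrow> complex"
  assumes c: "continuous_on UNIV f" "continuous_on UNIV g" and ae: "AE x in lebesgue. f x = g x"
  shows "f = g"
proof
  fix x
  have c': "continuous_on UNIV (\<lambda>x. f x - g x)" by (intro continuous_intros c)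
  have "(LINT t:{x..x+1}|lebesgue. r t * (cmod (f t - g t))\<^sup>2) = 0"
    unfolding set_lebesgue_integral_def
  proof (rule integral_eq_zero_AE)
    show "AE t in lebesgue. indicat_real {x..x + 1} t *\<^sub>R (r t * (cmod (f t - g t))\<^sup>2) = 0"
      using ae by eventually_elim simp
  qed
  then have "f x - g x = 0" by (intro zero_if_mass_zero[OF c', of x "x+1"]) auto
  then show "f x = g x" by simp
qed

lemma in_dom_diff:
  assumes "in_dom f u k" "in_dom g v l"
  shows "in_dom (\<lambda>x. f x - g x) (\<lambda>x. u x - v x) (\<lambda>x. k x - l x)"
proof -
  have L: "in_L2 f" "in_L2 k" "in_L2 g" "in_L2 l" using assms by (auto simp: in_dom_def)
  have "in_L2 (\<lambda>x. f x - g x)" "in_L2 (\<lambda>x. k x - l x)"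
    using in_L2_add[OF L(1,3), of 1 "-1"] in_L2_add[OF L(2,4), of 1 "-1"] by simp_all
  moreover have "solves (\<lambda>x. f x - g x) (\<lambda>x. u x - v x) (\<lambda>x. k x - l x)"
  proof -
    have S: "solves f u k" "solves g v l" using assms by (auto simp: in_dom_def)
    have "AC_deriv (\<lambda>x. f x - g x) (\<lambda>x. of_real (s x) * u x - of_real (s x) * v x)"
      using S by (intro AC_deriv_diff) (auto simp: solves_def)
    moreover have "AC_deriv (\<lambda>x. u x - v x) (\<lambda>x. (of_real (q x) * f x - of_real (r x) * k x) - (of_real (q x) * g x - of_real (r x) * l x))"
      using S by (intro AC_deriv_diff) (auto simp: solves_def)
    ultimately show ?thesis by (simp add: solves_def algebra_simps)
  qed
  ultimately show ?thesis by (simp add: in_dom_def)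
qed

end

text \<open>
  The original coefficients \<open>p\<close> and \<open>r\<close> next to their modifications \<open>s = 1/p\<close> and \<open>r'\<close>. The
  weighted measure, the operator and its domain depend on \<open>p\<close> and \<open>r\<close> only up to null sets.
\<close>
locale sturm_liouville_operator = sturm_liouville s q r' P c K N Q
  for s q r' :: "real \<Rightarrow> real" and P c K N Q :: real +
  fixes p r :: "real \<Rightarrow> real"
  assumes s_p: "AE x in lebesgue. 0 < p x \<and> s x = 1 / p x" and r_r': "AE x in lebesgue. r x = r' x"
begin

lemma r_measurable: "r \<in> borel_measurable lebesgue"
  by (rule borel_measurable_AE[OF r_meas]) (use r_r' in \<open>auto elim: eventually_mono\<close>)

lemma weighted_eq: "weighted r = density lebesgue (\<lambda>x. ennreal (r' x))"
  unfolding weighted_def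
proof (rule density_cong)
  show "AE x in lebesgue. ennreal (r x) = ennreal (r' x)" using r_r' by eventually_elim simp
qed (use r_measurable r_meas in measurable)

lemma AE_weighted: "(AE x in weighted r. R x) \<longleftrightarrow> (AE x in lebesgue. R x)"
proof -
  have [measurable]: "r' \<in> borel_measurable lebesgue" by (rule r_meas)
  have "(AE x in weighted r. R x) \<longleftrightarrow> (AE x in lebesgue. 0 < ennreal (r' x) \<longrightarrow> R x)"
    unfolding weighted_eq by (rule AE_density) measurable
  then show ?thesis using r_pos by simp
qed

lemma L2_weighted: "h \<in> L2 (weighted r) \<longleftrightarrow> in_L2 h"
proof -
  have [measurable]: "r' \<in> borel_measurable lebesgue" by (rule r_meas)
  have m: "h \<in> borel_measurable (weighted r) \<longleftrightarrow> h \<in> borel_measurable lebesgue"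
    unfolding weighted_def by simp
  have "integrable (weighted r) (\<lambda>x. (cmod (h x))\<^sup>2) \<longleftrightarrow> integrable lebesgue (\<lambda>x. r' x *\<^sub>R (cmod (h x))\<^sup>2)" if "h \<in> borel_measurable lebesgue"
    unfolding weighted_eq
    by (rule integrable_density) (use r_pos that in \<open>auto intro!: AE_I2 less_imp_le borel_measurable_power borel_measurable_norm\<close>)
  then show ?thesis unfolding L2_def in_L2_def m[symmetric] using m by auto
qed

lemma L2_norm_weighted:
  assumes "h \<in> borel_measurable lebesgue" shows "L2_norm (weighted r) h = sqrt (mass h)"
proof -
  have [measurable]: "r' \<in> borel_measurable lebesgue" by (rule r_meas)
  have "(\<integral>x. (cmod (h x))\<^sup>2 \<partial>weighted r) = (\<integral>x. r' x *\<^sub>R (cmod (h x))\<^sup>2 \<partial>lebesgue)"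
    unfolding weighted_eq
    by (rule integral_density) (use r_pos assms in \<open>auto intro!: AE_I2 less_imp_le borel_measurable_power borel_measurable_norm\<close>)
  then show ?thesis by (simp add: L2_norm_def mass_def)
qed

lemma quasi_deriv_eqI:
  assumes "is_quasi_deriv p f u" shows "quasi_deriv p f = u"
  unfolding quasi_deriv_def
proof (rule the_equality)
  show "is_quasi_deriv p f u" by (rule assms)
  fix v assume v: "is_quasi_deriv p f v"
  have "AE x in lebesgue. v x = u x"
    using assms v unfolding is_quasi_deriv_def by (auto elim: eventually_elim2)
  then show "v = u"
    using assms v by (intro continuous_AE_eq) (auto simp: is_quasi_deriv_def AC_loc_iff intro: ac_continuous)
qed

text \<open>
  The differential equation holds almost everywhere by definition; the fundamental theorem of
  calculus turns it into integral equations.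
\<close>
lemma SL_dom_imp_in_dom:
  assumes f: "f \<in> SL_dom p q r"
  shows "\<exists>u. in_dom f u (SL_op p q r f)"
proof -
  obtain u where u: "is_quasi_deriv p f u" and fL: "in_L2 f" and kL: "in_L2 (SL_op p q r f)" and facl: "ac f"
    using f unfolding SL_dom_def by (auto simp: L2_weighted AC_loc_iff)
  have qu: "quasi_deriv p f = u" by (rule quasi_deriv_eqI[OF u])
  have uac: "ac u" and uae: "AE x in lebesgue. u x = p x *\<^sub>R vector_derivative f (at x)"
    using u by (auto simp: is_quasi_deriv_def AC_loc_iff)
  have "AC_deriv f (\<lambda>x. of_real (s x) * u x)"
  proof (rule AC_deriv_cong_AE[OF ac_AC_deriv[OF facl]])
    show "AE x in lebesgue. vector_derivative f (at x) = of_real (s x) * u x"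
      using uae s_p by eventually_elim (auto simp: scaleR_conv_of_real)
  qed
  moreover have "AC_deriv u (\<lambda>x. of_real (q x) * f x - of_real (r' x) * SL_op p q r f x)"
  proof (rule AC_deriv_cong_AE[OF ac_AC_deriv[OF uac]])
    show "AE x in lebesgue. vector_derivative u (at x) = of_real (q x) * f x - of_real (r' x) * SL_op p q r f x"
      using r_r'
    proof eventually_elim
      case (elim x)
      have "complex_of_real (r' x) \<noteq> 0" using r_pos[of x] by simp
      then show ?case using elim by (simp add: SL_op_def qu scaleR_conv_of_real)
    qed
  qed
  ultimately show ?thesis using fL kL by (auto simp: in_dom_def solves_def)
qed

text \<open>
  The quasi-derivative in the definition of the operator is unique by continuity and therefore
  equals \<open>u\<close>.
\<close>
lemma in_dom_imp_SL_dom: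
  assumes d: "in_dom f u k"
  shows "f \<in> SL_dom p q r" "AE x in lebesgue. SL_op p q r f x = k x"
proof -
  have f: "AC_deriv f (\<lambda>x. of_real (s x) * u x)" and u: "AC_deriv u (\<lambda>x. of_real (q x) * f x - of_real (r' x) * k x)"
    and fL: "in_L2 f" and kL: "in_L2 k"
    using d by (auto simp: in_dom_def solves_def)
  have iq: "is_quasi_deriv p f u"
    unfolding is_quasi_deriv_def
  proof
    show "u \<in> AC_loc" using AC_deriv_ac[OF u] by (simp add: AC_loc_iff)
    show "AE x in lebesgue. u x = p x *\<^sub>R vector_derivative f (at x)"
      using s_p AC_deriv_has_derivative[OF f]
    proof eventually_elim
      case (elim x)
      then have "vector_derivative f (at x) = of_real (1 / p x) * u x" using vector_derivative_at by force
      then show ?case using elim by (simp add: scaleR_conv_of_real)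
    qed
  qed
  have qu: "quasi_deriv p f = u" by (rule quasi_deriv_eqI[OF iq])
  show ae: "AE x in lebesgue. SL_op p q r f x = k x"
    using r_r' AC_deriv_has_derivative[OF u]
  proof eventually_elim
    case (elim x)
    have "complex_of_real (r' x) \<noteq> 0" using r_pos[of x] by simp
    moreover have "vector_derivative u (at x) = of_real (q x) * f x - of_real (r' x) * k x"
      using elim(2) by (rule vector_derivative_at)
    ultimately show ?case using elim(1) by (simp add: SL_op_def qu scaleR_conv_of_real)
  qed
  have km: "k \<in> borel_measurable lebesgue" using kL by (simp add: in_L2_def)
  have ae': "AE x in lebesgue. k x = SL_op p q r f x" using ae by eventually_elim simp
  have om: "SL_op p q r f \<in> borel_measurable lebesgue" by (rule borel_measurable_AE[OF km ae'])
  have [measurable]: "r' \<in> borel_measurable lebesgue" "k \<in> borel_measurable lebesgue" "SL_op p q r f \<in> borel_measurable lebesgue"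
    by (rule r_meas km om)+
  have "integrable lebesgue (\<lambda>x. r' x * (cmod (SL_op p q r f x))\<^sup>2)"
  proof (rule integrable_cong_AE_imp)
    show "integrable lebesgue (\<lambda>x. r' x * (cmod (k x))\<^sup>2)" using kL by (simp add: in_L2_def)
    show "AE x in lebesgue. r' x * (cmod (k x))\<^sup>2 = r' x * (cmod (SL_op p q r f x))\<^sup>2"
      using ae by eventually_elim simp
  qed measurable
  then have "in_L2 (SL_op p q r f)" using om by (simp add: in_L2_def)
  then show "f \<in> SL_dom p q r"
    unfolding SL_dom_def using fL iq AC_deriv_ac[OF f] by (auto simp: L2_weighted AC_loc_iff)
qed

lemma mass_SL_op:
  assumes "in_dom f u k"
  shows "mass (\<lambda>x. SL_op p q r f x - z * f x) = mass (\<lambda>x. k x - z * f x)"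
    "(\<lambda>x. SL_op p q r f x - z * f x) \<in> borel_measurable lebesgue"
proof -
  have km: "k \<in> borel_measurable lebesgue" "f \<in> borel_measurable lebesgue" using assms by (auto simp: in_dom_def in_L2_def)
  have ae: "AE x in lebesgue. k x = SL_op p q r f x" using in_dom_imp_SL_dom(2)[OF assms] by eventually_elim simp
  have om: "SL_op p q r f \<in> borel_measurable lebesgue" by (rule borel_measurable_AE[OF km(1) ae])
  have [measurable]: "k \<in> borel_measurable lebesgue" "f \<in> borel_measurable lebesgue" "SL_op p q r f \<in> borel_measurable lebesgue"
    by (rule km om)+
  show m: "(\<lambda>x. SL_op p q r f x - z * f x) \<in> borel_measurable lebesgue" by measurable
  show "mass (\<lambda>x. SL_op p q r f x - z * f x) = mass (\<lambda>x. k x - z * f x)"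
  proof (rule mass_cong_AE[OF _ m])
    show "AE x in lebesgue. SL_op p q r f x - z * f x = k x - z * f x" using ae by eventually_elim simp
  qed measurable
qed

text \<open>
  Injectivity and the bound for the inverse come from \<open>coercive\<close>, surjectivity from
  \<open>resolvent_onto\<close>.
\<close>
lemma off_axis_resolvent:
  assumes z: "off_axis bottom z"
  shows "z \<in> resolvent_set (weighted r) (SL_dom p q r) (SL_op p q r)"
  unfolding resolvent_set_def
proof (intro CollectI conjI ballI impI)
  let ?T = "SL_op p q r"
  note gp = gap_pos[OF z]
  note co = coercive[OF _ z bottom_le]
  show "AE x in weighted r. f x = g x"
    if f: "f \<in> SL_dom p q r" and g: "g \<in> SL_dom p q r" and eq: "AE x in weighted r. ?T f x - z * f x = ?T g x - z * g x" for f g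
  proof -
    obtain u v where "in_dom f u (?T f)" "in_dom g v (?T g)" using SL_dom_imp_in_dom f g by blast
    from in_dom_diff[OF this] have d: "in_dom (\<lambda>x. f x - g x) (\<lambda>x. u x - v x) (\<lambda>x. ?T f x - ?T g x)" .
    have m: "(\<lambda>x. (?T f x - ?T g x) - z * (f x - g x)) \<in> borel_measurable lebesgue"
      using d in_L2_add[of "\<lambda>x. ?T f x - ?T g x" "\<lambda>x. f x - g x" 1 "-z"] by (simp add: in_dom_def in_L2_def)
    have "mass (\<lambda>x. (?T f x - ?T g x) - z * (f x - g x)) = mass (\<lambda>x. 0)"
    proof (rule mass_cong_AE[OF _ m])
      show "AE x in lebesgue. (?T f x - ?T g x) - z * (f x - g x) = 0"
        using eq unfolding AE_weighted by eventually_elim (simp add: algebra_simps)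
    qed simp
    then have "mass (\<lambda>x. f x - g x) \<le> 0" using co[OF d] by (simp add: mass_def)
    moreover have i: "integrable lebesgue (\<lambda>x. r' x * (cmod (f x - g x))\<^sup>2)" using d by (simp add: in_dom_def in_L2_def)
    moreover have c: "continuous_on UNIV (\<lambda>x. f x - g x)" using d by (auto simp: in_dom_def solves_def intro: AC_deriv_continuous)
    ultimately have z: "f x - g x = 0" for x
      using lint_le_integral[OF i, of "x" "x+1"] r_pos
      by (intro zero_if_mass_zero[OF c, of x "x+1"]) (auto simp: mass_def less_imp_le intro: order_trans)
    show ?thesis using z by (intro AE_I2) simp
  qed
  show "\<exists>f\<in>SL_dom p q r. AE x in weighted r. ?T f x - z * f x = h x" if h: "h \<in> L2 (weighted r)" for h
  proof -
    have hL: "in_L2 h" using h by (simp add: L2_weighted)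
    obtain f u where d: "in_dom f u (\<lambda>x. z * f x + h x)" using resolvent_onto[OF z bottom_le hL] by blast
    have "AE x in lebesgue. ?T f x - z * f x = h x"
      using in_dom_imp_SL_dom(2)[OF d] by eventually_elim simp
    then show ?thesis using in_dom_imp_SL_dom(1)[OF d] unfolding AE_weighted by blast
  qed
  show "\<exists>C. \<forall>f\<in>SL_dom p q r. L2_norm (weighted r) f \<le> C * L2_norm (weighted r) (\<lambda>x. ?T f x - z * f x)"
  proof (intro exI ballI)
    fix f assume "f \<in> SL_dom p q r"
    then obtain u where d: "in_dom f u (?T f)" using SL_dom_imp_in_dom by blast
    have fm: "f \<in> borel_measurable lebesgue" using d by (simp add: in_dom_def in_L2_def)
    have "sqrt (mass f) \<le> sqrt (mass (\<lambda>x. ?T f x - z * f x) / (gap bottom z)\<^sup>2)"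
      by (rule real_sqrt_le_mono[OF co[OF d]])
    also have "\<dots> = (1 / gap bottom z) * sqrt (mass (\<lambda>x. ?T f x - z * f x))"
      using gp by (simp add: real_sqrt_divide)
    finally show "L2_norm (weighted r) f \<le> (1 / gap bottom z) * L2_norm (weighted r) (\<lambda>x. ?T f x - z * f x)"
      by (simp add: L2_norm_weighted[OF fm] L2_norm_weighted[OF mass_SL_op(2)[OF d]])
  qed
qed

lemma bottom_spectrum:
  "of_real bottom \<notin> resolvent_set (weighted r) (SL_dom p q r) (SL_op p q r)"
proof
  let ?T = "SL_op p q r" and ?m = "complex_of_real bottom"
  assume "?m \<in> resolvent_set (weighted r) (SL_dom p q r) ?T"
  then obtain C where onto: "\<And>h. h \<in> L2 (weighted r) \<Longrightarrow> \<exists>f\<in>SL_dom p q r. AE x in weighted r. ?T f x - ?m * f x = h x"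
    and C: "\<And>f. f \<in> SL_dom p q r \<Longrightarrow> L2_norm (weighted r) f \<le> C * L2_norm (weighted r) (\<lambda>x. ?T f x - ?m * f x)"
    unfolding resolvent_set_def by blast
  show False
  proof (rule bottom_not_regular[of "C\<^sup>2"])
    show "\<exists>g u k. in_dom g u k \<and> (AE x in lebesgue. k x - ?m * g x = h x)" if h: "in_L2 h" for h
    proof -
      obtain f where f: "f \<in> SL_dom p q r" "AE x in weighted r. ?T f x - ?m * f x = h x"
        using onto h L2_weighted by blast
      then show ?thesis using SL_dom_imp_in_dom[OF f(1)] unfolding AE_weighted by blast
    qed
    show "mass g \<le> C\<^sup>2 * mass (\<lambda>x. k x - ?m * g x)" if d: "in_dom g u k" for g u k
    proof -
      have gm: "g \<in> borel_measurable lebesgue" using d by (simp add: in_dom_def in_L2_def)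
      have "sqrt (mass g) \<le> C * sqrt (mass (\<lambda>x. k x - ?m * g x))"
        using C[OF in_dom_imp_SL_dom(1)[OF d]]
        unfolding L2_norm_weighted[OF gm] L2_norm_weighted[OF mass_SL_op(2)[OF d]] mass_SL_op(1)[OF d] .
      then have "(sqrt (mass g))\<^sup>2 \<le> (C * sqrt (mass (\<lambda>x. k x - ?m * g x)))\<^sup>2"
        using mass_nonneg[of g] by (intro power_mono) auto
      then show ?thesis using mass_nonneg by (simp add: power_mult_distrib)
    qed
  qed
qed

theorem bottom_is_min: "is_min_of bottom (SL_spectrum p q r)"
  unfolding is_min_of_def SL_spectrum_def spectrum_def
proof (intro conjI ballI)
  show "of_real bottom \<in> - resolvent_set (weighted r) (SL_dom p q r) (SL_op p q r)"
    using bottom_spectrum by simp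
  fix z assume "z \<in> - resolvent_set (weighted r) (SL_dom p q r) (SL_op p q r)"
  then have "\<not> off_axis bottom z" using off_axis_resolvent by blast
  then show "z \<in> \<real>" "bottom \<le> Re z" by (auto simp: off_axis_def complex_is_Real_iff)
qed

end

section \<open>The lower bound for the spectrum\<close>

lemma Linf_AE:
  assumes "h \<in> Lp \<infinity>"
  shows "AE x in lebesgue. \<bar>h x\<bar> \<le> enn2real (Linf_norm h)"
proof -
  have fin: "Linf_norm h < \<infinity>" using assms by (simp add: Lp_def)
  have "AE x in lebesgue. ennreal \<bar>h x\<bar> \<le> Linf_norm h" unfolding Linf_norm_def by (rule esssup_AE)
  then show ?thesis
  proof eventually_elim
    case (elim x)
    have "ennreal \<bar>h x\<bar> \<le> ennreal (enn2real (Linf_norm h))" using elim fin by simp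
    then show ?case by (simp add: ennreal_le_iff)
  qed
qed

lemma unif_norm_bound:
  assumes h: "loc_int h" and fin: "unif_norm h < \<infinity>"
  shows "(LINT t:{real_of_int n..real_of_int n + 1}|lebesgue. \<bar>h t\<bar>) \<le> enn2real (unif_norm h)"
proof -
  let ?I = "{real_of_int n..real_of_int n + 1}"
  have i: "integrable lebesgue (\<lambda>x. indicator ?I x *\<^sub>R \<bar>h x\<bar>)"
    using loc_intD[OF loc_int_norm[OF h], of "real_of_int n" "real_of_int n + 1"] by (simp add: set_integrable_def)
  have "ennreal (LINT t:?I|lebesgue. \<bar>h t\<bar>) = (\<integral>\<^sup>+t. ennreal (indicator ?I t *\<^sub>R \<bar>h t\<bar>) \<partial>lebesgue)"
    unfolding set_lebesgue_integral_def by (rule nn_integral_eq_integral[OF i, symmetric]) (auto intro!: AE_I2)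
  also have "\<dots> = (\<integral>\<^sup>+t\<in>?I. ennreal \<bar>h t\<bar> \<partial>lebesgue)"
    by (intro nn_integral_cong) (auto simp: indicator_def)
  also have "\<dots> \<le> unif_norm h" unfolding unif_norm_def by (rule SUP_upper) simp
  finally have "ennreal (LINT t:?I|lebesgue. \<bar>h t\<bar>) \<le> ennreal (enn2real (unif_norm h))" using fin by simp
  then show ?thesis by (simp add: ennreal_le_iff)
qed

lemma unif_norm_mono:
  assumes "\<And>x. \<bar>g x\<bar> \<le> \<bar>h x\<bar>" shows "unif_norm g \<le> unif_norm h"
  unfolding unif_norm_def
  by (intro SUP_mono' nn_integral_mono mult_right_mono ennreal_leI assms) simp

theorem theorem3p2:
  fixes p q r :: "real \<Rightarrow> real" and \<alpha> \<beta> :: real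
  assumes meas: "p \<in> borel_measurable lebesgue" "q \<in> borel_measurable lebesgue"
      "r \<in> borel_measurable lebesgue"
    and loc: "r \<in> L1_loc" "(\<lambda>x. 1 / p x) \<in> L1_loc" "q \<in> L1_loc"
    and hyp_a: "AE x in lebesgue. p x > 0" "\<exists>\<eta>\<in>{1..\<infinity>}. (\<lambda>x. 1 / p x) \<in> Lp \<eta>"
    and hyp_b: "q \<in> L1_u"
    and hyp_c: "AE x in lebesgue. r x > 0"
      "\<exists>a b. a < b \<and> essinf (restrict_space lebesgue (- {a..b})) (\<lambda>t. ereal (r t)) > 0"
    and p_bdd: "(\<lambda>x. 1 / p x) \<in> Lp \<infinity>"
    and alpha: "\<alpha> = 2 * enn2real (unif_norm (neg_part q))
      + 4 * enn2real (Linf_norm (\<lambda>x. 1 / p x)) * (enn2real (unif_norm (neg_part q)))\<^sup>2"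
    and beta: "\<beta> = sqrt (4 * enn2real (Linf_norm (\<lambda>x. 1 / p x)) * \<alpha>)"
  shows "\<exists>m. is_min_of m (SL_spectrum p q r) \<and>
    (\<forall>g. g \<in> Lp \<infinity> \<longrightarrow> (AE x in lebesgue. g x \<ge> 0) \<longrightarrow>
       emeasure lebesgue (Omega r g) * ennreal \<beta> < 1 \<longrightarrow>
       m \<ge> - \<alpha> * enn2real (Linf_norm g) / (1 - measure lebesgue (Omega r g) * \<beta>)) \<and>
    ((\<lambda>x. 1 / r x) \<in> Lp \<infinity> \<longrightarrow>
       emeasure lebesgue (Omega r (\<lambda>x. 1 / r x)) = 0 \<and>
       m \<ge> - (2 * enn2real (unif_norm (neg_part q))
             + 4 * enn2real (Linf_norm (\<lambda>x. 1 / p x)) * (enn2real (unif_norm (neg_part q)))\<^sup>2)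
           * enn2real (Linf_norm (\<lambda>x. 1 / r x)))"
proof -
  define P where "P = enn2real (Linf_norm (\<lambda>x. 1 / p x))"
  define N where "N = enn2real (unif_norm (neg_part q))"
  have pP: "AE x in lebesgue. 0 < p x \<and> 1 / p x \<le> P"
    using Linf_AE[OF p_bdd] hyp_a(1) unfolding P_def by eventually_elim auto
  have "\<exists>x. 0 < p x \<and> 1 / p x \<le> P"
  proof -
    have "ae_filter (lebesgue :: real measure) \<noteq> bot" by (simp add: ae_filter_eq_bot_iff)
    from eventually_happens'[OF this pP] show ?thesis .
  qed
  then have P: "P > 0" by (auto intro: less_le_trans[of 0 "1 / p _"])
  (* Modification on null sets, so that the bounds hold everywhere. *)
  define s where "s x = (if 0 < p x \<and> 1 / p x \<le> P then 1 / p x else P)" for x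
  have s: "0 < s x" "s x \<le> P" for x using P by (auto simp: s_def)
  have sp: "AE x in lebesgue. 0 < p x \<and> s x = 1 / p x" using pP by eventually_elim (auto simp: s_def)
  have smeas: "s \<in> borel_measurable lebesgue"
    by (rule borel_measurable_AE[of "\<lambda>x. 1 / p x"]) (use meas sp in \<open>auto elim: eventually_mono\<close>)
  obtain a b where ab: "0 < essinf (restrict_space lebesgue (- {a..b})) (\<lambda>t. ereal (r t))" using hyp_c(2) by blast
  then obtain y where y: "0 < y" "AE x in restrict_space lebesgue (- {a..b}). y \<le> ereal (r x)"
    unfolding essinf_def less_Sup_iff by blast
  obtain c where c: "0 < ereal c" "ereal c < y" using ereal_dense2[OF y(1)] by blast
  define K where "K = max \<bar>a\<bar> \<bar>b\<bar>"
  have rc: "AE x in lebesgue. 0 < r x \<and> (K < \<bar>x\<bar> \<longrightarrow> c \<le> r x)"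
  proof -
    have "AE x in lebesgue. x \<in> - {a..b} \<longrightarrow> y \<le> ereal (r x)"
      using y(2) by (subst (asm) AE_restrict_space_iff) auto
    with hyp_c(1) show ?thesis
    proof eventually_elim
      case (elim x)
      have "c \<le> r x" if "K < \<bar>x\<bar>"
      proof -
        have "x \<in> - {a..b}" using that by (auto simp: K_def)
        then have "y \<le> ereal (r x)" using elim by blast
        from less_le_trans[OF c(2) this] show ?thesis by simp
      qed
      with elim show ?case by simp
    qed
  qed
  define r' where "r' x = (if 0 < r x \<and> (K < \<bar>x\<bar> \<longrightarrow> c \<le> r x) then r x else c)" for x
  have c0: "c > 0" using c by simp
  have rr': "AE x in lebesgue. r x = r' x" using rc by eventually_elim (auto simp: r'_def)
  have r': "0 < r' x" "K < \<bar>x\<bar> \<Longrightarrow> c \<le> r' x" for x using c0 by (auto simp: r'_def)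
  have locs: "loc_int r" "loc_int q" using loc by (auto simp: loc_int_def L1_loc_def)
  have r'loc: "loc_int r'" by (rule loc_int_cong_AE(1)[OF locs(1) rr'])
  have finq: "unif_norm q < \<infinity>" using hyp_b by (simp add: L1_u_def)
  have "unif_norm (neg_part q) \<le> unif_norm q" by (rule unif_norm_mono) (auto simp: neg_part_def)
  then have finn: "unif_norm (neg_part q) < \<infinity>" using finq by (rule le_less_trans)
  (* A unit interval is covered by two intervals between consecutive integers; hence the factor
     two. *)
  define Q where "Q = 2 * enn2real (unif_norm q)"
  have nloc: "loc_int (neg_part q)" by (rule loc_int_neg_part[OF locs(2)])
  have absq: "loc_int (\<lambda>x. \<bar>q x\<bar>)" using loc_int_norm[OF locs(2)] by simp
  have Q: "(LINT t:{x..x+1}|lebesgue. \<bar>q t\<bar>) \<le> Q" for x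
  proof -
    let ?n = "real_of_int \<lfloor>x\<rfloor>"
    have "(LINT t:{x..x+1}|lebesgue. \<bar>q t\<bar>) \<le> (LINT t:{?n..?n + 2}|lebesgue. \<bar>q t\<bar>)"
    proof (rule lint_mono_interval[OF absq])
      have "?n \<le> x" "x + 1 \<le> ?n + 2" using floor_correct[of x] by linarith+
      then show "{x..x+1} \<subseteq> {?n..?n + 2}" by (simp only: atLeastatMost_subset_iff simp_thms)
    qed simp
    also have "\<dots> = (LINT t:{?n..?n + 1}|lebesgue. \<bar>q t\<bar>) + (LINT t:{?n + 1..?n + 2}|lebesgue. \<bar>q t\<bar>)"
      by (intro lint_combine loc_intD absq) auto
    also have "\<dots> \<le> Q"
      using unif_norm_bound[OF locs(2) finq, of "\<lfloor>x\<rfloor>"] unif_norm_bound[OF locs(2) finq, of "\<lfloor>x\<rfloor> + 1"]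
      by (simp add: Q_def add.assoc)
    finally show ?thesis .
  qed
  have N: "(LINT t:{real_of_int n..real_of_int n + 1}|lebesgue. neg_part q t) \<le> N" for n
  proof -
    have "\<bar>neg_part q t\<bar> = neg_part q t" for t by (auto simp: neg_part_def)
    then show ?thesis using unif_norm_bound[OF nloc finn, of n] by (simp add: N_def)
  qed
  interpret sl: sturm_liouville_operator s q r' P c K N Q p r
    by unfold_locales (fact smeas s r'loc r' c0 locs Q N sp rr')+
  have al: "sl.\<alpha> = \<alpha>" unfolding sl.\<alpha>_def unfolding alpha P_def N_def ..
  have be: "\<beta> = sqrt (4 * P * \<alpha>)" unfolding beta P_def ..
  have bound: "- \<alpha> * enn2real (Linf_norm g) / (1 - measure lebesgue (Omega r g) * \<beta>) \<le> sl.bottom"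
    if g: "g \<in> Lp \<infinity>" and g0: "AE x in lebesgue. g x \<ge> 0" and small: "emeasure lebesgue (Omega r g) * ennreal \<beta> < 1" for g
  proof -
    let ?G = "enn2real (Linf_norm g)" and ?\<Omega> = "Omega r g"
    have [measurable]: "g \<in> borel_measurable lebesgue" "r \<in> borel_measurable lebesgue"
      using g meas by (auto simp: Lp_def)
    have "{x \<in> space lebesgue. r x * g x < 1} \<in> sets lebesgue" by measurable
    then have \<Omega>: "?\<Omega> \<in> sets lebesgue" by (simp add: Omega_def)
    (* If \<open>\<alpha> > 0\<close>, then \<open>\<beta> > 0\<close>, and the smallness condition excludes infinite measure. If
       \<open>\<alpha> = 0\<close>, the measure of \<open>\<Omega>\<close> may be infinite, in which case \<open>measure\<close> is zero by
       convention and the product with \<open>\<beta>\<close> is zero as well. *)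
    have fin: "emeasure lebesgue ?\<Omega> \<noteq> \<infinity>" if "sl.\<alpha> > 0"
    proof
      assume inf: "emeasure lebesgue ?\<Omega> = \<infinity>"
      have "\<beta> > 0" using that P by (simp add: be al)
      then have "emeasure lebesgue ?\<Omega> * ennreal \<beta> = \<infinity>" unfolding inf by (simp add: ennreal_top_mult)
      then show False using small by simp
    qed
    have b0: "\<beta> \<ge> 0" using P sl.alpha_nonneg by (simp add: be al)
    have sm: "measure lebesgue ?\<Omega> * \<beta> < 1"
    proof (cases "emeasure lebesgue ?\<Omega> = \<infinity>")
      case True
      then show ?thesis by (simp add: measure_def)
    next
      case False
      then have e: "emeasure lebesgue ?\<Omega> = ennreal (measure lebesgue ?\<Omega>)"
        unfolding infinity_ennreal_def by (rule emeasure_eq_ennreal_measure)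
      have "emeasure lebesgue ?\<Omega> * ennreal \<beta> = ennreal (measure lebesgue ?\<Omega> * \<beta>)"
        unfolding e by (rule ennreal_mult''[OF b0, symmetric])
      then have "ennreal (measure lebesgue ?\<Omega> * \<beta>) < ennreal 1" using small by (simp only: ennreal_1)
      then show ?thesis using b0 by (subst (asm) ennreal_less_iff) auto
    qed
    have off: "AE x in lebesgue. x \<notin> ?\<Omega> \<longrightarrow> 1 \<le> ?G * r' x"
      using Linf_AE[OF g] rr'
    proof eventually_elim
      case (elim x)
      show ?case
      proof
        assume "x \<notin> ?\<Omega>"
        then have "1 \<le> r' x * g x" using elim by (simp add: Omega_def not_less)
        also have "\<dots> \<le> r' x * ?G" using elim r'(1)[of x] by (intro mult_left_mono) auto
        finally show "1 \<le> ?G * r' x" by (simp add: mult.commute)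
      qed
    qed
    have "- (sl.\<alpha> * ?G / (1 - measure lebesgue ?\<Omega> * sqrt (4 * P * sl.\<alpha>))) \<le> sl.bottom"
    proof (rule sl.bottom_ge)
      fix f w assume fw: "sl.in_form f w"
      show "- (sl.\<alpha> * ?G / (1 - measure lebesgue ?\<Omega> * sqrt (4 * P * sl.\<alpha>))) * sl.mass f \<le> sl.tform f w"
        by (rule sl.form_lower_bound[OF fw enn2real_nonneg \<Omega> fin _ off]) (use sm in \<open>simp_all add: al be\<close>)
    qed
    then show ?thesis by (simp add: al be)
  qed
  have special: "emeasure lebesgue (Omega r (\<lambda>x. 1 / r x)) = 0"
  proof -
    have "AE x in lebesgue. x \<notin> Omega r (\<lambda>x. 1 / r x)"
      using hyp_c(1) by eventually_elim (simp add: Omega_def)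
    moreover have "Omega r (\<lambda>x. 1 / r x) \<in> sets lebesgue"
    proof -
      have [measurable]: "r \<in> borel_measurable lebesgue" by (rule meas)
      have "{x \<in> space lebesgue. r x * (1 / r x) < 1} \<in> sets lebesgue" by measurable
      then show ?thesis by (simp add: Omega_def)
    qed
    ultimately have "Omega r (\<lambda>x. 1 / r x) \<in> null_sets lebesgue" by (simp add: AE_iff_null_sets)
    then show ?thesis by (simp only: null_sets_def mem_Collect_eq)
  qed
  have "- \<alpha> * enn2real (Linf_norm (\<lambda>x. 1 / r x)) \<le> sl.bottom" if "(\<lambda>x. 1 / r x) \<in> Lp \<infinity>"
  proof -
    have "AE x in lebesgue. 1 / r x \<ge> 0" using hyp_c(1) by eventually_elim simp
    from bound[OF that this] special show ?thesis by (simp add: measure_def)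
  qed
  then show ?thesis
    using sl.bottom_is_min bound special unfolding alpha by (intro exI[of _ sl.bottom]) auto
qed

end
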